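(* Let $(H,<)$ be an ultrahomogeneous countable partially ordered set. Then $\operatorname{Aut}(H)$ is freely topologically 2-generated, i.e. it contains two elements $f,g$ which freely generate a dense subgroup of $\operatorname{Aut}(H)$: for every irreducible word $w(a,b)$ the automorphism $w(f,g)$ is not the identity function, and the subgroup $\langle f,g\rangle=\{w(f,g): w \text{ is a word}\}$ is dense in $\operatorname{Aut}(H)$.
   Context: A countable poset $H$ is ultrahomogeneous if every isomorphism between two finite subposets of $H$ extends to an automorphism of $H$. $\operatorname{Aut}(H)$ is the group of automorphisms of $H$, with the topology whose basic open sets are $\{\bar f\in\operatorname{Aut}(H): f\subset\bar f\}$, where $f$ ranges over isomorphisms between finite subposets of $H$ (functions are identified with their graphs). A word of letters $a,b$ is an expression $w(a,b)=c_1^{n_1}c_2^{n_2}\cdots c_k^{n_k}$ with $n_1,\dots,n_k\in\mathbb Z$ and $c_1,\dots,c_k\in\{a,b\}$; it is irreducible if $n_1,\dots,n_k\neq 0$ and $c_i\neq c_{i+1}$ for $i=1,\dots,k-1$. $w(f,g)$ is the automorphism obtained by substituting $f$ for $a$ and $g$ for $b$ and composing.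
   Formalization: "Countable" is taken to mean countably infinite: for a finite poset H the group Aut(H) is finite, so some power of f is the identity and the claim fails (e.g. a two-element antichain); irreducible words are taken to be non-empty. *)

theory Defs
  imports "HOL-Algebra.Bij" "HOL-Analysis.Abstract_Topology" "HOL-Library.Countable_Set"
begin

section \<open>Ultrahomogeneous posets and their automorphism groups\<close>

definition strict_poset :: "'a set \<Rightarrow> ('a \<Rightarrow> 'a \<Rightarrow> bool) \<Rightarrow> bool" where
  "strict_poset H lt \<longleftrightarrow> irreflp_on H lt \<and> transp_on H lt"

definition poset_iso :: "('a \<Rightarrow> 'a \<Rightarrow> bool) \<Rightarrow> 'a set \<Rightarrow> 'a set \<Rightarrow> ('a \<Rightarrow> 'a) \<Rightarrow> bool" where
  "poset_iso lt A B p \<longleftrightarrow> bij_betw p A B \<and> (\<forall>x\<in>A. \<forall>y\<in>A. lt (p x) (p y) \<longleftrightarrow> lt x y)"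

(* As everywhere in Bij, a bijection of H is represented by the HOL function
   that is undefined outside H, so that equality of automorphisms is equality of functions. *)
definition poset_auts :: "'a set \<Rightarrow> ('a \<Rightarrow> 'a \<Rightarrow> bool) \<Rightarrow> ('a \<Rightarrow> 'a) set" where
  "poset_auts H lt = {F \<in> Bij H. poset_iso lt H H F}"

definition Aut_group :: "'a set \<Rightarrow> ('a \<Rightarrow> 'a \<Rightarrow> bool) \<Rightarrow> ('a \<Rightarrow> 'a) monoid" where
  "Aut_group H lt = BijGroup H \<lparr>carrier := poset_auts H lt\<rparr>"

(* An isomorphism between the finite subposets A and B is given by a total HOL function p,
   of which only the restriction to A matters. *)
definition ultrahomogeneous :: "'a set \<Rightarrow> ('a \<Rightarrow> 'a \<Rightarrow> bool) \<Rightarrow> bool" where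
  "ultrahomogeneous H lt \<longleftrightarrow>
     (\<forall>A B p. finite A \<and> A \<subseteq> H \<and> finite B \<and> B \<subseteq> H \<and> poset_iso lt A B p \<longrightarrow>
        (\<exists>F \<in> poset_auts H lt. \<forall>x\<in>A. F x = p x))"

definition Aut_basic_open :: "'a set \<Rightarrow> ('a \<Rightarrow> 'a \<Rightarrow> bool) \<Rightarrow> ('a \<Rightarrow> 'a) set set" where
  "Aut_basic_open H lt =
     {{F \<in> poset_auts H lt. \<forall>x\<in>A. F x = p x} | A B p.
        finite A \<and> A \<subseteq> H \<and> finite B \<and> B \<subseteq> H \<and> poset_iso lt A B p}"

definition Aut_topology :: "'a set \<Rightarrow> ('a \<Rightarrow> 'a \<Rightarrow> bool) \<Rightarrow> ('a \<Rightarrow> 'a) topology" where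
  "Aut_topology H lt = topology_generated_by (Aut_basic_open H lt)"

section \<open>Words in two letters\<close>

datatype letter = LetterA | LetterB

(* The word c1^n1 ... ck^nk is the list [(c1, n1), ..., (ck, nk)]. *)
type_synonym word = "(letter \<times> int) list"

(* The empty word is excluded: it evaluates to the identity. *)
definition irreducible_word :: "word \<Rightarrow> bool" where
  "irreducible_word w \<longleftrightarrow>
     w \<noteq> [] \<and> (\<forall>(c, n) \<in> set w. n \<noteq> 0) \<and> (\<forall>i. Suc i < length w \<longrightarrow> fst (w ! i) \<noteq> fst (w ! Suc i))"

fun subst_letter :: "'g \<Rightarrow> 'g \<Rightarrow> letter \<Rightarrow> 'g" where
  "subst_letter f g LetterA = f"
| "subst_letter f g LetterB = g"

fun word_eval :: "('g, 'm) monoid_scheme \<Rightarrow> 'g \<Rightarrow> 'g \<Rightarrow> word \<Rightarrow> 'g" where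
  "word_eval G f g [] = \<one>\<^bsub>G\<^esub>"
| "word_eval G f g ((c, n) # w) = (subst_letter f g c [^]\<^bsub>G\<^esub> n) \<otimes>\<^bsub>G\<^esub> word_eval G f g w"

definition freely_topologically_2_generated ::
    "('g, 'm) monoid_scheme \<Rightarrow> 'g topology \<Rightarrow> bool" where
  "freely_topologically_2_generated G T \<longleftrightarrow>
     (\<exists>f \<in> carrier G. \<exists>g \<in> carrier G.
        (\<forall>w. irreducible_word w \<longrightarrow> word_eval G f g w \<noteq> \<one>\<^bsub>G\<^esub>) \<and>
        T closure_of {word_eval G f g w | w. True} = topspace T)"

section \<open>Basic facts\<close>

lemma poset_iso_inv_into:
  assumes "poset_iso lt H H F"
  shows "poset_iso lt H H (\<lambda>x\<in>H. inv_into H F x)"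
proof -
  have b: "bij_betw F H H" using assms by (simp add: poset_iso_def)
  have b': "bij_betw (\<lambda>x\<in>H. inv_into H F x) H H"
    using bij_betw_inv_into[OF b] by (simp cong: bij_betw_cong)
  have "lt (inv_into H F x) (inv_into H F y) \<longleftrightarrow> lt x y" if "x \<in> H" "y \<in> H" for x y
  proof -
    have "inv_into H F x \<in> H" "inv_into H F y \<in> H"
      using b that by (auto simp: bij_betw_def inv_into_into)
    then have "lt (F (inv_into H F x)) (F (inv_into H F y)) \<longleftrightarrow> lt (inv_into H F x) (inv_into H F y)"
      using assms unfolding poset_iso_def by blast
    then show ?thesis using b that by (simp add: bij_betw_inv_into_right)
  qed
  with b' show ?thesis by (simp add: poset_iso_def)
qed

lemma subgroup_poset_auts: "subgroup (poset_auts H lt) (BijGroup H)"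
proof (rule group.subgroupI[OF group_BijGroup])
  show "poset_auts H lt \<subseteq> carrier (BijGroup H)"
    by (auto simp: poset_auts_def BijGroup_def)
  have "(\<lambda>x\<in>H. x) \<in> poset_auts H lt"
    by (simp add: poset_auts_def id_Bij poset_iso_def) (simp add: bij_betw_def inj_on_def)
  then show "poset_auts H lt \<noteq> {}" by blast
next
  fix F assume F: "F \<in> poset_auts H lt"
  then have "F \<in> Bij H" "poset_iso lt H H F" by (auto simp: poset_auts_def)
  then show "inv\<^bsub>BijGroup H\<^esub> F \<in> poset_auts H lt"
    using restrict_inv_into_Bij[of F H] poset_iso_inv_into[of lt H F]
    by (simp add: inv_BijGroup poset_auts_def)
next
  fix F G assume FG: "F \<in> poset_auts H lt" "G \<in> poset_auts H lt"
  then have B: "F \<in> Bij H" "G \<in> Bij H" by (auto simp: poset_auts_def)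
  have G: "G x \<in> H" if "x \<in> H" for x
    using Bij_imp_funcset[OF B(2)] that by auto
  have C: "compose H F G \<in> Bij H" using B by (rule compose_Bij)
  then have "bij_betw (compose H F G) H H" by (simp add: Bij_def)
  with C FG B G show "F \<otimes>\<^bsub>BijGroup H\<^esub> G \<in> poset_auts H lt"
    by (auto simp: BijGroup_def poset_auts_def poset_iso_def compose_eq)
qed

lemma group_Aut_group: "group (Aut_group H lt)"
  unfolding Aut_group_def
  using subgroup.subgroup_is_group[OF subgroup_poset_auts group_BijGroup] .

lemma topspace_Aut_topology: "topspace (Aut_topology H lt) = poset_auts H lt"
proof -
  have "poset_auts H lt \<in> Aut_basic_open H lt"
    unfolding Aut_basic_open_def
    by (rule CollectI, rule exI[of _ "{}"], rule exI[of _ "{}"], rule exI[of _ id])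
      (simp add: poset_iso_def)
  moreover have "\<Union>(Aut_basic_open H lt) \<subseteq> poset_auts H lt"
    by (auto simp: Aut_basic_open_def)
  ultimately show ?thesis
    by (auto simp: Aut_topology_def)
qed

(* The generating sets are a base, not merely a subbase. *)
lemma openin_Aut_topology_iff:
  "openin (Aut_topology H lt) U \<longleftrightarrow>
     U \<subseteq> poset_auts H lt \<and> (\<forall>F\<in>U. \<exists>V\<in>Aut_basic_open H lt. F \<in> V \<and> V \<subseteq> U)"
proof
  assume "openin (Aut_topology H lt) U"
  then have "generate_topology_on (Aut_basic_open H lt) U"
    by (simp add: Aut_topology_def openin_topology_generated_by_iff)
  then show "U \<subseteq> poset_auts H lt \<and> (\<forall>F\<in>U. \<exists>V\<in>Aut_basic_open H lt. F \<in> V \<and> V \<subseteq> U)"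
  proof induction
    case Empty
    then show ?case by simp
  next
    case (Int a b)
    have "\<exists>V\<in>Aut_basic_open H lt. F \<in> V \<and> V \<subseteq> a \<inter> b" if F: "F \<in> a \<inter> b" for F
    proof -
      obtain V W where V: "V \<in> Aut_basic_open H lt" "F \<in> V" "V \<subseteq> a"
        and W: "W \<in> Aut_basic_open H lt" "F \<in> W" "W \<subseteq> b"
        using Int F by (meson IntD1 IntD2)
      obtain A p where A: "finite A" "A \<subseteq> H" "V = {F \<in> poset_auts H lt. \<forall>x\<in>A. F x = p x}"
        using V(1) by (auto simp: Aut_basic_open_def)
      obtain B q where B: "finite B" "B \<subseteq> H" "W = {F \<in> poset_auts H lt. \<forall>x\<in>B. F x = q x}"
        using W(1) by (auto simp: Aut_basic_open_def)
      define X where "X = {E \<in> poset_auts H lt. \<forall>x\<in>A \<union> B. E x = F x}"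
      have FA: "F \<in> poset_auts H lt" using V A by auto
      then have FH: "bij_betw F H H" "\<forall>x\<in>H. \<forall>y\<in>H. lt (F x) (F y) \<longleftrightarrow> lt x y"
        by (auto simp: poset_auts_def poset_iso_def)
      have AB: "A \<union> B \<subseteq> H" using A B by blast
      have "bij_betw F (A \<union> B) (F ` (A \<union> B))"
        using FH(1) AB by (meson bij_betw_subset order_refl)
      then have "poset_iso lt (A \<union> B) (F ` (A \<union> B)) F"
        using FH(2) AB unfolding poset_iso_def by blast
      moreover have "F ` (A \<union> B) \<subseteq> H"
        using FH(1) AB by (auto simp: bij_betw_def)
      moreover have "finite (A \<union> B)" "finite (F ` (A \<union> B))" using A B by auto
      ultimately have "X \<in> Aut_basic_open H lt"
        unfolding X_def Aut_basic_open_def using AB by blast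
      moreover have "F \<in> X" using FA by (simp add: X_def)
      moreover have "X \<subseteq> a \<inter> b"
      proof -
        have "X \<subseteq> V" "X \<subseteq> W" using V(2) W(2) by (auto simp: X_def A(3) B(3))
        then show ?thesis using V(3) W(3) by blast
      qed
      ultimately show ?thesis by blast
    qed
    then show ?case using Int by blast
  next
    case (UN K)
    have "\<exists>V\<in>Aut_basic_open H lt. F \<in> V \<and> V \<subseteq> \<Union>K" if F: "F \<in> \<Union>K" for F
    proof -
      obtain k where k: "k \<in> K" "F \<in> k" using F by blast
      then obtain V where "V \<in> Aut_basic_open H lt" "F \<in> V" "V \<subseteq> k" using UN by blast
      with k show ?thesis by blast
    qed
    moreover have "\<Union>K \<subseteq> poset_auts H lt" using UN by blast
    ultimately show ?case by blast
  next
    case (Basis s)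
    then have "s \<subseteq> poset_auts H lt" by (auto simp: Aut_basic_open_def)
    with Basis show ?case by blast
  qed
next
  assume R: "U \<subseteq> poset_auts H lt \<and> (\<forall>F\<in>U. \<exists>V\<in>Aut_basic_open H lt. F \<in> V \<and> V \<subseteq> U)"
  show "openin (Aut_topology H lt) U"
  proof (subst openin_subopen, intro ballI)
    fix F assume "F \<in> U"
    then obtain V where V: "V \<in> Aut_basic_open H lt" "F \<in> V" "V \<subseteq> U" using R by blast
    then have "openin (Aut_topology H lt) V"
      by (simp add: Aut_topology_def topology_generated_by_Basis)
    with V show "\<exists>T. openin (Aut_topology H lt) T \<and> F \<in> T \<and> T \<subseteq> U" by blast
  qed
qed

end

theory Submission
  imports Defs "HOL-Combinatorics.Permutations" "HOL-Library.Nat_Bijection"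
begin

text \<open>
  The first generator \<open>f\<close> is an automorphism that moves every point off to infinity, and the second
  generator \<open>g\<close> is generic, that is, built by finite approximations in which each requirement is met
  at some stage.

  Density.  Suppose that finitely many values of \<open>g\<close> have been fixed, and let \<open>P\<close> be an automorphism and
  \<open>A\<close> a finite set.  For large \<open>N\<close> the sets \<open>f\<^sup>N A\<close> and \<open>f\<^sup>N (P A)\<close> are so remote from the points at which
  \<open>g\<close> or its inverse is known that \<open>g\<close> can still be required to be \<open>f\<^sup>N P f\<^sup>-\<^sup>N\<close> on \<open>f\<^sup>N A\<close>
  (\<open>far_conjugate\<close>).  Then the word \<open>f\<^sup>-\<^sup>N g f\<^sup>N\<close> agrees with \<open>P\<close> on \<open>A\<close>.

  What remote means depends on the poset.  By \<open>directed_or_chain_union\<close> there are only two possibilities: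
  either any two elements have strict upper and lower bounds, or comparability is an
  equivalence relation, so that the poset is a disjoint union of chains.  In a directed poset \<open>f\<close> shifts
  a cofinal and coinitial sequence \<open>\<dots> < c\<^sub>0 < c\<^sub>1 < \<dots>\<close>, and \<open>f\<^sup>N x\<close> is finally above any given point.
  If there are infinitely many chains, then \<open>f\<close> shifts a sequence with one term in each of them, and
  \<open>f\<^sup>N x\<close> is finally incomparable to any given point.  If there are \<open>n \<ge> 2\<close> chains, then \<open>f\<close> permutes
  them cyclically, and \<open>f\<^sup>n\<close> shifts a cofinal and coinitial sequence in each.  In this case a
  partial map \<open>g\<close> also determines a permutation of the chains, which the prescription above has to respect.
  Therefore \<open>g\<close> starts out as a transposition of two chains that are neighbours in the
  cycle; together these permutations generate the symmetric group, and \<open>P\<close> can be composed with a word so that it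
  permutes the chains as \<open>g\<close> does (\<open>chain_permutations_realized\<close>).

  Freeness.  It is enough that, whichever values of \<open>g\<close> have been fixed, each irreducible word can be made to
  move some point.  A point is followed through the word, and whenever the value of \<open>g\<close> at the current
  point is asked for, it is chosen so fresh that the walk keeps away from everything that has been decided
  (\<open>irreducible_walk\<close>).  This needs infinitely many admissible values.  In a union of chains they exist for every
  point.  In a directed poset they need not, because the stabiliser of a finite set can have finite
  orbits; there the walk takes place in a dense chain that is invariant under \<open>f\<close>, and is
  afterwards moved by a power of \<open>f\<close> above all values that have been fixed.
\<close>

section \<open>Automorphisms of an ultrahomogeneous poset\<close>

locale homogeneous_poset =
  fixes H :: "'a set" and lt :: "'a \<Rightarrow> 'a \<Rightarrow> bool"
  assumes strict: "strict_poset H lt"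
    and countable_H: "countable H"
    and infinite_H: "infinite H"
    and homogeneous: "ultrahomogeneous H lt"
begin

abbreviation "G \<equiv> Aut_group H lt"
abbreviation "Auts \<equiv> poset_auts H lt"

sublocale group G
  by (rule group_Aut_group)

lemma carrier_G [simp]: "carrier G = Auts"
  by (simp add: Aut_group_def)

lemma lt_irrefl: "x \<in> H \<Longrightarrow> \<not> lt x x"
  using strict by (auto simp: strict_poset_def dest: irreflp_onD)

lemma lt_trans: "lt x y \<Longrightarrow> lt y z \<Longrightarrow> x \<in> H \<Longrightarrow> y \<in> H \<Longrightarrow> z \<in> H \<Longrightarrow> lt x z"
  using strict by (auto simp: strict_poset_def dest: transp_onD)

lemma lt_asym: "lt x y \<Longrightarrow> x \<in> H \<Longrightarrow> y \<in> H \<Longrightarrow> \<not> lt y x"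
  using lt_trans lt_irrefl by blast

lemma aut_bij: "F \<in> Auts \<Longrightarrow> bij_betw F H H"
  by (simp add: poset_auts_def Bij_def)

lemma aut_closed [simp]: "F \<in> Auts \<Longrightarrow> x \<in> H \<Longrightarrow> F x \<in> H"
  using aut_bij bij_betwE by blast

lemma aut_lt [simp]: "F \<in> Auts \<Longrightarrow> x \<in> H \<Longrightarrow> y \<in> H \<Longrightarrow> lt (F x) (F y) \<longleftrightarrow> lt x y"
  by (simp add: poset_auts_def poset_iso_def)

lemma aut_inj [simp]: "F \<in> Auts \<Longrightarrow> x \<in> H \<Longrightarrow> y \<in> H \<Longrightarrow> F x = F y \<longleftrightarrow> x = y"
  using aut_bij bij_betw_imp_inj_on inj_on_eq_iff by metis

lemma autI:
  assumes "bij_betw F H H" "\<And>x y. x \<in> H \<Longrightarrow> y \<in> H \<Longrightarrow> lt (F x) (F y) \<longleftrightarrow> lt x y"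
  shows "restrict F H \<in> Auts"
  using assms by (auto simp: poset_auts_def Bij_def poset_iso_def cong: bij_betw_cong)

lemma one_apply [simp]: "x \<in> H \<Longrightarrow> \<one>\<^bsub>G\<^esub> x = x"
  by (simp add: Aut_group_def BijGroup_def)

lemma mult_apply [simp]:
  "F \<in> Auts \<Longrightarrow> E \<in> Auts \<Longrightarrow> x \<in> H \<Longrightarrow> (F \<otimes>\<^bsub>G\<^esub> E) x = F (E x)"
  by (simp add: Aut_group_def BijGroup_def poset_auts_def compose_eq)

lemma aut_one [simp]: "\<one>\<^bsub>G\<^esub> \<in> Auts"
  using one_closed by simp

lemma aut_mult [simp]: "F \<in> Auts \<Longrightarrow> E \<in> Auts \<Longrightarrow> F \<otimes>\<^bsub>G\<^esub> E \<in> Auts"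
  using m_closed by simp

lemma aut_inv [simp]: "F \<in> Auts \<Longrightarrow> inv\<^bsub>G\<^esub> F \<in> Auts"
  using inv_closed by simp

lemma aut_pow [simp]: "F \<in> Auts \<Longrightarrow> F [^]\<^bsub>G\<^esub> (n::int) \<in> Auts"
  using int_pow_closed by simp

lemma inv_apply [simp]: "F \<in> Auts \<Longrightarrow> x \<in> H \<Longrightarrow> (inv\<^bsub>G\<^esub> F) (F x) = x"
  using mult_apply[of "inv\<^bsub>G\<^esub> F" F x] l_inv[of F] by simp

lemma apply_inv [simp]: "F \<in> Auts \<Longrightarrow> x \<in> H \<Longrightarrow> F ((inv\<^bsub>G\<^esub> F) x) = x"
  using mult_apply[of F "inv\<^bsub>G\<^esub> F" x] r_inv[of F] by simp

lemma pow_0_apply: "x \<in> H \<Longrightarrow> (F [^]\<^bsub>G\<^esub> (0::int)) x = x"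
  by simp

lemma pow_add_apply:
  "F \<in> Auts \<Longrightarrow> x \<in> H \<Longrightarrow>
    (F [^]\<^bsub>G\<^esub> (m::int)) ((F [^]\<^bsub>G\<^esub> n) x) = (F [^]\<^bsub>G\<^esub> (m + n)) x"
  using int_pow_mult[of F m n] by simp

lemma aut_eqI:
  assumes "F \<in> Auts" "E \<in> Auts" "\<And>x. x \<in> H \<Longrightarrow> F x = E x"
  shows "F = E"
  using assms by (auto simp: poset_auts_def Bij_def intro: extensionalityI)

lemma extend:
  assumes "finite A" "A \<subseteq> H" "\<And>x. x \<in> A \<Longrightarrow> p x \<in> H"
    and "\<And>x y. x \<in> A \<Longrightarrow> y \<in> A \<Longrightarrow> lt (p x) (p y) \<longleftrightarrow> lt x y"
    and "\<And>x y. x \<in> A \<Longrightarrow> y \<in> A \<Longrightarrow> p x = p y \<Longrightarrow> x = y"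
  obtains F where "F \<in> Auts" "\<And>x. x \<in> A \<Longrightarrow> F x = p x"
proof -
  have "inj_on p A" by (rule inj_onI) (fact assms(5))
  then have "poset_iso lt A (p ` A) p"
    unfolding poset_iso_def using assms(4) by (simp add: inj_on_imp_bij_betw)
  moreover have "finite (p ` A)" "p ` A \<subseteq> H" using assms(1,3) by blast+
  ultimately have "\<exists>F\<in>Auts. \<forall>x\<in>A. F x = p x"
    using homogeneous[unfolded ultrahomogeneous_def, rule_format, of A "p ` A" p] assms(1,2)
    by blast
  then show ?thesis using that by blast
qed

text \<open>
  Each piece preserves the order because it is part of an automorphism, so only the relations
  between a point of \<open>S\<close> and a point of \<open>T\<close> have to be compared with those between their images.
\<close>

lemma glue:
  assumes "h \<in> Auts" "k \<in> Auts" "finite S" "S \<subseteq> H" "finite T" "T \<subseteq> H"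
    and "\<And>s t. s \<in> S \<Longrightarrow> t \<in> T \<Longrightarrow> lt (h s) (k t) \<longleftrightarrow> lt s t"
    and "\<And>s t. s \<in> S \<Longrightarrow> t \<in> T \<Longrightarrow> lt (k t) (h s) \<longleftrightarrow> lt t s"
    and "\<And>s t. s \<in> S \<Longrightarrow> t \<in> T \<Longrightarrow> s \<noteq> t \<and> h s \<noteq> k t"
  obtains F where "F \<in> Auts" "\<And>s. s \<in> S \<Longrightarrow> F s = h s" "\<And>t. t \<in> T \<Longrightarrow> F t = k t"
proof -
  define p where "p x = (if x \<in> S then h x else k x)" for x
  have nS: "t \<notin> S" if "t \<in> T" for t using assms(9) that by blast
  obtain F where F: "F \<in> Auts" "\<And>x. x \<in> S \<union> T \<Longrightarrow> F x = p x"
  proof (rule extend[of "S \<union> T" p])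
    fix x y assume "x \<in> S \<union> T" "y \<in> S \<union> T"
    then consider "x \<in> S" "y \<in> S" | "x \<in> S" "y \<in> T" | "x \<in> T" "y \<in> S" | "x \<in> T" "y \<in> T"
      by blast
    then have "(lt (p x) (p y) \<longleftrightarrow> lt x y) \<and> (p x = p y \<longrightarrow> x = y)"
    proof cases
      case 1
      then show ?thesis using assms(1,4) by (simp add: p_def subset_iff)
    next
      case 2
      then show ?thesis using assms(7,9)[of x y] nS by (simp add: p_def)
    next
      case 3
      then show ?thesis using assms(8)[of y x] assms(9)[of y x] nS by (auto simp: p_def)
    next
      case 4
      then show ?thesis using assms(2,6) nS by (simp add: p_def subset_iff)
    qed
    then show "lt (p x) (p y) \<longleftrightarrow> lt x y" "p x = p y \<Longrightarrow> x = y" by auto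
  qed (use assms nS in \<open>auto simp: p_def\<close>)
  show ?thesis
    by (rule that[OF F(1)]) (use F nS in \<open>auto simp: p_def\<close>)
qed

lemma transitive:
  assumes "x \<in> H" "y \<in> H"
  obtains F where "F \<in> Auts" "F x = y"
  using extend[of "{x}" "\<lambda>_. y"] assms lt_irrefl by auto

lemma dual: "homogeneous_poset H (\<lambda>x y. lt y x)"
proof
  show "ultrahomogeneous H (\<lambda>x y. lt y x)"
    unfolding ultrahomogeneous_def
  proof (intro allI impI, elim conjE)
    fix A B :: "'a set" and p
    assume *: "finite A" "A \<subseteq> H" "finite B" "B \<subseteq> H" "poset_iso (\<lambda>x y. lt y x) A B p"
    have "poset_iso lt A B p" using *(5) unfolding poset_iso_def by blast
    then obtain F where F: "F \<in> Auts" "\<forall>x\<in>A. F x = p x"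
      using homogeneous *(1-4) unfolding ultrahomogeneous_def by meson
    then have "F \<in> poset_auts H (\<lambda>x y. lt y x)"
      unfolding poset_auts_def poset_iso_def by blast
    with F(2) show "\<exists>F\<in>poset_auts H (\<lambda>x y. lt y x). \<forall>x\<in>A. F x = p x" by blast
  qed
  show "strict_poset H (\<lambda>x y. lt y x)"
    using strict unfolding strict_poset_def irreflp_on_def transp_on_def by blast
qed (fact countable_H infinite_H)+

definition comparable :: "'a \<Rightarrow> 'a \<Rightarrow> bool" where
  "comparable x y \<longleftrightarrow> x = y \<or> lt x y \<or> lt y x"

lemma comparable_refl [simp]: "comparable x x"
  and comparable_sym: "comparable x y \<Longrightarrow> comparable y x"
  by (auto simp: comparable_def)

lemma aut_comparable [simp]:
  "F \<in> Auts \<Longrightarrow> x \<in> H \<Longrightarrow> y \<in> H \<Longrightarrow> comparable (F x) (F y) \<longleftrightarrow> comparable x y"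
  by (simp add: comparable_def)

section \<open>Directed posets and disjoint unions of chains\<close>

lemma above_everywhere:
  assumes "u \<in> H" "v \<in> H" "lt u v" "x \<in> H"
  obtains y where "y \<in> H" "lt x y"
proof -
  obtain F where "F \<in> Auts" "F u = x" using transitive assms by metis
  then show ?thesis using that[of "F v"] assms aut_lt[of F u v] by simp
qed

text \<open>
  Take some \<open>v' > v\<close>.  The chains \<open>u < v'\<close> and \<open>u < v\<close> are isomorphic, and an automorphism that takes the
  first to the second takes \<open>v\<close> to a point in between.
\<close>

lemma dense:
  assumes "u \<in> H" "v \<in> H" "lt u v"
  obtains w where "w \<in> H" "lt u w" "lt w v"
proof -
  obtain v' where v': "v' \<in> H" "lt v v'" using above_everywhere assms by metis
  then have u: "lt u v'" using lt_trans[of u v v'] assms by blast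
  obtain F where F: "F \<in> Auts" "\<And>x. x \<in> {u, v'} \<Longrightarrow> F x = (if x = u then u else v)"
    by (rule extend[of "{u, v'}" "\<lambda>x. if x = u then u else v"])
       (use assms v' u lt_irrefl lt_asym in \<open>auto split: if_splits\<close>)
  have "u \<noteq> v'" using u lt_irrefl assms by auto
  then have "F u = u" "F v' = v" using F by auto
  then show ?thesis using that[of "F v"] F(1) assms v' aut_lt[of F u v] aut_lt[of F v v'] by simp
qed

text \<open>
  Suppose that no two incomparable elements have an upper bound.  Then \<open>z\<close> is incomparable to both elements
  of a chain \<open>y < y'\<close>.  Moving this chain to \<open>x < y\<close> turns \<open>z\<close> into a point \<open>w\<close> that is incomparable to \<open>x\<close> and
  \<open>y\<close>, hence also to \<open>z\<close>.  Exchanging \<open>y\<close> and \<open>w\<close> in the antichain \<open>y, z, w\<close> moves \<open>x\<close> to a lower bound \<open>x'\<close> of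
  \<open>z\<close> and \<open>w\<close> that is incomparable to \<open>y\<close>.  Both \<open>x\<close> and \<open>x'\<close> are below \<open>z\<close> and therefore comparable; but
  \<open>x \<le> x'\<close> would put \<open>x\<close> below \<open>w\<close>, and \<open>x' < x\<close> would put \<open>x'\<close> below \<open>y\<close>.
\<close>

lemma fork_gives_join:
  assumes V: "x \<in> H" "y \<in> H" "z \<in> H" "lt x y" "lt x z" "\<not> comparable y z"
  obtains a b c where "a \<in> H" "b \<in> H" "c \<in> H" "lt a c" "lt b c" "\<not> comparable a b"
proof (rule ccontr)
  note join = that
  assume "\<not> thesis"
  have below: "comparable a b" if "a \<in> H" "b \<in> H" "c \<in> H" "lt a c" "lt b c" for a b c
    using join that \<open>\<not> thesis\<close> by blast
  obtain y' where y': "y' \<in> H" "lt y y'" using above_everywhere V by metis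
  have zy': "\<not> comparable z y'"
    using V y' below[of y z y'] lt_trans[of y y' z] by (auto simp: comparable_def)
  obtain F where F: "F \<in> Auts" "\<And>u. u \<in> {y, y'} \<Longrightarrow> F u = (if u = y then x else y)"
    by (rule extend[of "{y, y'}" "\<lambda>u. if u = y then x else y"])
       (use V y' lt_irrefl lt_asym in \<open>auto split: if_splits\<close>)
  have "y \<noteq> y'" using y' lt_irrefl by auto
  then have Fy: "F y = x" "F y' = y" using F by auto
  define w where "w = F z"
  have w: "w \<in> H" "\<not> comparable x w" "\<not> comparable y w"
    using F(1) V y' zy' aut_comparable[of F y z] aut_comparable[of F y' z] Fy
    by (auto simp: w_def comparable_def)
  have wz: "\<not> comparable z w"
    using w V below[of x w z] lt_trans[of x z w] by (auto simp: comparable_def)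
  define q where "q u = (if u = y then w else if u = w then y else u)" for u
  obtain E where E: "E \<in> Auts" "\<And>u. u \<in> {y, z, w} \<Longrightarrow> E u = q u"
    by (rule extend[of "{y, z, w}" q])
       (use V w wz lt_irrefl in \<open>auto simp: q_def comparable_def split: if_splits\<close>)
  have Eq: "E y = w" "E z = z" "E w = y"
    using E V w wz by (auto simp: q_def comparable_def)
  define x' where "x' = E x"
  have x': "x' \<in> H" "lt x' z" "lt x' w" "\<not> comparable x' y"
    using E(1) V w aut_lt[of E x z] aut_lt[of E x y] aut_comparable[of E x w] Eq
    by (auto simp: x'_def)
  have "comparable x x'" using below[of x x' z] V x' by blast
  then show False
    using x' V w lt_trans[of x x' w] lt_trans[of x' x y] by (auto simp: comparable_def)
qed

lemma join_gives_fork: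
  assumes "x \<in> H" "y \<in> H" "z \<in> H" "lt y x" "lt z x" "\<not> comparable y z"
  obtains a b c where "a \<in> H" "b \<in> H" "c \<in> H" "lt c a" "lt c b" "\<not> comparable a b"
proof -
  interpret D: homogeneous_poset H "\<lambda>x y. lt y x" by (rule dual)
  have eq: "D.comparable u v \<longleftrightarrow> comparable u v" for u v
    unfolding D.comparable_def comparable_def by blast
  show ?thesis
    by (rule D.fork_gives_join[of x y z]) (use assms that in \<open>unfold eq, blast+\<close>)
qed

lemma incomparable_alike:
  assumes "a \<in> H" "b \<in> H" "\<not> comparable a b" "x \<in> H" "y \<in> H" "\<not> comparable x y"
  obtains F where "F \<in> Auts" "F a = x" "F b = y"
proof -
  have ab: "a \<noteq> b" using assms by auto
  obtain F where F: "F \<in> Auts" "\<And>u. u \<in> {a, b} \<Longrightarrow> F u = (if u = a then x else y)"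
    by (rule extend[of "{a, b}" "\<lambda>u. if u = a then x else y"])
       (use assms lt_irrefl in \<open>auto simp: comparable_def split: if_splits\<close>)
  then show ?thesis using ab that by auto
qed

lemma join_gives_directed:
  assumes "a \<in> H" "b \<in> H" "c \<in> H" "lt a c" "lt b c" "\<not> comparable a b" "x \<in> H" "y \<in> H"
  obtains z where "z \<in> H" "lt x z" "lt y z"
proof (cases "comparable x y")
  case True
  then obtain m where m: "m \<in> H" "m = x \<or> lt x m" "m = y \<or> lt y m"
    using assms by (auto simp: comparable_def)
  obtain z where "z \<in> H" "lt m z" using above_everywhere[OF assms(1,3,4) m(1)] by metis
  then show ?thesis using that[of z] m assms lt_trans[of x m z] lt_trans[of y m z] by blast
next
  case False
  obtain F where "F \<in> Auts" "F a = x" "F b = y"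
    using incomparable_alike[OF assms(1,2,6) assms(7,8) False] by metis
  then show ?thesis using that[of "F c"] aut_lt[of F a c] aut_lt[of F b c] assms by simp
qed

definition directed :: bool where
  "directed \<longleftrightarrow> (\<forall>x\<in>H. \<forall>y\<in>H. (\<exists>z\<in>H. lt x z \<and> lt y z) \<and> (\<exists>z\<in>H. lt z x \<and> lt z y))"

definition chain_union :: bool where
  "chain_union \<longleftrightarrow>
    (\<forall>x\<in>H. \<forall>y\<in>H. \<forall>z\<in>H. comparable x y \<longrightarrow> comparable y z \<longrightarrow> comparable x z)"

text \<open>
  Where comparability fails to be transitive there is a fork or a join, hence one of each.  All
  incomparable pairs being conjugate, every one of them then has an upper and a lower bound.
\<close>

lemma directed_or_chain_union: "directed \<or> chain_union"
proof (rule disjCI)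
  assume "\<not> chain_union"
  then obtain x y z where xyz: "x \<in> H" "y \<in> H" "z \<in> H" "comparable x y" "comparable y z"
    "\<not> comparable x z" by (auto simp: chain_union_def)
  then have "(lt x y \<and> lt z y) \<or> (lt y x \<and> lt y z)"
    using lt_trans[of x y z] lt_trans[of z y x] by (auto simp: comparable_def)
  then obtain a b c where
    J: "a \<in> H" "b \<in> H" "c \<in> H" "lt a c" "lt b c" "\<not> comparable a b"
    using xyz(1-3,6) fork_gives_join[OF xyz(2,1,3)] by blast
  obtain a' b' c' where
    F: "a' \<in> H" "b' \<in> H" "c' \<in> H" "lt c' a'" "lt c' b'" "\<not> comparable a' b'"
    using join_gives_fork[OF J(3,1,2,4,5,6)] by blast
  interpret D: homogeneous_poset H "\<lambda>x y. lt y x" by (rule dual)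
  have eq: "D.comparable u v \<longleftrightarrow> comparable u v" for u v
    unfolding D.comparable_def comparable_def by blast
  show directed
  proof (unfold directed_def, intro ballI conjI)
    fix x y assume xy: "x \<in> H" "y \<in> H"
    show "\<exists>z\<in>H. lt x z \<and> lt y z"
      using join_gives_directed[OF J xy] by blast
    show "\<exists>z\<in>H. lt z x \<and> lt z y"
      using D.join_gives_directed[OF F(1-5) _ xy] F(6) unfolding eq by blast
  qed
qed

end

section \<open>Automorphisms as limits of finite approximations\<close>

context homogeneous_poset
begin

text \<open>
  A Baire category argument in the closed subset of the automorphism group cut out by \<open>ok\<close>.  The pair
  \<open>(h, A)\<close> stands for the basic open set of all automorphisms that agree with \<open>h\<close> on \<open>A\<close>; each
  requirement in \<open>R\<close> contains a dense open set.  Completeness is the requirement that the domain and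
  the range of the limit be all of \<open>H\<close>.
\<close>

lemma generic_automorphism:
  fixes ok :: "('a \<Rightarrow> 'a) \<Rightarrow> 'a set \<Rightarrow> bool" and R :: "(('a \<Rightarrow> 'a) \<Rightarrow> bool) set"
  assumes R: "countable R" and start: "ok h0 A0"
    and aut: "\<And>h A. ok h A \<Longrightarrow> h \<in> Auts"
    and total: "\<And>h A z. ok h A \<Longrightarrow> z \<in> H \<Longrightarrow>
      \<exists>h' A'. ok h' A' \<and> A \<subseteq> A' \<and> (\<forall>a\<in>A. h' a = h a) \<and> z \<in> A' \<and> (\<exists>a\<in>A' \<inter> H. h' a = z)"
    and dense: "\<And>h A D. ok h A \<Longrightarrow> D \<in> R \<Longrightarrow>
      \<exists>h' A'. ok h' A' \<and> A \<subseteq> A' \<and> (\<forall>a\<in>A. h' a = h a) \<and>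
        (\<forall>F\<in>Auts. (\<forall>a\<in>A'. a \<in> H \<longrightarrow> F a = h' a) \<longrightarrow> D F)"
  obtains F where "F \<in> Auts" "\<And>a. a \<in> A0 \<Longrightarrow> a \<in> H \<Longrightarrow> F a = h0 a" "\<And>D. D \<in> R \<Longrightarrow> D F"
proof -
  define e where "e = from_nat_into H"
  have e: "range e = H" and eH: "\<And>n. e n \<in> H"
    using range_from_nat_into[of H] from_nat_into[of H] countable_H infinite_H infinite_imp_nonempty
    by (metis e_def)+
  define D where "D = from_nat_into (insert (\<lambda>_. True) R)"
  have D: "range D = insert (\<lambda>_. True) R"
    using R by (simp add: D_def range_from_nat_into)
  define ext where "ext s t \<longleftrightarrow> snd s \<subseteq> snd t \<and> (\<forall>a\<in>snd s. fst t a = fst s a)"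
    for s t :: "('a \<Rightarrow> 'a) \<times> 'a set"
  define step where "step n s t \<longleftrightarrow> ext s t \<and> e n \<in> snd t \<and> (\<exists>a\<in>snd t \<inter> H. fst t a = e n) \<and>
      (\<forall>F\<in>Auts. (\<forall>a\<in>snd t. a \<in> H \<longrightarrow> F a = fst t a) \<longrightarrow> D n F)"
    for n and s t :: "('a \<Rightarrow> 'a) \<times> 'a set"
  have "\<exists>s. \<forall>n. (ok (fst (s n)) (snd (s n)) \<and> (n = 0 \<longrightarrow> s n = (h0, A0))) \<and> step n (s n) (s (Suc n))"
  proof (rule dependent_nat_choice)
    show "\<exists>x. ok (fst x) (snd x) \<and> (0 = (0::nat) \<longrightarrow> x = (h0, A0))"
      using start by auto
    fix s :: "('a \<Rightarrow> 'a) \<times> 'a set" and n :: nat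
    assume "ok (fst s) (snd s) \<and> (n = 0 \<longrightarrow> s = (h0, A0))"
    then obtain h A where s: "s = (h, A)" "ok h A" by (cases s) auto
    obtain h1 A1 where 1: "ok h1 A1" "A \<subseteq> A1" "\<forall>a\<in>A. h1 a = h a" "e n \<in> A1"
      "\<exists>a\<in>A1 \<inter> H. h1 a = e n"
      using total[OF s(2) eH[of n]] by blast
    have "\<exists>h2 A2. ok h2 A2 \<and> A1 \<subseteq> A2 \<and> (\<forall>a\<in>A1. h2 a = h1 a) \<and>
        (\<forall>F\<in>Auts. (\<forall>a\<in>A2. a \<in> H \<longrightarrow> F a = h2 a) \<longrightarrow> D n F)"
    proof (cases "D n \<in> R")
      case True
      then show ?thesis using dense[OF 1(1)] by blast
    next
      case False
      then have "D n = (\<lambda>_. True)" using D by blast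
      then show ?thesis using 1(1) by auto
    qed
    then obtain h2 A2 where 2: "ok h2 A2" "A1 \<subseteq> A2" "\<forall>a\<in>A1. h2 a = h1 a"
      "\<forall>F\<in>Auts. (\<forall>a\<in>A2. a \<in> H \<longrightarrow> F a = h2 a) \<longrightarrow> D n F" by blast
    have "\<exists>a\<in>A2 \<inter> H. h2 a = e n" using 1(5) 2(2,3) by (metis IntD1 IntD2 IntI subsetD)
    moreover have "ext s (h2, A2)" using 1(2,3) 2(2,3) s(1) by (auto simp: ext_def)
    ultimately have "step n s (h2, A2)" using 1(4) 2(2,4) by (auto simp: step_def)
    then show "\<exists>t. (ok (fst t) (snd t) \<and> (Suc n = 0 \<longrightarrow> t = (h0, A0))) \<and> step n s t"
      using 2(1) by (intro exI[of _ "(h2, A2)"]) simp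
  qed
  then obtain s where s: "\<And>n. ok (fst (s n)) (snd (s n))" "s 0 = (h0, A0)"
    "\<And>n. step n (s n) (s (Suc n))" by blast
  define h where "h n = fst (s n)" for n
  define A where "A n = snd (s n)" for n
  have h: "h n \<in> Auts" for n using aut[OF s(1)] by (simp add: h_def)
  have mono: "A n \<subseteq> A m \<and> (\<forall>a\<in>A n. h m a = h n a)" if "n \<le> m" for n m
    using that
  proof (induction m rule: dec_induct)
    case (step m)
    have "A m \<subseteq> A (Suc m) \<and> (\<forall>a\<in>A m. h (Suc m) a = h m a)"
      using s(3)[of m] by (simp add: step_def ext_def A_def h_def)
    then show ?case using step.IH by (simp add: subset_iff)
  qed simp
  have agree: "h n a = h m a" if "a \<in> A n" "a \<in> A m" for n m a
    using mono[of n m] mono[of m n] that by (metis nat_le_linear)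
  have inA: "e n \<in> A (Suc n)" for n using s(3)[of n] by (simp add: step_def A_def)
  have onto: "\<exists>a\<in>A (Suc n) \<inter> H. h (Suc n) a = e n" for n
    using s(3)[of n] by (simp add: step_def A_def h_def)
  define E where "E x = h (SOME n. x \<in> A n) x" for x
  have E: "E a = h n a" if "a \<in> A n" for a n
    using agree[OF _ that] someI[of "\<lambda>n. a \<in> A n", OF that] by (simp add: E_def)
  have cover: "\<exists>n. x \<in> A n \<and> y \<in> A n" if xy: "x \<in> H" "y \<in> H" for x y
  proof -
    obtain i j where ij: "x = e i" "y = e j" using xy e by blast
    have "x \<in> A (max (Suc i) (Suc j))" "y \<in> A (max (Suc i) (Suc j))"
      using ij inA[of i] inA[of j] mono[of "Suc i" "max (Suc i) (Suc j)"]
        mono[of "Suc j" "max (Suc i) (Suc j)"] by auto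
    then show ?thesis by blast
  qed
  have pres: "(lt (E x) (E y) \<longleftrightarrow> lt x y) \<and> (E x = E y \<longleftrightarrow> x = y) \<and> E x \<in> H"
    if xy: "x \<in> H" "y \<in> H" for x y
  proof -
    obtain n where "x \<in> A n" "y \<in> A n" using cover[OF xy] by blast
    then show ?thesis using h[of n] xy by (simp add: E)
  qed
  have "bij_betw E H H"
    unfolding bij_betw_def
  proof
    show "inj_on E H" using pres by (auto simp: inj_on_def)
    show "E ` H = H"
    proof
      show "E ` H \<subseteq> H" using pres by blast
      show "H \<subseteq> E ` H"
      proof
        fix x assume "x \<in> H"
        then obtain n where n: "x = e n" using e by blast
        obtain a where a: "a \<in> A (Suc n)" "a \<in> H" "h (Suc n) a = e n" using onto[of n] by blast
        then have "E a = x" using E[OF a(1)] n by simp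
        then show "x \<in> E ` H" using a(2) by blast
      qed
    qed
  qed
  then have F: "restrict E H \<in> Auts" using autI pres by blast
  have Fh: "restrict E H a = h n a" if "a \<in> A n" "a \<in> H" for a n
    using that by (simp add: E)
  show ?thesis
  proof (rule that[OF F])
    show "restrict E H a = h0 a" if "a \<in> A0" "a \<in> H" for a
      using Fh[of a 0] that s(2) by (simp add: A_def h_def)
    fix D' assume "D' \<in> R"
    then obtain n where n: "D' = D n" using D by (metis imageE insertI2)
    then show "D' (restrict E H)"
      using s(3)[of n] F Fh[of _ "Suc n"] unfolding step_def A_def h_def by blast
  qed
qed

end

section \<open>Following a word through a finite partial map\<close>

definition rel_int_pow :: "('a \<times> 'a) set \<Rightarrow> int \<Rightarrow> ('a \<times> 'a) set" where
  "rel_int_pow p n = (if n \<ge> 0 then p ^^ nat n else (p\<inverse>) ^^ nat (- n))"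

text \<open>
  \<open>F n\<close> is the \<open>n\<close>-th power of the automorphism substituted for the first letter, and \<open>p\<close> is the part
  known so far of the graph of the automorphism substituted for the second letter.
\<close>

fun walk :: "(int \<Rightarrow> 'a \<Rightarrow> 'a) \<Rightarrow> ('a \<times> 'a) set \<Rightarrow> word \<Rightarrow> 'a \<Rightarrow> 'a \<Rightarrow> bool" where
  "walk F p [] x y \<longleftrightarrow> x = y"
| "walk F p ((LetterA, n) # w) x y \<longleftrightarrow> (\<exists>z. walk F p w x z \<and> y = F n z)"
| "walk F p ((LetterB, n) # w) x y \<longleftrightarrow> (\<exists>z. walk F p w x z \<and> (z, y) \<in> rel_int_pow p n)"

lemma relpow_subset: "(p :: ('a \<times> 'a) set) \<subseteq> q \<Longrightarrow> p ^^ n \<subseteq> q ^^ n"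
  by (induction n) (auto simp: relcomp_mono)

lemma rel_int_pow_mono: "p \<subseteq> q \<Longrightarrow> rel_int_pow p n \<subseteq> rel_int_pow q n"
  unfolding rel_int_pow_def by (simp add: relpow_subset converse_mono)

lemma walk_mono: "p \<subseteq> q \<Longrightarrow> walk F p w x y \<Longrightarrow> walk F q w x y"
proof (induction F p w x y rule: walk.induct)
  case (3 F p n w x y)
  then show ?case using rel_int_pow_mono[of p q n] by auto
qed auto

text \<open>
  If every point outside the domain (the range) of a map in \<open>P\<close> can be given infinitely many values
  (preimages), and no nonzero power of \<open>F\<close> has a fixed point, then every irreducible word can be made to move
  a point: at each step the new value is chosen so fresh that the walk never has to enter the part of
  the map that is already determined.  Only after a power of the first letter, which \<open>F\<close> dictates,
  is there no choice, and therefore the point from which that power departs is chosen such that its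
  translates by small powers are fresh as well.
\<close>

locale walk_space =
  fixes X :: "'a set" and F :: "int \<Rightarrow> 'a \<Rightarrow> 'a" and P :: "('a \<times> 'a) set set"
  assumes infinite_X: "infinite X"
    and F_closed: "x \<in> X \<Longrightarrow> F n x \<in> X"
    and F_0: "x \<in> X \<Longrightarrow> F 0 x = x"
    and F_add: "x \<in> X \<Longrightarrow> F m (F n x) = F (m + n) x"
    and F_free: "x \<in> X \<Longrightarrow> n \<noteq> 0 \<Longrightarrow> F n x \<noteq> x"
    and P_finite: "p \<in> P \<Longrightarrow> finite p"
    and P_extend: "p \<in> P \<Longrightarrow> x \<in> X \<Longrightarrow> x \<notin> Domain p \<Longrightarrow> infinite {y \<in> X. insert (x, y) p \<in> P}"
    and P_converse: "p \<in> P \<Longrightarrow> p\<inverse> \<in> P"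
begin

lemma finite_translates:
  assumes "finite E"
  shows "finite {y \<in> X. \<exists>k. \<bar>k\<bar> \<le> K \<and> F k y \<in> E}"
proof (rule finite_subset)
  show "{y \<in> X. \<exists>k. \<bar>k\<bar> \<le> K \<and> F k y \<in> E} \<subseteq> (\<lambda>(k, e). F (- k) e) ` ({- K..K} \<times> E)"
  proof
    fix y assume "y \<in> {y \<in> X. \<exists>k. \<bar>k\<bar> \<le> K \<and> F k y \<in> E}"
    then obtain k where k: "y \<in> X" "\<bar>k\<bar> \<le> K" "F k y \<in> E" by blast
    have "y = F (- k) (F k y)" using k F_add[of y "- k" k] F_0 by simp
    then show "y \<in> (\<lambda>(k, e). F (- k) e) ` ({- K..K} \<times> E)"
      using k by (intro image_eqI[of _ _ "(k, F k y)"]) auto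
  qed
qed (use assms in simp)

lemma fresh_step:
  assumes "p \<in> P" "y \<in> X" "y \<notin> Domain p" "finite E" "0 \<le> K"
  obtains z where "z \<in> X" "insert (y, z) p \<in> P" "\<And>k. \<bar>k\<bar> \<le> K \<Longrightarrow> F k z \<notin> E"
    "\<And>k. \<bar>k\<bar> \<le> K \<Longrightarrow> k \<noteq> 0 \<Longrightarrow> F k z \<notin> Field (insert (y, z) p)"
    "z \<notin> Domain (insert (y, z) p)"
proof -
  let ?E = "E \<union> Field p \<union> {y}"
  have "finite ?E" using assms P_finite by (simp add: finite_Field)
  then have "infinite ({z \<in> X. insert (y, z) p \<in> P} - {z \<in> X. \<exists>k. \<bar>k\<bar> \<le> K \<and> F k z \<in> ?E})"
    by (intro Diff_infinite_finite finite_translates P_extend[OF assms(1-3)])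
  then obtain z where "z \<in> {z \<in> X. insert (y, z) p \<in> P} - {z \<in> X. \<exists>k. \<bar>k\<bar> \<le> K \<and> F k z \<in> ?E}"
    using infinite_imp_nonempty by blast
  then have z: "z \<in> X" "insert (y, z) p \<in> P" "\<And>k. \<bar>k\<bar> \<le> K \<Longrightarrow> F k z \<notin> ?E" by blast+
  show ?thesis
  proof (rule that[OF z(1,2)])
    show "F k z \<notin> Field (insert (y, z) p)" if "\<bar>k\<bar> \<le> K" "k \<noteq> 0" for k
      using z(3)[OF that(1)] F_free[OF z(1) that(2)] by (auto simp: Field_insert)
    show "z \<notin> Domain (insert (y, z) p)"
      using z(3)[of 0] assms(5) F_0[OF z(1)] by (auto simp: Field_def)
  qed (use z(3) in blast)
qed

lemma fresh_steps:
  assumes "p \<in> P" "y \<in> X" "y \<notin> Domain p" "finite E" "0 \<le> K"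
  shows "\<exists>q\<in>P. \<exists>z\<in>X. p \<subseteq> q \<and> (y, z) \<in> q ^^ Suc j \<and> (\<forall>k. \<bar>k\<bar> \<le> K \<longrightarrow> F k z \<notin> E) \<and>
    (\<forall>k. \<bar>k\<bar> \<le> K \<longrightarrow> k \<noteq> 0 \<longrightarrow> F k z \<notin> Field q) \<and> z \<notin> Domain q"
proof (induction j)
  case 0
  show ?case
  proof (rule fresh_step[OF assms])
    fix z
    assume "z \<in> X" "insert (y, z) p \<in> P" "\<And>k. \<bar>k\<bar> \<le> K \<Longrightarrow> F k z \<notin> E"
      "\<And>k. \<bar>k\<bar> \<le> K \<Longrightarrow> k \<noteq> 0 \<Longrightarrow> F k z \<notin> Field (insert (y, z) p)"
      "z \<notin> Domain (insert (y, z) p)"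
    then show ?thesis by (intro bexI[of _ "insert (y, z) p"] bexI[of _ z]) auto
  qed
next
  case (Suc j)
  then obtain q z where q: "q \<in> P" "z \<in> X" "p \<subseteq> q" "(y, z) \<in> q ^^ Suc j" "z \<notin> Domain q" by blast
  show ?case
  proof (rule fresh_step[OF q(1,2,5) assms(4,5)])
    fix v
    assume v: "v \<in> X" "insert (z, v) q \<in> P" "\<And>k. \<bar>k\<bar> \<le> K \<Longrightarrow> F k v \<notin> E"
      "\<And>k. \<bar>k\<bar> \<le> K \<Longrightarrow> k \<noteq> 0 \<Longrightarrow> F k v \<notin> Field (insert (z, v) q)"
      "v \<notin> Domain (insert (z, v) q)"
    have "(y, z) \<in> insert (z, v) q ^^ Suc j"
      using q(4) relpow_subset[of q "insert (z, v) q" "Suc j"] by blast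
    then have "(y, v) \<in> insert (z, v) q ^^ Suc (Suc j)" by (rule relpow_Suc_I) simp
    then show ?thesis using v q(3) by (intro bexI[of _ "insert (z, v) q"] bexI[of _ v]) auto
  qed
qed

lemma fresh_power:
  assumes "p \<in> P" "y \<in> X" "y \<notin> Field p" "finite E" "0 \<le> K" "n \<noteq> 0"
  obtains q z where "q \<in> P" "z \<in> X" "p \<subseteq> q" "(y, z) \<in> rel_int_pow q n"
    "\<And>k. \<bar>k\<bar> \<le> K \<Longrightarrow> F k z \<notin> E" "\<And>k. \<bar>k\<bar> \<le> K \<Longrightarrow> k \<noteq> 0 \<Longrightarrow> F k z \<notin> Field q"
proof (cases "n > 0")
  case True
  then have n: "nat n = Suc (nat n - 1)" by simp
  have "y \<notin> Domain p" using assms(3) by (auto simp: Field_def)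
  then obtain q z where q: "q \<in> P" "z \<in> X" "p \<subseteq> q" "(y, z) \<in> q ^^ Suc (nat n - 1)"
    "\<forall>k. \<bar>k\<bar> \<le> K \<longrightarrow> F k z \<notin> E" "\<forall>k. \<bar>k\<bar> \<le> K \<longrightarrow> k \<noteq> 0 \<longrightarrow> F k z \<notin> Field q"
    using fresh_steps[OF assms(1,2) _ assms(4,5), of "nat n - 1"] by blast
  have "(y, z) \<in> rel_int_pow q n" using q(4) n True by (simp add: rel_int_pow_def)
  then show ?thesis using that q(1-3,5,6) by blast
next
  case False
  then have n: "nat (- n) = Suc (nat (- n) - 1)" using assms(6) by simp
  have "y \<notin> Domain (p\<inverse>)" using assms(3) by (auto simp: Field_def)
  then obtain q z where q: "q \<in> P" "z \<in> X" "p\<inverse> \<subseteq> q" "(y, z) \<in> q ^^ Suc (nat (- n) - 1)"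
    "\<forall>k. \<bar>k\<bar> \<le> K \<longrightarrow> F k z \<notin> E" "\<forall>k. \<bar>k\<bar> \<le> K \<longrightarrow> k \<noteq> 0 \<longrightarrow> F k z \<notin> Field q"
    using fresh_steps[OF P_converse[OF assms(1)] assms(2) _ assms(4,5), of "nat (- n) - 1"]
    by blast
  show ?thesis
  proof (rule that[of "q\<inverse>" z])
    show "q\<inverse> \<in> P" using q(1) by (rule P_converse)
    show "p \<subseteq> q\<inverse>" using q(3) by (metis converse_converse converse_mono)
    show "(y, z) \<in> rel_int_pow (q\<inverse>) n" using q(4) n False assms(6) by (simp add: rel_int_pow_def)
    show "F k z \<notin> Field (q\<inverse>)" if "\<bar>k\<bar> \<le> K" "k \<noteq> 0" for k
      using q(6) that by simp
  qed (use q(2,5) in blast)+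
qed

text \<open>
  The end point \<open>y\<close> has to be ready for the letter that comes next.  A second letter can be applied freshly
  if \<open>y\<close> is not in the field of the map; before a first letter, whose exponent is bounded by \<open>K\<close>, the translates
  of \<open>y\<close> have to be off the field and off the starting point.
\<close>

lemma reduced_walk:
  assumes "distinct_adj (map fst w)" "\<forall>(c, n)\<in>set w. n \<noteq> 0 \<and> \<bar>n\<bar> \<le> K" "0 \<le> K" "p \<in> P"
  shows "\<exists>q\<in>P. \<exists>x\<in>X. \<exists>y\<in>X. p \<subseteq> q \<and> walk F q w x y \<and> (w \<noteq> [] \<longrightarrow> y \<noteq> x) \<and>
    (w = [] \<or> fst (hd w) = LetterA \<longrightarrow> y \<notin> Field q) \<and>
    (w = [] \<or> fst (hd w) = LetterB \<longrightarrow> (\<forall>k. \<bar>k\<bar> \<le> K \<longrightarrow> k \<noteq> 0 \<longrightarrow> F k y \<notin> Field q \<union> {x}))"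
  using assms(1,2)
proof (induction w)
  case Nil
  have "finite (Field p)" using P_finite[OF assms(4)] by (rule finite_Field)
  then have "infinite (X - {y \<in> X. \<exists>k. \<bar>k\<bar> \<le> K \<and> F k y \<in> Field p})"
    by (intro Diff_infinite_finite finite_translates infinite_X)
  then obtain y where "y \<in> X - {y \<in> X. \<exists>k. \<bar>k\<bar> \<le> K \<and> F k y \<in> Field p}"
    using infinite_imp_nonempty by blast
  then have y: "y \<in> X" "\<And>k. \<bar>k\<bar> \<le> K \<Longrightarrow> F k y \<notin> Field p" by blast+
  have "y \<notin> Field p" using y(2)[of 0] F_0[OF y(1)] assms(3) by simp
  then show ?case using y F_free assms(4) by (intro bexI[of _ p] bexI[of _ y]) auto
next
  case (Cons a w)
  obtain c n where a: "a = (c, n)" by (cases a)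
  have n: "n \<noteq> 0" "\<bar>n\<bar> \<le> K" using Cons.prems(2) a by auto
  have w: "distinct_adj (map fst w)" "w = [] \<or> fst (hd w) \<noteq> c"
    using Cons.prems(1) a by (auto simp: distinct_adj_Cons hd_map)
  obtain q x y where q: "q \<in> P" "x \<in> X" "y \<in> X" "p \<subseteq> q" "walk F q w x y"
    "w = [] \<or> fst (hd w) = LetterA \<longrightarrow> y \<notin> Field q"
    "w = [] \<or> fst (hd w) = LetterB \<longrightarrow> (\<forall>k. \<bar>k\<bar> \<le> K \<longrightarrow> k \<noteq> 0 \<longrightarrow> F k y \<notin> Field q \<union> {x})"
    using Cons.IH[OF w(1)] Cons.prems(2) by auto
  show ?case
  proof (cases c)
    case LetterA
    then have "w = [] \<or> fst (hd w) = LetterB" using w(2) letter.exhaust by blast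
    then have "F n y \<notin> Field q \<union> {x}" using q(7) n by blast
    then show ?thesis using a LetterA q F_closed[OF q(3), of n] by auto
  next
    case LetterB
    then have "w = [] \<or> fst (hd w) = LetterA" using w(2) letter.exhaust by blast
    then have "y \<notin> Field q" using q(6) by blast
    then obtain r z where r: "r \<in> P" "z \<in> X" "q \<subseteq> r" "(y, z) \<in> rel_int_pow r n"
      "\<And>k. \<bar>k\<bar> \<le> K \<Longrightarrow> F k z \<notin> {x}" "\<And>k. \<bar>k\<bar> \<le> K \<Longrightarrow> k \<noteq> 0 \<Longrightarrow> F k z \<notin> Field r"
      using fresh_power[OF q(1,3) _ _ assms(3) n(1), of "{x}"] by auto
    have "walk F r ((c, n) # w) x z"
      using walk_mono[OF r(3) q(5)] r(4) LetterB by auto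
    moreover have "z \<noteq> x" using r(5)[of 0] F_0[OF r(2)] assms(3) by auto
    moreover have "\<forall>k. \<bar>k\<bar> \<le> K \<longrightarrow> k \<noteq> 0 \<longrightarrow> F k z \<notin> Field r \<union> {x}" using r(5,6) by blast
    ultimately show ?thesis using r(1,2,3) q(2,4) a LetterB
      by (intro bexI[of _ r] bexI[of _ x] bexI[of _ z]) auto
  qed
qed

lemma irreducible_walk:
  assumes "irreducible_word w" "p \<in> P"
  obtains q x y where "q \<in> P" "p \<subseteq> q" "x \<in> X" "y \<in> X" "walk F q w x y" "x \<noteq> y"
proof -
  define K where "K = (\<Sum>(c, n)\<leftarrow>w. \<bar>n\<bar>)"
  have K: "0 \<le> K" unfolding K_def by (rule sum_list_nonneg) auto
  have "\<bar>n\<bar> \<le> K" if "(c, n) \<in> set w" for c n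
  proof -
    have "\<bar>n\<bar> \<in> set (map (\<lambda>(c, n). \<bar>n\<bar>) w)" using that by force
    then show ?thesis unfolding K_def by (intro member_le_sum_list) auto
  qed
  then have "\<forall>(c, n)\<in>set w. n \<noteq> 0 \<and> \<bar>n\<bar> \<le> K"
    using assms(1) unfolding irreducible_word_def by blast
  moreover have "distinct_adj (map fst w)"
    unfolding distinct_adj_conv_nth
  proof (intro allI impI)
    fix i assume "Suc i < length (map fst w)"
    then have "Suc i < length w" by simp
    then show "map fst w ! i \<noteq> map fst w ! Suc i"
      using assms(1) by (simp add: irreducible_word_def)
  qed
  moreover have "w \<noteq> []" using assms(1) by (simp add: irreducible_word_def)
  ultimately show ?thesis
    using reduced_walk[of w K p] assms(2) K that by blast
qed

end

section \<open>Words in two automorphisms\<close>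

context homogeneous_poset
begin

lemma subst_letter_closed [simp]: "f \<in> Auts \<Longrightarrow> g \<in> Auts \<Longrightarrow> subst_letter f g c \<in> Auts"
  by (cases c) auto

lemma word_eval_closed [simp]: "f \<in> Auts \<Longrightarrow> g \<in> Auts \<Longrightarrow> word_eval G f g w \<in> Auts"
  by (induction w) auto

lemma word_eval_append:
  "f \<in> Auts \<Longrightarrow> g \<in> Auts \<Longrightarrow>
    word_eval G f g (v @ w) = word_eval G f g v \<otimes>\<^bsub>G\<^esub> word_eval G f g w"
  by (induction v) (auto simp: m_assoc)

lemma relpow_graph:
  assumes "g \<in> Auts" "\<And>u v. (u, v) \<in> p \<Longrightarrow> u \<in> H \<and> g u = v" "x \<in> H" "(x, y) \<in> p ^^ k"
  shows "y = (g [^]\<^bsub>G\<^esub> int k) x"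
  using assms(4)
proof (induction k arbitrary: y)
  case 0
  then show ?case using assms by simp
next
  case (Suc k)
  then obtain z where z: "(x, z) \<in> p ^^ k" "(z, y) \<in> p" by auto
  have "y = (g [^]\<^bsub>G\<^esub> (1::int)) ((g [^]\<^bsub>G\<^esub> int k) x)"
    using assms(2)[OF z(2)] Suc.IH[OF z(1)] assms(1) by simp
  then show ?case using pow_add_apply[OF assms(1,3), of 1 "int k"] by (simp add: add.commute)
qed

lemma pow_inv: "g \<in> Auts \<Longrightarrow> (inv\<^bsub>G\<^esub> g) [^]\<^bsub>G\<^esub> (n::int) = g [^]\<^bsub>G\<^esub> (- n)"
  using int_pow_inv[of g n] int_pow_neg[of g n] by simp

lemma rel_int_pow_graph:
  assumes "g \<in> Auts" "\<And>u v. (u, v) \<in> p \<Longrightarrow> u \<in> H \<and> g u = v" "x \<in> H" "(x, y) \<in> rel_int_pow p n"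
  shows "y = (g [^]\<^bsub>G\<^esub> n) x"
proof (cases "n \<ge> 0")
  case True
  then show ?thesis
    using relpow_graph[OF assms(1-3), where p = p and y = y and k = "nat n"] assms(4)
    by (simp add: rel_int_pow_def)
next
  case False
  have "y = ((inv\<^bsub>G\<^esub> g) [^]\<^bsub>G\<^esub> int (nat (- n))) x"
  proof (rule relpow_graph[of _ "p\<inverse>"])
    show "u \<in> H \<and> (inv\<^bsub>G\<^esub> g) u = v" if "(u, v) \<in> p\<inverse>" for u v
      using assms(1,2) that by force
  qed (use assms False in \<open>auto simp: rel_int_pow_def\<close>)
  then show ?thesis using assms(1) False by (simp add: pow_inv)
qed

lemma walk_eval:
  assumes "f \<in> Auts" "g \<in> Auts" "\<And>u v. (u, v) \<in> p \<Longrightarrow> u \<in> H \<and> g u = v" "x \<in> H"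
    and "walk (\<lambda>n. f [^]\<^bsub>G\<^esub> n) p w x y"
  shows "word_eval G f g w x = y"
  using assms(5)
proof (induction w arbitrary: y)
  case Nil
  then show ?case using assms(4) by simp
next
  case (Cons a w)
  obtain c n where a: "a = (c, n)" by (cases a)
  show ?case
  proof (cases c)
    case LetterA
    then show ?thesis using Cons a assms by auto
  next
    case LetterB
    then obtain z where z: "walk (\<lambda>n. f [^]\<^bsub>G\<^esub> n) p w x z" "(z, y) \<in> rel_int_pow p n"
      using Cons.prems a by auto
    then have "word_eval G f g w x = z" using Cons.IH by blast
    moreover have "z \<in> H" using calculation assms(1,2,4) by (metis aut_closed word_eval_closed)
    ultimately show ?thesis
      using rel_int_pow_graph[OF assms(2,3) _ z(2)] LetterB a assms(1,2,4) by simp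
  qed
qed

text \<open>
  Conversely the value of a word at a point depends on finitely many values of \<open>g\<close> only; this is the
  continuity of word maps.
\<close>

lemma graph_relpow:
  assumes "g \<in> Auts" "x \<in> H"
  shows "\<exists>C. finite C \<and> C \<subseteq> H \<and> (x, (g [^]\<^bsub>G\<^esub> int k) x) \<in> ((\<lambda>u. (u, g u)) ` C) ^^ k"
proof (induction k)
  case 0
  show ?case using assms by (intro exI[of _ "{}"]) simp
next
  case (Suc k)
  let ?gr = "\<lambda>C. (\<lambda>u. (u, g u)) ` C" and ?z = "(g [^]\<^bsub>G\<^esub> int k) x"
  obtain C where C: "finite C" "C \<subseteq> H" "(x, ?z) \<in> ?gr C ^^ k" using Suc by blast
  have "(x, ?z) \<in> ?gr (insert ?z C) ^^ k"
    using C(3) relpow_subset[of "?gr C" "?gr (insert ?z C)" k] by blast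
  moreover have "g ?z = (g [^]\<^bsub>G\<^esub> int (Suc k)) x"
    using pow_add_apply[OF assms, of 1 "int k"] assms(1) by (simp add: add.commute)
  ultimately have "(x, (g [^]\<^bsub>G\<^esub> int (Suc k)) x) \<in> ?gr (insert ?z C) ^^ Suc k"
    by (intro relpow_Suc_I[of x ?z]) auto
  then show ?case using C assms by (intro exI[of _ "insert ?z C"]) simp
qed

lemma graph_rel_int_pow:
  assumes "g \<in> Auts" "x \<in> H"
  shows "\<exists>C. finite C \<and> C \<subseteq> H \<and> (x, (g [^]\<^bsub>G\<^esub> n) x) \<in> rel_int_pow ((\<lambda>u. (u, g u)) ` C) n"
proof (cases "n \<ge> 0")
  case True
  then show ?thesis using graph_relpow[OF assms, of "nat n"] by (simp add: rel_int_pow_def)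
next
  case False
  obtain C where C: "finite C" "C \<subseteq> H"
    "(x, ((inv\<^bsub>G\<^esub> g) [^]\<^bsub>G\<^esub> int (nat (- n))) x) \<in> ((\<lambda>u. (u, (inv\<^bsub>G\<^esub> g) u)) ` C) ^^ nat (- n)"
    using graph_relpow[of "inv\<^bsub>G\<^esub> g" x "nat (- n)"] assms by auto
  have "(\<lambda>u. (u, (inv\<^bsub>G\<^esub> g) u)) ` C \<subseteq> ((\<lambda>u. (u, g u)) ` (inv\<^bsub>G\<^esub> g) ` C)\<inverse>"
  proof
    fix q assume "q \<in> (\<lambda>u. (u, (inv\<^bsub>G\<^esub> g) u)) ` C"
    then obtain u where u: "u \<in> C" "q = (u, (inv\<^bsub>G\<^esub> g) u)" by blast
    then have "g ((inv\<^bsub>G\<^esub> g) u) = u" using C(2) assms(1) by (intro apply_inv) auto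
    then have "((inv\<^bsub>G\<^esub> g) u, u) = (\<lambda>u. (u, g u)) ((inv\<^bsub>G\<^esub> g) u)" by simp
    moreover have "(inv\<^bsub>G\<^esub> g) u \<in> (inv\<^bsub>G\<^esub> g) ` C" using u(1) by (rule imageI)
    ultimately have "((inv\<^bsub>G\<^esub> g) u, u) \<in> (\<lambda>u. (u, g u)) ` (inv\<^bsub>G\<^esub> g) ` C"
      by (rule image_eqI)
    then show "q \<in> ((\<lambda>u. (u, g u)) ` (inv\<^bsub>G\<^esub> g) ` C)\<inverse>" using u(2) by simp
  qed
  then have "(x, ((inv\<^bsub>G\<^esub> g) [^]\<^bsub>G\<^esub> int (nat (- n))) x)
      \<in> ((\<lambda>u. (u, g u)) ` (inv\<^bsub>G\<^esub> g) ` C)\<inverse> ^^ nat (- n)"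
    using C(3) relpow_subset by blast
  then have "(x, (g [^]\<^bsub>G\<^esub> n) x) \<in> rel_int_pow ((\<lambda>u. (u, g u)) ` (inv\<^bsub>G\<^esub> g) ` C) n"
    using False assms(1) by (simp add: rel_int_pow_def pow_inv)
  then show ?thesis using C assms(1) by (intro exI[of _ "(inv\<^bsub>G\<^esub> g) ` C"]) auto
qed

lemma eval_walk:
  assumes "f \<in> Auts" "g \<in> Auts" "x \<in> H"
  shows "\<exists>C. finite C \<and> C \<subseteq> H \<and>
    walk (\<lambda>n. f [^]\<^bsub>G\<^esub> n) ((\<lambda>u. (u, g u)) ` C) w x (word_eval G f g w x)"
proof (induction w)
  case Nil
  show ?case using assms by (intro exI[of _ "{}"]) simp
next
  case (Cons a w)
  obtain c n where a: "a = (c, n)" by (cases a)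
  let ?gr = "\<lambda>C. (\<lambda>u. (u, g u)) ` C" and ?z = "word_eval G f g w x"
  obtain C where C: "finite C" "C \<subseteq> H" "walk (\<lambda>n. f [^]\<^bsub>G\<^esub> n) (?gr C) w x ?z"
    using Cons.IH by blast
  have z: "?z \<in> H" using assms by simp
  show ?case
  proof (cases c)
    case LetterA
    then show ?thesis using C a assms by (intro exI[of _ C]) auto
  next
    case LetterB
    obtain C' where C': "finite C'" "C' \<subseteq> H" "(?z, (g [^]\<^bsub>G\<^esub> n) ?z) \<in> rel_int_pow (?gr C') n"
      using graph_rel_int_pow[OF assms(2) z] by blast
    have "walk (\<lambda>n. f [^]\<^bsub>G\<^esub> n) (?gr (C \<union> C')) w x ?z"
      using C(3) by (rule walk_mono[rotated]) blast
    moreover have "(?z, (g [^]\<^bsub>G\<^esub> n) ?z) \<in> rel_int_pow (?gr (C \<union> C')) n"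
      using C'(3) rel_int_pow_mono[of "?gr C'" "?gr (C \<union> C')" n] by blast
    ultimately show ?thesis
      using C C' a LetterB assms by (intro exI[of _ "C \<union> C'"]) auto
  qed
qed

lemma word_eval_continuous:
  assumes "f \<in> Auts" "g \<in> Auts" "finite B" "B \<subseteq> H"
  obtains C where "finite C" "C \<subseteq> H"
    "\<And>g' x. g' \<in> Auts \<Longrightarrow> (\<And>u. u \<in> C \<Longrightarrow> g' u = g u) \<Longrightarrow> x \<in> B \<Longrightarrow>
      word_eval G f g' w x = word_eval G f g w x"
proof -
  have "\<forall>x\<in>B. \<exists>C. finite C \<and> C \<subseteq> H \<and>
      walk (\<lambda>n. f [^]\<^bsub>G\<^esub> n) ((\<lambda>u. (u, g u)) ` C) w x (word_eval G f g w x)"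
  proof
    fix x assume "x \<in> B"
    then have "x \<in> H" using assms(4) by blast
    then show "\<exists>C. finite C \<and> C \<subseteq> H \<and>
        walk (\<lambda>n. f [^]\<^bsub>G\<^esub> n) ((\<lambda>u. (u, g u)) ` C) w x (word_eval G f g w x)"
      by (rule eval_walk[OF assms(1,2)])
  qed
  from bchoice[OF this] obtain C where C: "\<And>x. x \<in> B \<Longrightarrow> finite (C x)" "\<And>x. x \<in> B \<Longrightarrow> C x \<subseteq> H"
    "\<And>x. x \<in> B \<Longrightarrow> walk (\<lambda>n. f [^]\<^bsub>G\<^esub> n) ((\<lambda>u. (u, g u)) ` C x) w x (word_eval G f g w x)"
    by blast
  show ?thesis
  proof (rule that[of "\<Union>(C ` B)"])
    fix g' x assume *: "g' \<in> Auts" "\<And>u. u \<in> \<Union>(C ` B) \<Longrightarrow> g' u = g u" "x \<in> B"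
    show "word_eval G f g' w x = word_eval G f g w x"
    proof (rule walk_eval[OF assms(1) *(1)])
      show "walk (\<lambda>n. f [^]\<^bsub>G\<^esub> n) ((\<lambda>u. (u, g u)) ` C x) w x (word_eval G f g w x)"
        by (rule C(3)[OF *(3)])
      show "u \<in> H \<and> g' u = v" if "(u, v) \<in> (\<lambda>u. (u, g u)) ` C x" for u v
      proof -
        have u: "u \<in> C x" "v = g u" using that by auto
        then have "u \<in> \<Union>(C ` B)" using *(3) by blast
        from *(2)[OF this] show ?thesis using u C(2)[OF *(3)] by blast
      qed
      show "x \<in> H" using *(3) assms(4) by blast
    qed
  next
    show "finite (\<Union>(C ` B))" using assms(3) C(1) by simp
    show "\<Union>(C ` B) \<subseteq> H" using C(2) by blast
  qed
qed

end

section \<open>What the two generators have to satisfy\<close>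

context homogeneous_poset
begin

lemma countable_words: "countable (UNIV :: word set)"
proof -
  have "(UNIV :: letter set) = {LetterA, LetterB}" by (auto intro: letter.exhaust)
  then have "countable (UNIV :: letter set)" by (metis countable_finite finite.emptyI finite.insertI)
  then have "countable ((UNIV :: letter set) \<times> (UNIV :: int set))"
    by (intro countable_SIGMA) auto
  then have "countable (UNIV :: (letter \<times> int) set)" by (simp only: UNIV_Times_UNIV)
  then have "countable (lists (UNIV :: (letter \<times> int) set))" by (rule countable_lists)
  then show ?thesis by (simp only: lists_UNIV)
qed

lemma dense_in_Aut:
  assumes S: "S \<subseteq> Auts"
    and approx: "\<And>A P. finite A \<Longrightarrow> A \<subseteq> H \<Longrightarrow> P \<in> Auts \<Longrightarrow> \<exists>F\<in>S. \<forall>a\<in>A. F a = P a"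
  shows "Aut_topology H lt closure_of S = topspace (Aut_topology H lt)"
proof
  show "Aut_topology H lt closure_of S \<subseteq> topspace (Aut_topology H lt)"
    by (rule closure_of_subset_topspace)
  show "topspace (Aut_topology H lt) \<subseteq> Aut_topology H lt closure_of S"
  proof
    fix P assume P: "P \<in> topspace (Aut_topology H lt)"
    then have PA: "P \<in> Auts" by (simp add: topspace_Aut_topology)
    have "\<exists>F\<in>S. F \<in> U" if U: "P \<in> U" "openin (Aut_topology H lt) U" for U
    proof -
      obtain V where V: "V \<in> Aut_basic_open H lt" "P \<in> V" "V \<subseteq> U"
        using U unfolding openin_Aut_topology_iff by blast
      then obtain A p where A: "finite A" "A \<subseteq> H" "V = {F \<in> Auts. \<forall>x\<in>A. F x = p x}"
        unfolding Aut_basic_open_def by blast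
      obtain F where F: "F \<in> S" "\<forall>a\<in>A. F a = P a" using approx[OF A(1,2) PA] by blast
      then have "F \<in> V" using V(2) A(3) S by auto
      then show ?thesis using F(1) V(3) by blast
    qed
    then show "P \<in> Aut_topology H lt closure_of S"
      using P by (simp add: in_closure_of) blast
  qed
qed

text \<open>
  The second generator is generic among the automorphisms that agree with \<open>h0\<close> on \<open>C0\<close>; the word maps
  being continuous, it is enough to treat one partial isomorphism or one word at a time.
\<close>

lemma generated_by_generic:
  assumes f: "f \<in> Auts" and h0: "h0 \<in> Auts" and C0: "finite C0" "C0 \<subseteq> H"
    and dens: "\<And>h C P A. h \<in> Auts \<Longrightarrow> finite C \<Longrightarrow> C \<subseteq> H \<Longrightarrow> (\<And>c. c \<in> C0 \<Longrightarrow> h c = h0 c) \<Longrightarrow>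
      C0 \<subseteq> C \<Longrightarrow> P \<in> Auts \<Longrightarrow> finite A \<Longrightarrow> A \<subseteq> H \<Longrightarrow>
      \<exists>h'\<in>Auts. (\<forall>c\<in>C. h' c = h c) \<and> (\<exists>w. \<forall>a\<in>A. word_eval G f h' w a = P a)"
    and free: "\<And>h C w. h \<in> Auts \<Longrightarrow> finite C \<Longrightarrow> C \<subseteq> H \<Longrightarrow> irreducible_word w \<Longrightarrow>
      \<exists>h'\<in>Auts. (\<forall>c\<in>C. h' c = h c) \<and> (\<exists>x\<in>H. word_eval G f h' w x \<noteq> x)"
  shows "freely_topologically_2_generated G (Aut_topology H lt)"
proof -
  define realized where "realized xs F \<longleftrightarrow>
      ((\<exists>P\<in>Auts. \<forall>(a, b)\<in>set xs. P a = b) \<longrightarrow> (\<exists>w. \<forall>(a, b)\<in>set xs. word_eval G f F w a = b))"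
    for xs :: "('a \<times> 'a) list" and F
  define faithful where "faithful w F \<longleftrightarrow> (irreducible_word w \<longrightarrow> word_eval G f F w \<noteq> \<one>\<^bsub>G\<^esub>)"
    for w F
  define R where "R = realized ` lists (H \<times> H) \<union> range faithful"
  define ok where "ok h C \<longleftrightarrow> h \<in> Auts \<and> finite C \<and> C \<subseteq> H \<and> C0 \<subseteq> C \<and> (\<forall>c\<in>C0. h c = h0 c)"
    for h C
  have ok_extend: "ok h' C'"
    if "ok h C" "h' \<in> Auts" "\<forall>c\<in>C. h' c = h c" "finite C'" "C' \<subseteq> H" "C \<subseteq> C'" for h C h' C'
    using that by (auto simp: ok_def subset_iff)
  have open_dense: "\<exists>h' C'. ok h' C' \<and> C \<subseteq> C' \<and> (\<forall>c\<in>C. h' c = h c) \<and>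
      (\<forall>F\<in>Auts. (\<forall>c\<in>C'. c \<in> H \<longrightarrow> F c = h' c) \<longrightarrow> D F)"
    if ok: "ok h C" and D: "h' \<in> Auts" "\<forall>c\<in>C. h' c = h c" "finite B" "B \<subseteq> H"
      "\<And>F. F \<in> Auts \<Longrightarrow> (\<And>x. x \<in> B \<Longrightarrow> word_eval G f F w x = word_eval G f h' w x) \<Longrightarrow> D F"
    for h C h' B w D
  proof -
    obtain C' where C': "finite C'" "C' \<subseteq> H"
      "\<And>g' x. g' \<in> Auts \<Longrightarrow> (\<And>u. u \<in> C' \<Longrightarrow> g' u = h' u) \<Longrightarrow> x \<in> B \<Longrightarrow>
        word_eval G f g' w x = word_eval G f h' w x"
      using word_eval_continuous[OF f D(1,3,4), of w] by blast
    have C: "finite C" "C \<subseteq> H" using ok by (auto simp: ok_def)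
    have "D F" if F: "F \<in> Auts" "\<forall>c\<in>C \<union> C'. c \<in> H \<longrightarrow> F c = h' c" for F
    proof (rule D(5)[OF F(1)])
      fix x assume "x \<in> B"
      then show "word_eval G f F w x = word_eval G f h' w x"
        by (rule C'(3)[OF F(1), rotated]) (use F(2) C'(2) in auto)
    qed
    moreover have "ok h' (C \<union> C')"
      by (rule ok_extend[OF ok D(1,2)]) (use C C' in auto)
    ultimately show ?thesis using D(2) by (intro exI[of _ h'] exI[of _ "C \<union> C'"]) auto
  qed
  obtain g where g: "g \<in> Auts" "\<And>D. D \<in> R \<Longrightarrow> D g"
  proof (rule generic_automorphism[of R ok h0 C0])
    show "countable R"
      using countable_words countable_H unfolding R_def
      by (intro countable_Un countable_image countable_lists countable_SIGMA)
    show "ok h0 C0" using h0 C0 by (simp add: ok_def)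
    show "h \<in> Auts" if "ok h A" for h A using that by (simp add: ok_def)
    show "\<exists>h' A'. ok h' A' \<and> A \<subseteq> A' \<and> (\<forall>a\<in>A. h' a = h a) \<and> z \<in> A' \<and> (\<exists>a\<in>A' \<inter> H. h' a = z)"
      if ok: "ok h A" and z: "z \<in> H" for h A z
    proof -
      have h: "h \<in> Auts" "finite A" "A \<subseteq> H" using ok by (auto simp: ok_def)
      let ?v = "(inv\<^bsub>G\<^esub> h) z"
      have v: "?v \<in> H" "h ?v = z" using h(1) z by auto
      have "ok h (A \<union> {z, ?v})"
        by (rule ok_extend[OF ok]) (use h z v in auto)
      then show ?thesis using v by (intro exI[of _ h] exI[of _ "A \<union> {z, ?v}"]) auto
    qed
    show "\<exists>h' A'. ok h' A' \<and> A \<subseteq> A' \<and> (\<forall>a\<in>A. h' a = h a) \<and>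
        (\<forall>F\<in>Auts. (\<forall>a\<in>A'. a \<in> H \<longrightarrow> F a = h' a) \<longrightarrow> D F)"
      if ok: "ok h A" and D: "D \<in> R" for h A D
    proof -
      have h: "h \<in> Auts" "finite A" "A \<subseteq> H" "C0 \<subseteq> A" "\<And>c. c \<in> C0 \<Longrightarrow> h c = h0 c"
        using ok by (auto simp: ok_def)
      consider xs where "xs \<in> lists (H \<times> H)" "D = realized xs" | w where "D = faithful w"
        using D by (auto simp: R_def)
      then show ?thesis
      proof cases
        case 1
        show ?thesis
        proof (cases "\<exists>P\<in>Auts. \<forall>(a, b)\<in>set xs. P a = b")
          case True
          then obtain P where P: "P \<in> Auts" "\<forall>(a, b)\<in>set xs. P a = b" by blast
          have B: "finite (fst ` set xs)" "fst ` set xs \<subseteq> H" using 1(1) by auto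
          obtain h' w where h': "h' \<in> Auts" "\<forall>c\<in>A. h' c = h c"
            "\<forall>a\<in>fst ` set xs. word_eval G f h' w a = P a"
            using dens[OF h(1,2,3,5,4) P(1) B] by blast
          show ?thesis
          proof (rule open_dense[OF ok h'(1,2) B, of w])
            fix F assume F: "F \<in> Auts"
              "\<And>x. x \<in> fst ` set xs \<Longrightarrow> word_eval G f F w x = word_eval G f h' w x"
            have "word_eval G f F w a = b" if "(a, b) \<in> set xs" for a b
            proof -
              have "a \<in> fst ` set xs" using that by force
              moreover have "P a = b" using P(2) that by auto
              ultimately show ?thesis using F(2) h'(3) by simp
            qed
            then show "D F" unfolding 1(2) realized_def by auto
          qed
        next
          case False
          then have "D F" for F unfolding 1(2) realized_def by blast
          then show ?thesis using ok by (intro exI[of _ h] exI[of _ A]) simp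
        qed
      next
        case 2
        show ?thesis
        proof (cases "irreducible_word w")
          case True
          obtain h' x where h': "h' \<in> Auts" "\<forall>c\<in>A. h' c = h c" "x \<in> H" "word_eval G f h' w x \<noteq> x"
            using free[OF h(1,2,3) True] by blast
          show ?thesis
          proof (rule open_dense[OF ok h'(1,2), of "{x}" w])
            fix F assume F: "F \<in> Auts"
              "\<And>y. y \<in> {x} \<Longrightarrow> word_eval G f F w y = word_eval G f h' w y"
            have "word_eval G f F w x \<noteq> \<one>\<^bsub>G\<^esub> x" using F(2)[of x] h'(3,4) by simp
            then show "D F" unfolding 2 faithful_def by metis
          qed (use h'(3) in auto)
        next
          case False
          then have "D F" for F using 2 by (simp add: faithful_def)
          then show ?thesis using ok by (intro exI[of _ h] exI[of _ A]) simp
        qed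
      qed
    qed
  qed blast
  have "word_eval G f g w \<noteq> \<one>\<^bsub>G\<^esub>" if "irreducible_word w" for w
    using g(2)[of "faithful w"] that by (simp add: R_def faithful_def)
  moreover have "Aut_topology H lt closure_of {word_eval G f g w | w. True} = topspace (Aut_topology H lt)"
  proof (rule dense_in_Aut)
    show "{word_eval G f g w | w. True} \<subseteq> Auts" using f g(1) by auto
    fix A P assume A: "finite A" "A \<subseteq> H" "P \<in> Auts"
    obtain as where as: "set as = A" using finite_list[OF A(1)] by blast
    define xs where "xs = map (\<lambda>a. (a, P a)) as"
    have "(a, P a) \<in> H \<times> H" if "a \<in> set as" for a
      using that as A(2) aut_closed[OF A(3), of a] by blast
    then have "xs \<in> lists (H \<times> H)" by (auto simp: xs_def)
    then have "realized xs g" using g(2)[of "realized xs"] by (simp add: R_def)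
    moreover have "\<forall>(a, b)\<in>set xs. P a = b" by (auto simp: xs_def)
    ultimately obtain w where "\<forall>(a, b)\<in>set xs. word_eval G f g w a = b"
      using A(3) unfolding realized_def by blast
    then have "\<forall>a\<in>A. word_eval G f g w a = P a" using as by (auto simp: xs_def)
    then show "\<exists>F\<in>{word_eval G f g w | w. True}. \<forall>a\<in>A. F a = P a" by blast
  qed
  ultimately show ?thesis
    unfolding freely_topologically_2_generated_def using f g(1) carrier_G by blast
qed

end

section \<open>An automorphism under which everything escapes to infinity\<close>

text \<open>
  A frame is a sequence \<open>c\<close> along which an automorphism can shift the whole poset; \<open>pos x r lo hi\<close> says
  that the position of \<open>x\<close> relative to \<open>c\<close> can be read off from \<open>c lo, \<dots>, c hi\<close>.  Two points at
  disjoint positions are related according to their residues \<open>r\<close> modulo \<open>n\<close> alone: the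
  earlier is below the later one if their residues agree, and otherwise they are incomparable.
  In a directed poset \<open>n = 1\<close> and \<open>c\<close> is cofinal and coinitial.  In a union of \<open>n\<close> infinite chains \<open>c\<close>
  visits the chains cyclically, and is cofinal and coinitial in each.  In a union of infinitely
  many chains \<open>n = 0\<close> and \<open>c\<close> has one term in each chain.
\<close>

locale frame = homogeneous_poset +
  fixes c :: "int \<Rightarrow> 'a" and n :: int and pos :: "'a \<Rightarrow> int \<Rightarrow> int \<Rightarrow> int \<Rightarrow> bool"
  assumes c_closed [simp]: "c i \<in> H"
    and pos_c: "pos (c i) i i i"
    and pos_mono: "pos x r lo hi \<Longrightarrow> lo' \<le> lo \<Longrightarrow> hi \<le> hi' \<Longrightarrow> pos x r lo' hi'"
    and pos_ex: "x \<in> H \<Longrightarrow> \<exists>r lo hi. pos x r lo hi"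
    and pos_shift: "x \<in> H \<Longrightarrow> F \<in> Auts \<Longrightarrow> (\<And>i. lo \<le> i \<Longrightarrow> i \<le> hi \<Longrightarrow> F (c i) = c (i + d)) \<Longrightarrow>
      pos x r lo hi \<Longrightarrow> pos (F x) (r + d) (lo + d) (hi + d)"
    and pos_less: "x \<in> H \<Longrightarrow> y \<in> H \<Longrightarrow> pos x r lo hi \<Longrightarrow> pos y s lo' hi' \<Longrightarrow> hi < lo' \<Longrightarrow>
      x \<noteq> y \<and> \<not> lt y x \<and> (lt x y \<longleftrightarrow> n dvd s - r)"
begin

text \<open>
  The window on which \<open>c\<close> is shifted can be enlarged because the relations of a point to the terms of \<open>c\<close>
  beyond its position depend on residues only, and the shift changes all residues by the same amount.
\<close>

lemma shift_extend:
  assumes h: "h \<in> Auts" "\<And>i. \<bar>i\<bar> \<le> k \<Longrightarrow> h (c i) = c (i + 1)"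
    and A: "finite A" "A \<subseteq> H" "\<And>a. a \<in> A \<Longrightarrow> \<exists>r. pos a r (- k) k" and k: "0 \<le> k"
  obtains h' where "h' \<in> Auts" "\<And>a. a \<in> A \<Longrightarrow> h' a = h a" "\<And>i. \<bar>i\<bar> \<le> k + 1 \<Longrightarrow> h' (c i) = c (i + 1)"
proof -
  define S where "S = A \<union> c ` {- k..k}"
  have S: "finite S" "S \<subseteq> H" using A by (auto simp: S_def)
  have hS: "\<exists>r. pos s r (- k) k \<and> pos (h s) (r + 1) (- k + 1) (k + 1)" if s: "s \<in> S" for s
  proof -
    obtain r where r: "pos s r (- k) k"
    proof (cases "s \<in> A")
      case True
      then show ?thesis using A(3) that by blast
    next
      case False
      then obtain i where "s = c i" "- k \<le> i" "i \<le> k" using s by (auto simp: S_def)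
      then show ?thesis using pos_mono[OF pos_c, of "- k" i k] that by blast
    qed
    moreover have "pos (h s) (r + 1) (- k + 1) (k + 1)"
      by (rule pos_shift[OF _ h(1) _ r]) (use s S h(2) in auto)
    ultimately show ?thesis by blast
  qed
  obtain up where up: "up \<in> Auts" "up (c (k + 1)) = c (k + 2)"
    using transitive[of "c (k + 1)" "c (k + 2)"] by auto
  obtain F where F: "F \<in> Auts" "\<And>s. s \<in> S \<Longrightarrow> F s = h s"
    "\<And>t. t \<in> {c (k + 1)} \<Longrightarrow> F t = up t"
  proof (rule glue[OF h(1) up(1) S, of "{c (k + 1)}"])
    fix s t assume st: "s \<in> S" "t \<in> {c (k + 1)}"
    obtain r where r: "pos s r (- k) k" "pos (h s) (r + 1) (- k + 1) (k + 1)" using hS st by blast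
    have s: "s \<in> H" "h s \<in> H" using S st h(1) by auto
    have 1: "s \<noteq> t \<and> \<not> lt t s \<and> (lt s t \<longleftrightarrow> n dvd (k + 1) - r)"
      using pos_less[OF s(1) _ r(1) pos_c, of "k + 1"] st by simp
    have 2: "h s \<noteq> up t \<and> \<not> lt (up t) (h s) \<and> (lt (h s) (up t) \<longleftrightarrow> n dvd (k + 2) - (r + 1))"
      using pos_less[OF s(2) _ r(2) pos_c, of "k + 2"] st up(2) by simp
    have 3: "(k + 2) - (r + 1) = (k + 1) - r" by simp
    show "lt (h s) (up t) \<longleftrightarrow> lt s t" using 1 2 unfolding 3 by blast
    show "lt (up t) (h s) \<longleftrightarrow> lt t s" "s \<noteq> t \<and> h s \<noteq> up t" using 1 2 by blast+
  qed auto
  define T where "T = insert (c (k + 1)) S"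
  have T: "finite T" "T \<subseteq> H" using S by (auto simp: T_def)
  have FT: "\<exists>r. pos s r (- k) (k + 1) \<and> pos (F s) (r + 1) (- k + 1) (k + 2)" if s: "s \<in> T" for s
  proof (cases "s \<in> S")
    case True
    then obtain r where "pos s r (- k) k" "pos (h s) (r + 1) (- k + 1) (k + 1)" using hS by blast
    then have "pos s r (- k) (k + 1)" "pos (h s) (r + 1) (- k + 1) (k + 2)"
      by (auto elim: pos_mono)
    then show ?thesis using F(2)[OF True] by auto
  next
    case False
    then have "s = c (k + 1)" "F s = c (k + 2)" using s F(3) up(2) by (auto simp: T_def)
    then show ?thesis
      using pos_mono[OF pos_c[of "k + 1"], of "- k" "k + 1"] pos_mono[OF pos_c[of "k + 2"], of "- k + 1" "k + 2"] k
      by (intro exI[of _ "k + 1"]) (auto simp: add.commute)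
  qed
  obtain dn where dn: "dn \<in> Auts" "dn (c (- k - 1)) = c (- k)"
    using transitive[of "c (- k - 1)" "c (- k)"] by auto
  obtain E where E: "E \<in> Auts" "\<And>s. s \<in> T \<Longrightarrow> E s = F s"
    "\<And>t. t \<in> {c (- k - 1)} \<Longrightarrow> E t = dn t"
  proof (rule glue[OF F(1) dn(1) T, of "{c (- k - 1)}"])
    fix s t assume st: "s \<in> T" "t \<in> {c (- k - 1)}"
    obtain r where r: "pos s r (- k) (k + 1)" "pos (F s) (r + 1) (- k + 1) (k + 2)"
      using FT st by blast
    have s: "s \<in> H" "F s \<in> H" using T st F(1) by auto
    have 1: "t \<noteq> s \<and> \<not> lt s t \<and> (lt t s \<longleftrightarrow> n dvd r - (- k - 1))"
      using pos_less[OF _ s(1) pos_c r(1), of "- k - 1"] st by simp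
    have 2: "dn t \<noteq> F s \<and> \<not> lt (F s) (dn t) \<and> (lt (dn t) (F s) \<longleftrightarrow> n dvd (r + 1) - (- k))"
      using pos_less[OF _ s(2) pos_c r(2), of "- k"] st dn(2) by simp
    have 3: "(r + 1) - (- k) = r - (- k - 1)" by simp
    show "lt (dn t) (F s) \<longleftrightarrow> lt t s" using 1 2 unfolding 3 by blast
    show "lt (F s) (dn t) \<longleftrightarrow> lt s t" "s \<noteq> t \<and> F s \<noteq> dn t" using 1 2 by metis+
  qed auto
  show ?thesis
  proof (rule that[OF E(1)])
    show "E a = h a" if "a \<in> A" for a using that E(2) F(2) by (simp add: S_def T_def)
    show "E (c i) = c (i + 1)" if i: "\<bar>i\<bar> \<le> k + 1" for i
    proof -
      consider "i = k + 1" | "i = - k - 1" | "\<bar>i\<bar> \<le> k" using i by linarith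
      then show ?thesis
      proof cases
        case 1
        then have "E (c i) = F (c i)" "F (c i) = up (c i)" using E(2) F(3) by (auto simp: T_def)
        then show ?thesis using 1 up(2) by (simp add: add.commute)
      next
        case 2
        then show ?thesis using E(3) dn(2) by simp
      next
        case 3
        then have "c i \<in> S" unfolding S_def by (intro UnI2 imageI) auto
        then show ?thesis using E(2) F(2) h(2)[OF 3] by (simp add: T_def)
      qed
    qed
  qed
qed

lemma shift_extend_far:
  assumes h: "h \<in> Auts" "\<And>i. \<bar>i\<bar> \<le> int k \<Longrightarrow> h (c i) = c (i + 1)"
    and A: "finite A" "A \<subseteq> H" "\<And>a. a \<in> A \<Longrightarrow> \<exists>r. pos a r (- int k) (int k)"
  shows "\<exists>h'\<in>Auts. (\<forall>a\<in>A. h' a = h a) \<and> (\<forall>i. \<bar>i\<bar> \<le> int (k + m) \<longrightarrow> h' (c i) = c (i + 1))"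
proof (induction m)
  case 0
  show ?case using h by auto
next
  case (Suc m)
  then obtain h1 where h1: "h1 \<in> Auts" "\<forall>a\<in>A. h1 a = h a"
    "\<And>i. \<bar>i\<bar> \<le> int (k + m) \<Longrightarrow> h1 (c i) = c (i + 1)" by blast
  have pos: "\<exists>r. pos a r (- int (k + m)) (int (k + m))" if "a \<in> A" for a
  proof -
    obtain r where "pos a r (- int k) (int k)" using A(3)[OF \<open>a \<in> A\<close>] by blast
    then show ?thesis by (intro exI[of _ r], elim pos_mono) auto
  qed
  obtain h2 where "h2 \<in> Auts" "\<And>a. a \<in> A \<Longrightarrow> h2 a = h1 a"
    "\<And>i. \<bar>i\<bar> \<le> int (k + m) + 1 \<Longrightarrow> h2 (c i) = c (i + 1)"
    by (rule shift_extend[OF h1(1,3) A(1,2) pos]) auto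
  then show ?case using h1(2) by (intro bexI[of _ h2]) auto
qed

lemma c_inj: "c i = c j \<Longrightarrow> i = j"
  using pos_less[OF c_closed c_closed pos_c pos_c, of i j]
    pos_less[OF c_closed c_closed pos_c pos_c, of j i]
  by (cases i j rule: linorder_cases) auto

text \<open>
  At each stage the shift of \<open>c\<close> is prescribed on a window \<open>-k, \<dots>, k\<close> only, large enough to determine the positions
  of all points treated so far.  Before a point is added the window is enlarged until it also
  determines the positions of this point and of its preimage.
\<close>

lemma shift_exists:
  obtains f where "f \<in> Auts" "\<And>i. f (c i) = c (i + 1)"
proof -
  define ok where "ok h A \<longleftrightarrow> h \<in> Auts \<and> finite A \<and> A \<subseteq> H \<and>
      (\<exists>k. (\<forall>i. \<bar>i\<bar> \<le> int k \<longrightarrow> h (c i) = c (i + 1)) \<and> (\<forall>a\<in>A. \<exists>r. pos a r (- int k) (int k)))"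
    for h A
  have grow: "\<exists>h' A'. ok h' A' \<and> A \<subseteq> A' \<and> (\<forall>a\<in>A. h' a = h a) \<and> z \<in> A' \<and> (\<exists>a\<in>A' \<inter> H. h' a = z) \<and>
      (\<forall>i. z = c i \<longrightarrow> h' (c i) = c (i + 1))"
    if ok: "ok h A" and z: "z \<in> H" for h A z
  proof -
    obtain k where h: "h \<in> Auts" "finite A" "A \<subseteq> H" "\<And>i. \<bar>i\<bar> \<le> int k \<Longrightarrow> h (c i) = c (i + 1)"
      "\<And>a. a \<in> A \<Longrightarrow> \<exists>r. pos a r (- int k) (int k)" using ok unfolding ok_def by blast
    obtain r lo hi where r: "pos z r lo hi" using pos_ex[OF z] by blast
    obtain j where j: "\<And>i. z = c i \<Longrightarrow> i = j" using c_inj by metis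
    define m where "m = nat (\<bar>lo\<bar> + \<bar>hi\<bar> + \<bar>j\<bar>) + 1"
    have m: "\<bar>lo\<bar> + 1 \<le> int m" "\<bar>hi\<bar> + 1 \<le> int m" "\<bar>j\<bar> \<le> int m" by (auto simp: m_def)
    obtain h' where h': "h' \<in> Auts" "\<forall>a\<in>A. h' a = h a"
      "\<And>i. \<bar>i\<bar> \<le> int (k + m) \<Longrightarrow> h' (c i) = c (i + 1)"
      using shift_extend_far[OF h(1,4,2,3,5), of m] by blast
    let ?v = "(inv\<^bsub>G\<^esub> h') z"
    have v: "?v \<in> H" "h' ?v = z" using h'(1) z by auto
    have "pos ?v (r + - 1) (lo + - 1) (hi + - 1)"
    proof (rule pos_shift[OF z _ _ r])
      fix i assume "lo \<le> i" "i \<le> hi"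
      then have "\<bar>i - 1\<bar> \<le> int (k + m)" using m by auto
      then have "h' (c (i - 1)) = c i" using h'(3)[of "i - 1"] by simp
      then show "(inv\<^bsub>G\<^esub> h') (c i) = c (i + - 1)" using inv_apply[OF h'(1), of "c (i - 1)"] by simp
    qed (use h'(1) in simp)
    then have 1: "pos ?v (r + - 1) (- int (k + m)) (int (k + m))"
      by (rule pos_mono) (use m in auto)
    have 2: "pos z r (- int (k + m)) (int (k + m))"
      by (rule pos_mono[OF r]) (use m in auto)
    have 3: "\<exists>r. pos a r (- int (k + m)) (int (k + m))" if "a \<in> A" for a
    proof -
      obtain r where "pos a r (- int k) (int k)" using h(5)[OF \<open>a \<in> A\<close>] by blast
      then show ?thesis by (intro exI[of _ r], elim pos_mono) auto
    qed
    have "ok h' (A \<union> {z, ?v})"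
      unfolding ok_def
      using h'(1,3) h(2,3) z v 1 2 3 by (intro conjI exI[of _ "k + m"]) blast+
    moreover have "h' (c i) = c (i + 1)" if "z = c i" for i
    proof -
      have "i = j" by (rule j) (fact that)
      then show ?thesis using h'(3) m by simp
    qed
    ultimately show ?thesis using h'(2) v by (intro exI[of _ h'] exI[of _ "A \<union> {z, ?v}"]) auto
  qed
  obtain h0 where h0: "h0 \<in> Auts" "h0 (c 0) = c 1" using transitive[of "c 0" "c 1"] by auto
  obtain f where f: "f \<in> Auts" "\<And>D. D \<in> range (\<lambda>i F. F (c i) = c (i + 1)) \<Longrightarrow> D f"
  proof (rule generic_automorphism[of "range (\<lambda>i F. F (c i) = c (i + 1))" ok h0 "{}"])
    show "countable (range (\<lambda>i F. F (c i) = c (i + 1)))" by simp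
    show "ok h0 {}" using h0 unfolding ok_def by (intro conjI exI[of _ 0]) auto
    show "h \<in> Auts" if "ok h A" for h A using that by (simp add: ok_def)
    show "\<exists>h' A'. ok h' A' \<and> A \<subseteq> A' \<and> (\<forall>a\<in>A. h' a = h a) \<and> z \<in> A' \<and> (\<exists>a\<in>A' \<inter> H. h' a = z)"
      if "ok h A" "z \<in> H" for h A z
      using grow[OF that] by blast
    show "\<exists>h' A'. ok h' A' \<and> A \<subseteq> A' \<and> (\<forall>a\<in>A. h' a = h a) \<and>
        (\<forall>F\<in>Auts. (\<forall>a\<in>A'. a \<in> H \<longrightarrow> F a = h' a) \<longrightarrow> D F)"
      if okA: "ok h A" and D: "D \<in> range (\<lambda>i F. F (c i) = c (i + 1))" for h A D
    proof -
      obtain i where i: "D = (\<lambda>F. F (c i) = c (i + 1))" using D by blast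
      obtain h' A' where *: "ok h' A'" "A \<subseteq> A'" "\<forall>a\<in>A. h' a = h a" "c i \<in> A'"
        "h' (c i) = c (i + 1)"
        using grow[OF okA c_closed, of i] by auto
      have "D F" if "\<forall>a\<in>A'. a \<in> H \<longrightarrow> F a = h' a" for F
        using that *(4,5) i by simp
      then show ?thesis using *(1,2,3) by blast
    qed
  qed blast
  show ?thesis using that[OF f(1)] f(2) by blast
qed

end

locale shifted_frame = frame +
  fixes f :: "'a \<Rightarrow> 'a"
  assumes f [simp]: "f \<in> Auts" and f_c: "f (c i) = c (i + 1)"
begin

abbreviation shift :: "int \<Rightarrow> 'a \<Rightarrow> 'a" where
  "shift m \<equiv> f [^]\<^bsub>G\<^esub> m"

lemma shift_c: "shift m (c i) = c (i + m)"
proof -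
  have up: "shift (int k) (c i) = c (i + int k)" for k i
  proof (induction k)
    case (Suc k)
    have "shift (int (Suc k)) (c i) = f (shift (int k) (c i))"
      using pow_add_apply[OF f c_closed, of 1 "int k" i] by (simp add: add.commute)
    then show ?case using Suc f_c by (simp add: algebra_simps)
  qed simp
  show ?thesis
  proof (cases "m \<ge> 0")
    case True
    then show ?thesis using up[of "nat m" i] by simp
  next
    case False
    have "shift m (c i) = shift m (shift (- m) (c (i + m)))"
      using up[of "nat (- m)" "i + m"] False by simp
    also have "\<dots> = c (i + m)" using pow_add_apply[OF f c_closed, of m "- m" "i + m"] by simp
    finally show ?thesis .
  qed
qed

lemma pos_shift_f: "x \<in> H \<Longrightarrow> pos x r lo hi \<Longrightarrow> pos (shift m x) (r + m) (lo + m) (hi + m)"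
  by (rule pos_shift) (auto simp: shift_c)

text \<open>A periodic point would have two disjoint positions, and be different from itself.\<close>

lemma shift_no_fixpoint:
  assumes "x \<in> H" "m \<noteq> 0"
  shows "shift m x \<noteq> x"
proof
  assume fix_x: "shift m x = x"
  have iter: "shift (m * int j) x = x" for j
  proof (induction j)
    case (Suc j)
    then show ?case
      using pow_add_apply[OF f assms(1), of m "m * int j"] fix_x by (simp add: algebra_simps)
  qed (use assms in simp)
  obtain r lo hi where r: "pos x r lo hi" using pos_ex assms(1) by blast
  define j where "j = nat (\<bar>hi\<bar> + \<bar>lo\<bar>) + 1"
  have d: "pos x (r + m * int j) (lo + m * int j) (hi + m * int j)"
    using pos_shift_f[OF assms(1) r, of "m * int j"] iter by simp
  have "hi < lo + m * int j \<or> hi + m * int j < lo"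
  proof (cases "m > 0")
    case True
    then have "int j \<le> m * int j" by (simp add: mult_le_cancel_right1)
    then show ?thesis by (auto simp: j_def)
  next
    case False
    then have "int j \<le> (- m) * int j" using assms(2) by (intro mult_le_cancel_right1[THEN iffD2]) auto
    then show ?thesis by (auto simp: j_def)
  qed
  then show False using pos_less[OF assms(1,1) r d] pos_less[OF assms(1,1) d r] by blast
qed

text \<open>
  A high power of the shift brings \<open>A\<close> beyond the positions of all points of \<open>C\<close>, and \<open>P A\<close> beyond those of
  \<open>h C\<close>.  At such a distance only the residues can cause a conflict, and \<open>compat\<close> excludes it.
\<close>

lemma far_conjugate:
  assumes h: "h \<in> Auts" and P: "P \<in> Auts" and A: "finite A" "A \<subseteq> H" and C: "finite C" "C \<subseteq> H"
    and rk: "\<And>x. x \<in> H \<Longrightarrow> \<exists>lo hi. pos x (rk x) lo hi"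
    and compat: "\<And>B. \<exists>N\<ge>B.
      \<forall>a\<in>A. \<forall>u\<in>C. n dvd rk a + N - rk u \<longleftrightarrow> n dvd rk (P a) + N - rk (h u)"
  obtains h' N where "h' \<in> Auts" "\<And>u. u \<in> C \<Longrightarrow> h' u = h u"
    "\<And>a. a \<in> A \<Longrightarrow> h' (shift N a) = shift N (P a)"
proof -
  define X where "X = A \<union> P ` A \<union> C \<union> h ` C"
  have X: "finite X" "X \<subseteq> H" using A C h P by (auto simp: X_def)
  obtain lo hi where pos: "\<And>x. x \<in> H \<Longrightarrow> pos x (rk x) (lo x) (hi x)" using rk by metis
  define L where "L = Min (insert 0 (lo ` X))"
  define U where "U = Max (insert 0 (hi ` X))"
  have LU: "pos x (rk x) L U" if "x \<in> X" for x
    by (rule pos_mono[OF pos]) (use that X in \<open>auto simp: L_def U_def\<close>)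
  obtain N where N: "U - L + 1 \<le> N"
    "\<And>a u. a \<in> A \<Longrightarrow> u \<in> C \<Longrightarrow> n dvd rk a + N - rk u \<longleftrightarrow> n dvd rk (P a) + N - rk (h u)"
    using compat[of "U - L + 1"] by blast
  define k where "k = shift N \<otimes>\<^bsub>G\<^esub> (P \<otimes>\<^bsub>G\<^esub> shift (- N))"
  have k: "k \<in> Auts" using P by (simp add: k_def)
  have kA: "k (shift N a) = shift N (P a)" if "a \<in> A" for a
    using that A P pow_add_apply[OF f, of a "- N" N] by (auto simp: k_def)
  obtain F where "F \<in> Auts" "\<And>s. s \<in> C \<Longrightarrow> F s = h s" "\<And>t. t \<in> shift N ` A \<Longrightarrow> F t = k t"
  proof (rule glue[OF h k C, of "shift N ` A"])
    fix s t assume st: "s \<in> C" "t \<in> shift N ` A"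
    then obtain a where a: "a \<in> A" "t = shift N a" by blast
    have Xs: "s \<in> X" "h s \<in> X" "a \<in> X" "P a \<in> X" using st a by (auto simp: X_def)
    then have H: "s \<in> H" "h s \<in> H" "a \<in> H" "P a \<in> H" using X(2) by blast+
    have t: "t \<in> H" "k t = shift N (P a)" "k t \<in> H" using a kA H by auto
    have 1: "pos t (rk a + N) (L + N) (U + N)" using pos_shift_f[OF H(3) LU[OF Xs(3)]] a by simp
    have 2: "pos (k t) (rk (P a) + N) (L + N) (U + N)"
      using pos_shift_f[OF H(4) LU[OF Xs(4)]] t by simp
    have 3: "s \<noteq> t \<and> \<not> lt t s \<and> (lt s t \<longleftrightarrow> n dvd rk a + N - rk s)"
      by (rule pos_less[OF H(1) t(1) LU[OF Xs(1)] 1]) (use N in auto)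
    have 4: "h s \<noteq> k t \<and> \<not> lt (k t) (h s) \<and> (lt (h s) (k t) \<longleftrightarrow> n dvd rk (P a) + N - rk (h s))"
      by (rule pos_less[OF H(2) t(3) LU[OF Xs(2)] 2]) (use N in auto)
    show "lt (h s) (k t) \<longleftrightarrow> lt s t" using 3 4 N(2)[OF a(1) st(1)] by blast
    show "lt (k t) (h s) \<longleftrightarrow> lt t s" "s \<noteq> t \<and> h s \<noteq> k t" using 3 4 by blast+
  qed (use A in auto)
  then show ?thesis using that[of F N] kA by auto
qed

lemma conjugate_word:
  assumes "h \<in> Auts" "a \<in> H" "P \<in> Auts" "h (shift N a) = shift N (P a)"
  shows "word_eval G f h [(LetterA, - N), (LetterB, 1), (LetterA, N)] a = P a"
  using assms pow_add_apply[OF f, of "P a" "- N" N] by simp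

end

section \<open>Cofinal sequences and directed posets\<close>

context homogeneous_poset
begin

lemma finite_maximal:
  assumes "finite S" "S \<noteq> {}" "S \<subseteq> H"
  shows "\<exists>m\<in>S. \<forall>y\<in>S. \<not> lt m y"
  using assms
proof (induction S rule: finite_ne_induct)
  case (singleton x)
  then show ?case using lt_irrefl by auto
next
  case (insert x F)
  then obtain m where m: "m \<in> F" "\<forall>y\<in>F. \<not> lt m y" by blast
  then have H: "m \<in> H" "x \<in> H" "F \<subseteq> H" using insert.prems by auto
  show ?case
  proof (cases "lt m x")
    case True
    have "\<not> lt x y" if "y \<in> F" for y
      using lt_trans[OF True, of y] m(2) H that by blast
    then show ?thesis using lt_irrefl[OF H(2)] by blast
  next
    case False
    then show ?thesis using m by blast
  qed
qed

lemma infinite_if_no_maximal: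
  assumes "S \<subseteq> H" "S \<noteq> {}" "\<And>y. y \<in> S \<Longrightarrow> \<exists>z\<in>S. lt y z"
  shows "infinite S"
  using finite_maximal[of S] assms by blast

lemma cofinal_sequence:
  assumes Y: "Y \<subseteq> H" "y0 \<in> Y" and dir: "\<And>x y. x \<in> Y \<Longrightarrow> y \<in> Y \<Longrightarrow> \<exists>z\<in>Y. lt x z \<and> lt y z"
  obtains u :: "nat \<Rightarrow> 'a" where "u 0 = y0" "\<And>k. u k \<in> Y" "\<And>j k. j < k \<Longrightarrow> lt (u j) (u k)"
    "\<And>y. y \<in> Y \<Longrightarrow> \<exists>k. lt y (u k)"
proof -
  define e where "e = from_nat_into Y"
  have ne: "Y \<noteq> {}" using Y(2) by blast
  have e: "range e = Y" "\<And>n. e n \<in> Y"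
    using range_from_nat_into[OF ne] from_nat_into[OF ne] countable_subset[OF Y(1) countable_H]
    by (auto simp: e_def)
  have "\<exists>u. \<forall>k. (u k \<in> Y \<and> (k = 0 \<longrightarrow> u k = y0)) \<and> (lt (u k) (u (Suc k)) \<and> lt (e k) (u (Suc k)))"
  proof (rule dependent_nat_choice)
    show "\<exists>x. x \<in> Y \<and> (0 = (0::nat) \<longrightarrow> x = y0)" using Y(2) by blast
    show "\<exists>y. (y \<in> Y \<and> (Suc k = 0 \<longrightarrow> y = y0)) \<and> (lt x y \<and> lt (e k) y)"
      if "x \<in> Y \<and> (k = 0 \<longrightarrow> x = y0)" for x k
      using dir[of x "e k"] that e(2) by blast
  qed
  then obtain u where u: "\<And>k. u k \<in> Y" "u 0 = y0" "\<And>k. lt (u k) (u (Suc k))"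
    "\<And>k. lt (e k) (u (Suc k))" by blast
  have H: "u k \<in> H" for k using u(1) Y(1) by blast
  have "lt (u j) (u k)" if "j < k" for j k
    using that
  proof (induction k)
    case (Suc k)
    show ?case
    proof (cases "j = k")
      case True
      then show ?thesis using u(3) by simp
    next
      case False
      then have "lt (u j) (u k)" using Suc by simp
      then show ?thesis using lt_trans[OF _ u(3)] H by blast
    qed
  qed simp
  moreover have "\<exists>k. lt y (u k)" if y: "y \<in> Y" for y
  proof -
    obtain k where "y = e k" using y e(1) by blast
    then show ?thesis using u(4) by blast
  qed
  ultimately show ?thesis using that u(1,2) by blast
qed

lemma cofinal_coinitial_sequence:
  assumes Y: "Y \<subseteq> H" "Y \<noteq> {}"
    and up: "\<And>x y. x \<in> Y \<Longrightarrow> y \<in> Y \<Longrightarrow> \<exists>z\<in>Y. lt x z \<and> lt y z"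
    and down: "\<And>x y. x \<in> Y \<Longrightarrow> y \<in> Y \<Longrightarrow> \<exists>z\<in>Y. lt z x \<and> lt z y"
  obtains c :: "int \<Rightarrow> 'a" where "\<And>i. c i \<in> Y" "\<And>i j. lt (c i) (c j) \<longleftrightarrow> i < j"
    "\<And>y. y \<in> Y \<Longrightarrow> \<exists>i j. lt (c i) y \<and> lt y (c j)"
proof -
  interpret D: homogeneous_poset H "\<lambda>x y. lt y x" by (rule dual)
  obtain y0 where y0: "y0 \<in> Y" using Y(2) by blast
  obtain u :: "nat \<Rightarrow> 'a" where u: "u 0 = y0" "\<And>k. u k \<in> Y" "\<And>j k. j < k \<Longrightarrow> lt (u j) (u k)"
    "\<And>y. y \<in> Y \<Longrightarrow> \<exists>k. lt y (u k)"
    using cofinal_sequence[OF Y(1) y0 up] by blast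
  obtain d :: "nat \<Rightarrow> 'a" where d: "d 0 = y0" "\<And>k. d k \<in> Y" "\<And>j k. j < k \<Longrightarrow> lt (d k) (d j)"
    "\<And>y. y \<in> Y \<Longrightarrow> \<exists>k. lt (d k) y"
    using D.cofinal_sequence[OF Y(1) y0 down] by blast
  define c where "c i = (if i \<ge> 0 then u (nat i) else d (nat (- i)))" for i
  have cY: "c i \<in> Y" for i using u(2) d(2) by (simp add: c_def)
  then have cH: "c i \<in> H" for i using Y(1) by blast
  have mono: "lt (c i) (c j)" if ij: "i < j" for i j
  proof -
    consider "0 \<le> i" | "j \<le> 0" | "i < 0" "0 < j" by linarith
    then show ?thesis
    proof cases
      case 1
      then show ?thesis using ij u(3) by (simp add: c_def)
    next
      case 2
      then have "c j = d (nat (- j))" using u(1) d(1) by (auto simp: c_def)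
      then show ?thesis using ij 2 d(3)[of "nat (- j)" "nat (- i)"] by (simp add: c_def)
    next
      case 3
      have "lt (c i) y0" "lt y0 (c j)"
        using 3 d(3)[of 0 "nat (- i)"] u(3)[of 0 "nat j"] u(1) d(1) by (auto simp: c_def)
      moreover have "y0 \<in> H" using y0 Y(1) by blast
      ultimately show ?thesis using lt_trans[of "c i" y0 "c j"] cH by blast
    qed
  qed
  show ?thesis
  proof (rule that[OF cY])
    show "lt (c i) (c j) \<longleftrightarrow> i < j" for i j
      using mono[of i j] mono[of j i] lt_asym[of "c i" "c j"] lt_irrefl[of "c i"] cH
      by (cases i j rule: linorder_cases) auto
    fix y assume "y \<in> Y"
    then obtain k l where kl: "lt y (u k)" "lt (d l) y" using u(4)[of y] d(4)[of y] by blast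
    have "c (int k) = u k" "c (- int l) = d l" using u(1) d(1) by (auto simp: c_def)
    then show "\<exists>i j. lt (c i) y \<and> lt y (c j)" using kl by metis
  qed
qed

text \<open>
  The position of \<open>x\<close> relative to a sequence that is cofinal and coinitial in each chain: terms with indices between
  \<open>lo\<close> and \<open>hi\<close>, congruent to \<open>r\<close> modulo \<open>n\<close>, enclose \<open>x\<close>.
\<close>

definition squeezed :: "(int \<Rightarrow> 'a) \<Rightarrow> int \<Rightarrow> 'a \<Rightarrow> int \<Rightarrow> int \<Rightarrow> int \<Rightarrow> bool" where
  "squeezed c n x r lo hi \<longleftrightarrow> (\<exists>i j. lo \<le> i \<and> i \<le> hi \<and> lo \<le> j \<and> j \<le> hi \<and>
    n dvd i - r \<and> n dvd j - r \<and> (c i = x \<or> lt (c i) x) \<and> (x = c j \<or> lt x (c j)))"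

text \<open>
  Two points at disjoint positions with the same residue are separated by a chain of terms of \<open>c\<close>; if the residues differ,
  then the points lie in different chains.
\<close>

lemma frame_of_cofinal_sequence:
  fixes c :: "int \<Rightarrow> 'a"
  assumes n: "n > 0" and c: "\<And>i. c i \<in> H" "\<And>i j. lt (c i) (c j) \<longleftrightarrow> i < j \<and> n dvd j - i"
    and cof: "\<And>x. x \<in> H \<Longrightarrow> \<exists>i j. lt (c i) x \<and> lt x (c j)"
    and cases: "n = 1 \<or> chain_union"
  shows "frame H lt c n (squeezed c n)"
proof -
  let ?pos = "\<lambda>x r lo hi. \<exists>i j. lo \<le> i \<and> i \<le> hi \<and> lo \<le> j \<and> j \<le> hi \<and>
    n dvd i - r \<and> n dvd j - r \<and> (c i = x \<or> lt (c i) x) \<and> (x = c j \<or> lt x (c j))"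
  have "squeezed c n = ?pos" by (simp add: squeezed_def fun_eq_iff)
  then show ?thesis
  proof (elim ssubst, unfold_locales)
    show "c i \<in> H" for i by (rule c(1))
    show "?pos (c i) i i i" for i by (intro exI[of _ i]) simp
    show "?pos x r lo' hi'" if p: "?pos x r lo hi" and le: "lo' \<le> lo" "hi \<le> hi'" for x r lo hi lo' hi'
    proof -
      obtain i j where "lo \<le> i" "i \<le> hi" "lo \<le> j" "j \<le> hi" "n dvd i - r" "n dvd j - r"
        "c i = x \<or> lt (c i) x" "x = c j \<or> lt x (c j)" using p by blast
      then show ?thesis using le by (intro exI[of _ i] exI[of _ j] conjI) auto
    qed
    show "\<exists>r lo hi. ?pos x r lo hi" if x: "x \<in> H" for x
    proof -
      obtain i j where ij: "lt (c i) x" "lt x (c j)" using cof[OF x] by blast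
      then have "lt (c i) (c j)" using lt_trans[of "c i" x "c j"] c(1) x by blast
      then have "i < j" "n dvd j - i" using c(2) by auto
      then show ?thesis using ij by (intro exI[of _ i] exI[of _ j] exI[of _ i]) force
    qed
    show "?pos (F x) (r + d) (lo + d) (hi + d)"
      if x: "x \<in> H" and F: "F \<in> Auts" "\<And>i. lo \<le> i \<Longrightarrow> i \<le> hi \<Longrightarrow> F (c i) = c (i + d)"
        and p: "?pos x r lo hi" for x F lo hi d r
    proof -
      obtain i j where ij: "lo \<le> i" "i \<le> hi" "lo \<le> j" "j \<le> hi" "n dvd i - r" "n dvd j - r"
        "c i = x \<or> lt (c i) x" "x = c j \<or> lt x (c j)" using p by blast
      have "c (i + d) = F x \<or> lt (c (i + d)) (F x)"
        using F(2)[OF ij(1,2)] ij(7) aut_lt[OF F(1) c(1)[of i] x] by metis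
      moreover have "F x = c (j + d) \<or> lt (F x) (c (j + d))"
        using F(2)[OF ij(3,4)] ij(8) aut_lt[OF F(1) x c(1)[of j]] by metis
      moreover have "i + d - (r + d) = i - r" "j + d - (r + d) = j - r" by auto
      ultimately show ?thesis
        using ij(1-6) by (intro exI[of _ "i + d"] exI[of _ "j + d"]) simp
    qed
    show "x \<noteq> y \<and> \<not> lt y x \<and> (lt x y \<longleftrightarrow> n dvd s - r)"
      if H: "x \<in> H" "y \<in> H" and px: "?pos x r lo hi" and py: "?pos y s lo' hi'" and less: "hi < lo'"
      for x y r lo hi s lo' hi'
    proof -
      obtain j where j: "j \<le> hi" "n dvd j - r" "x = c j \<or> lt x (c j)" using px by blast
      obtain i where i: "lo' \<le> i" "n dvd i - s" "c i = y \<or> lt (c i) y" using py by blast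
      have eq: "n dvd i - j \<longleftrightarrow> n dvd s - r"
      proof -
        have "i - j = (s - r) + ((i - s) - (j - r))" by simp
        moreover have "n dvd (i - s) - (j - r)" using i(2) j(2) by (rule dvd_diff)
        ultimately show ?thesis by (metis dvd_add_left_iff)
      qed
      have ij: "j < i" using i(1) j(1) less by simp
      show ?thesis
      proof (cases "n dvd s - r")
        case True
        then have cc: "lt (c j) (c i)" using c(2) eq ij by blast
        then have "lt x (c i)" using j(3) lt_trans[of x "c j" "c i"] c(1) H by blast
        then have "lt x y" using i(3) lt_trans[of x "c i" y] c(1) H by blast
        then show ?thesis using True lt_asym[of x y] lt_irrefl H by blast
      next
        case False
        then have "n \<noteq> 1" by auto
        then have cu: chain_union using cases by blast
        have "\<not> comparable x y"
        proof
          assume xy: "comparable x y"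
          have "comparable (c j) x" "comparable y (c i)"
            using j(3) i(3) by (auto simp: comparable_def)
          then have "comparable (c j) (c i)"
            using cu xy H c(1) unfolding chain_union_def by blast
          moreover have "c j \<noteq> c i"
          proof
            assume "c j = c i"
            then have "lt (c i) (c (j + n))" using c(2)[of j "j + n"] n by simp
            then have "n dvd i - j" using c(2) by (metis add_diff_eq diff_add_eq_diff_diff_swap
                dvd_add_triv_right_iff dvd_diff_commute diff_diff_eq2 add.commute)
            then show False using False eq by blast
          qed
          ultimately have "lt (c j) (c i) \<or> lt (c i) (c j)" by (auto simp: comparable_def)
          then show False using False eq c(2) dvd_diff_commute by metis
        qed
        then show ?thesis using False by (auto simp: comparable_def)
      qed
    qed
  qed
qed

text \<open>
  A chain without end points and without gaps has enough room to extend any finite monotone map in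
  infinitely many ways.
\<close>

lemma finite_cut_filled:
  assumes X: "X \<subseteq> H" "X \<noteq> {}" "\<And>x y. x \<in> X \<Longrightarrow> y \<in> X \<Longrightarrow> comparable x y"
    and gap: "\<And>x y. x \<in> X \<Longrightarrow> y \<in> X \<Longrightarrow> lt x y \<Longrightarrow> \<exists>z\<in>X. lt x z \<and> lt z y"
    and top: "\<And>x. x \<in> X \<Longrightarrow> \<exists>z\<in>X. lt x z" and bot: "\<And>x. x \<in> X \<Longrightarrow> \<exists>z\<in>X. lt z x"
    and AB: "finite A" "A \<subseteq> X" "finite B" "B \<subseteq> X" "\<And>a b. a \<in> A \<Longrightarrow> b \<in> B \<Longrightarrow> lt a b"
  shows "\<exists>y\<in>X. (\<forall>a\<in>A. lt a y) \<and> (\<forall>b\<in>B. lt y b)"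
proof -
  interpret D: homogeneous_poset H "\<lambda>x y. lt y x" by (rule dual)
  have A: "A = {} \<or> (\<exists>m\<in>A. \<forall>a\<in>A. a = m \<or> lt a m)"
    using finite_maximal[OF AB(1)] AB(2) X(1,3) unfolding comparable_def by blast
  have B: "B = {} \<or> (\<exists>m\<in>B. \<forall>b\<in>B. b = m \<or> lt m b)"
    using D.finite_maximal[OF AB(3)] AB(4) X(1,3) unfolding comparable_def by blast
  have ltA: "\<forall>a\<in>A. lt a y" if "m \<in> A" "\<forall>a\<in>A. a = m \<or> lt a m" "lt m y" "y \<in> X" for m y
  proof
    fix a assume a: "a \<in> A"
    then have "a \<in> H" "m \<in> H" "y \<in> H" using that(1,4) AB(2) X(1) by auto
    then show "lt a y" using that(2,3) a lt_trans[of a m y] by auto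
  qed
  have ltB: "\<forall>b\<in>B. lt y b" if "m \<in> B" "\<forall>b\<in>B. b = m \<or> lt m b" "lt y m" "y \<in> X" for m y
  proof
    fix b assume b: "b \<in> B"
    then have "b \<in> H" "m \<in> H" "y \<in> H" using that(1,4) AB(4) X(1) by auto
    then show "lt y b" using that(2,3) b lt_trans[of y m b] by auto
  qed
  consider "A = {}" "B = {}" | a where "a \<in> A" "\<forall>x\<in>A. x = a \<or> lt x a" "B = {}"
    | b where "A = {}" "b \<in> B" "\<forall>x\<in>B. x = b \<or> lt b x"
    | a b where "a \<in> A" "\<forall>x\<in>A. x = a \<or> lt x a" "b \<in> B" "\<forall>x\<in>B. x = b \<or> lt b x"
    using A B by blast
  then show ?thesis
  proof cases
    case 1
    then show ?thesis using X(2) by blast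
  next
    case 2
    then obtain y where "y \<in> X" "lt a y" using top AB(2) by blast
    then show ?thesis using ltA[OF 2(1,2)] 2(3) by blast
  next
    case 3
    then obtain y where "y \<in> X" "lt y b" using bot AB(4) by blast
    then show ?thesis using ltB[OF 3(2,3)] 3(1) by blast
  next
    case 4
    then obtain y where "y \<in> X" "lt a y" "lt y b" using gap[of a b] AB by blast
    then show ?thesis using ltA[OF 4(1,2)] ltB[OF 4(3,4)] by blast
  qed
qed

definition finite_embeddings :: "'a set \<Rightarrow> ('a \<times> 'a) set set" where
  "finite_embeddings X = {p. finite p \<and> p \<subseteq> X \<times> X \<and>
    (\<forall>u v u' v'. (u, v) \<in> p \<longrightarrow> (u', v') \<in> p \<longrightarrow>
      (lt u u' \<longleftrightarrow> lt v v') \<and> (u = u' \<longleftrightarrow> v = v'))}"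

lemma finite_embeddings_extend:
  assumes X: "X \<subseteq> H" "X \<noteq> {}" "\<And>x y. x \<in> X \<Longrightarrow> y \<in> X \<Longrightarrow> comparable x y"
    and gap: "\<And>x y. x \<in> X \<Longrightarrow> y \<in> X \<Longrightarrow> lt x y \<Longrightarrow> \<exists>z\<in>X. lt x z \<and> lt z y"
    and top: "\<And>x. x \<in> X \<Longrightarrow> \<exists>z\<in>X. lt x z" and bot: "\<And>x. x \<in> X \<Longrightarrow> \<exists>z\<in>X. lt z x"
    and p: "p \<in> finite_embeddings X" and x: "x \<in> X" "x \<notin> Domain p"
  shows "infinite {y \<in> X. insert (x, y) p \<in> finite_embeddings X}"
proof -
  have p: "finite p" "p \<subseteq> X \<times> X"
    "\<And>u v u' v'. (u, v) \<in> p \<Longrightarrow> (u', v') \<in> p \<Longrightarrow> (lt u u' \<longleftrightarrow> lt v v') \<and> (u = u' \<longleftrightarrow> v = v')"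
    using p unfolding finite_embeddings_def by blast+
  define A where "A = snd ` {q \<in> p. lt (fst q) x}"
  define B where "B = snd ` {q \<in> p. lt x (fst q)}"
  define S where "S = {y \<in> X. (\<forall>a\<in>A. lt a y) \<and> (\<forall>b\<in>B. lt y b)}"
  have A: "finite A" "A \<subseteq> X" and B: "finite B" "B \<subseteq> X"
    using p(1,2) by (auto simp: A_def B_def)
  have AB: "lt a b" if ab: "a \<in> A" "b \<in> B" for a b
  proof -
    obtain u where u: "(u, a) \<in> p" "lt u x" using ab(1) by (auto simp: A_def)
    obtain v where v: "(v, b) \<in> p" "lt x v" using ab(2) by (auto simp: B_def)
    have "u \<in> H" "v \<in> H" "x \<in> H" using u v x p(2) X(1) by auto
    then have "lt u v" using lt_trans[OF u(2) v(2)] by blast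
    then show ?thesis using p(3)[OF u(1) v(1)] by blast
  qed
  have "infinite S"
  proof (rule infinite_if_no_maximal)
    show "S \<subseteq> H" using X(1) by (auto simp: S_def)
    show "S \<noteq> {}"
      using finite_cut_filled[OF X gap top bot A B AB] by (auto simp: S_def)
    fix y assume y: "y \<in> S"
    have "\<exists>z\<in>X. (\<forall>a\<in>insert y A. lt a z) \<and> (\<forall>b\<in>B. lt z b)"
      by (rule finite_cut_filled[OF X gap top bot])
         (use A B AB y in \<open>auto simp: S_def\<close>)
    then show "\<exists>z\<in>S. lt y z" by (auto simp: S_def)
  qed
  moreover have "insert (x, y) p \<in> finite_embeddings X" if y: "y \<in> S" for y
  proof -
    have yX: "y \<in> X" using y by (simp add: S_def)
    have "(lt x u \<longleftrightarrow> lt y v) \<and> (lt u x \<longleftrightarrow> lt v y) \<and> x \<noteq> u \<and> y \<noteq> v" if uv: "(u, v) \<in> p" for u v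
    proof -
      have X': "u \<in> X" "v \<in> X" "u \<noteq> x" using uv p(2) x by auto
      then have H: "u \<in> H" "v \<in> H" "x \<in> H" "y \<in> H" using x yX X(1) by auto
      have "lt x u \<or> lt u x" using X(3)[OF x(1) X'(1)] X'(3) by (auto simp: comparable_def)
      moreover have "lt x u \<Longrightarrow> lt y v" using uv y by (auto simp: S_def B_def)
      moreover have "lt u x \<Longrightarrow> lt v y" using uv y by (auto simp: S_def A_def)
      ultimately show ?thesis
        using lt_asym[of x u] lt_asym[of y v] lt_irrefl[OF H(3)] lt_irrefl[OF H(4)] H by blast
    qed
    moreover have "x \<in> H" "y \<in> H" using x yX X(1) by auto
    ultimately show ?thesis
      using p x(1) yX lt_irrefl unfolding finite_embeddings_def by auto
  qed
  then have "S \<subseteq> {y \<in> X. insert (x, y) p \<in> finite_embeddings X}" by (auto simp: S_def)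
  ultimately show ?thesis using infinite_super by blast
qed

lemma finite_embeddings_converse: "p \<in> finite_embeddings X \<Longrightarrow> p\<inverse> \<in> finite_embeddings X"
  unfolding finite_embeddings_def by auto

lemma finite_embedding_extends:
  assumes "p \<in> finite_embeddings X" "X \<subseteq> H"
  obtains F where "F \<in> Auts" "\<And>u v. (u, v) \<in> p \<Longrightarrow> F u = v"
proof -
  have p: "finite p" "p \<subseteq> X \<times> X"
    "\<And>u v u' v'. (u, v) \<in> p \<Longrightarrow> (u', v') \<in> p \<Longrightarrow> (lt u u' \<longleftrightarrow> lt v v') \<and> (u = u' \<longleftrightarrow> v = v')"
    using assms(1) unfolding finite_embeddings_def by blast+
  define q where "q u = (THE v. (u, v) \<in> p)" for u
  have q: "q u = v" if "(u, v) \<in> p" for u v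
    unfolding q_def using p(3) that by blast
  have "(u, q u) \<in> p" if "u \<in> Domain p" for u using that q by auto
  note pq = this
  obtain F where F: "F \<in> Auts" "\<And>u. u \<in> Domain p \<Longrightarrow> F u = q u"
  proof (rule extend[of "Domain p" q])
    show "finite (Domain p)" using p(1) by (rule finite_Domain)
    show "Domain p \<subseteq> H" using p(2) assms(2) by auto
    show "q u \<in> H" if "u \<in> Domain p" for u using pq[OF that] p(2) assms(2) by auto
    show "lt (q u) (q v) \<longleftrightarrow> lt u v" if "u \<in> Domain p" "v \<in> Domain p" for u v
      using p(3)[OF pq[OF that(1)] pq[OF that(2)]] by blast
    show "u = v" if "u \<in> Domain p" "v \<in> Domain p" "q u = q v" for u v
      using p(3)[OF pq[OF that(1)] pq[OF that(2)]] that(3) by blast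
  qed blast
  show ?thesis
    by (rule that[OF F(1)]) (use F(2) q in auto)
qed

end

lemma (in group) word_eval_conjugate:
  assumes "f \<in> carrier G" "g \<in> carrier G" "z \<in> carrier G"
  shows "word_eval G (z \<otimes> f \<otimes> inv z) (z \<otimes> g \<otimes> inv z) w = z \<otimes> word_eval G f g w \<otimes> inv z"
proof -
  have hom: "(\<lambda>x. z \<otimes> x \<otimes> inv z) \<in> hom G G"
    using assms(3) by (auto simp: hom_def m_assoc inv_solve_left' simp flip: m_assoc[of "inv z" z])
  have closed: "word_eval G f g v \<in> carrier G" for v
    using assms(1,2)
  proof (induction v)
    case (Cons a v)
    then show ?case by (cases a, cases "fst a") auto
  qed simp
  have pow: "z \<otimes> (x [^] n) \<otimes> inv z = (z \<otimes> x \<otimes> inv z) [^] n" if "x \<in> carrier G" for x and n :: int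
    using hom_int_pow[OF hom that group_axioms group_axioms] by simp
  show ?thesis
  proof (induction w)
    case Nil
    show ?case using assms(3) by simp
  next
    case (Cons a w)
    obtain c n where a: "a = (c, n)" by (cases a)
    let ?x = "subst_letter f g c"
    have x: "?x \<in> carrier G" using assms by (cases c) auto
    have "subst_letter (z \<otimes> f \<otimes> inv z) (z \<otimes> g \<otimes> inv z) c = z \<otimes> ?x \<otimes> inv z" by (cases c) auto
    moreover have "z \<otimes> (?x [^] n \<otimes> word_eval G f g w) \<otimes> inv z
        = (z \<otimes> ?x [^] n \<otimes> inv z) \<otimes> (z \<otimes> word_eval G f g w \<otimes> inv z)"
      using hom_mult[OF hom int_pow_closed[OF x] closed] .
    ultimately show ?case using a Cons pow[OF x, of n] by simp
  qed
qed

context shifted_frame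
begin

text \<open>Conjugation by a power of \<open>f\<close> fixes \<open>f\<close>, so it changes the second generator only.\<close>

lemma word_eval_shift_conjugate:
  assumes "h \<in> Auts" "x \<in> H"
  shows "word_eval G f (shift N \<otimes>\<^bsub>G\<^esub> h \<otimes>\<^bsub>G\<^esub> shift (- N)) w (shift N x) = shift N (word_eval G f h w x)"
proof -
  have inv: "inv\<^bsub>G\<^esub> (shift N) = shift (- N)" using int_pow_neg[of f N] by simp
  have "shift N \<otimes>\<^bsub>G\<^esub> f = f \<otimes>\<^bsub>G\<^esub> shift N"
    using int_pow_mult[of f N 1] int_pow_mult[of f 1 N] by (simp add: add.commute)
  then have "shift N \<otimes>\<^bsub>G\<^esub> f \<otimes>\<^bsub>G\<^esub> inv\<^bsub>G\<^esub> (shift N) = f"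
    by (simp add: m_assoc)
  then have "word_eval G f (shift N \<otimes>\<^bsub>G\<^esub> h \<otimes>\<^bsub>G\<^esub> shift (- N)) w
      = shift N \<otimes>\<^bsub>G\<^esub> word_eval G f h w \<otimes>\<^bsub>G\<^esub> shift (- N)"
    using word_eval_conjugate[of f h "shift N" w] assms(1) by (simp add: inv)
  then show ?thesis
    using assms pow_add_apply[OF f assms(2), of "- N" N] by simp
qed

text \<open>
  A maximal chain between \<open>c 0\<close> and \<open>c 1\<close> has neither gaps nor end points: any point that fills a gap, or lies
  beyond all elements of the chain on one side, would be comparable to all of them.  The
  translates of such a chain lie one after the other and make up a chain that is invariant under the shift.
\<close>

lemma interval_chain:
  assumes n: "n = 1"
  obtains X where "X \<subseteq> H" "X \<noteq> {}" "\<And>x y. x \<in> X \<Longrightarrow> y \<in> X \<Longrightarrow> comparable x y"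
    "\<And>x y. x \<in> X \<Longrightarrow> y \<in> X \<Longrightarrow> lt x y \<Longrightarrow> \<exists>z\<in>X. lt x z \<and> lt z y"
    "\<And>x. x \<in> X \<Longrightarrow> \<exists>z\<in>X. lt x z" "\<And>x. x \<in> X \<Longrightarrow> \<exists>z\<in>X. lt z x"
    "\<And>x m. x \<in> X \<Longrightarrow> shift m x \<in> X"
proof -
  have c_less: "lt (c i) (c j)" if "i < j" for i j
    using pos_less[OF c_closed c_closed pos_c pos_c that] n by simp
  define I where "I = {x \<in> H. lt (c 0) x \<and> lt x (c 1)}"
  obtain M where "pred_on.maxchain I lt M" using pred_on.Hausdorff by blast
  then have chain: "pred_on.chain I lt M" and max: "\<not> (\<exists>S. pred_on.chain I lt S \<and> M \<subset> S)"
    unfolding pred_on.maxchain_def by auto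
  have MI: "M \<subseteq> I" and Mc: "\<And>x y. x \<in> M \<Longrightarrow> y \<in> M \<Longrightarrow> comparable x y"
    using chain unfolding pred_on.chain_def comparable_def by auto
  have MH: "M \<subseteq> H" using MI by (auto simp: I_def)
  have add: "z \<in> M" if z: "z \<in> I" "\<And>x. x \<in> M \<Longrightarrow> comparable x z" for z
  proof (rule ccontr)
    assume "z \<notin> M"
    moreover have "pred_on.chain I lt (insert z M)"
      using z MI Mc unfolding pred_on.chain_def comparable_def by auto
    ultimately show False using max by blast
  qed
  have ne: "M \<noteq> {}"
  proof
    assume "M = {}"
    obtain z where "z \<in> H" "lt (c 0) z" "lt z (c 1)" using dense[OF _ _ c_less[of 0 1]] by auto
    then show False using add[of z] \<open>M = {}\<close> by (simp add: I_def)
  qed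
  have gap: "\<exists>z\<in>M. lt u z \<and> lt z v" if uv: "u \<in> M" "v \<in> M" "lt u v" for u v
  proof (rule ccontr)
    assume no: "\<not> (\<exists>z\<in>M. lt u z \<and> lt z v)"
    have H: "u \<in> H" "v \<in> H" "lt (c 0) u" "lt v (c 1)" using uv MI by (auto simp: I_def)
    obtain z where z: "z \<in> H" "lt u z" "lt z v" using dense[OF H(1,2) uv(3)] by blast
    have "z \<in> I" using H z lt_trans[of "c 0" u z] lt_trans[of z v "c 1"] by (simp add: I_def)
    moreover have "comparable x z" if x: "x \<in> M" for x
    proof -
      have xH: "x \<in> H" using x MH by blast
      have "x = u \<or> lt x u \<or> x = v \<or> lt v x"
        using no x Mc[OF x uv(1)] Mc[OF x uv(2)] unfolding comparable_def by blast
      then show ?thesis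
        using z H(1,2) xH lt_trans[of x u z] lt_trans[of z v x] unfolding comparable_def by blast
    qed
    ultimately show False using add no z by blast
  qed
  have top: "\<exists>z\<in>M. lt u z" if u: "u \<in> M" for u
  proof (rule ccontr)
    assume no: "\<not> (\<exists>z\<in>M. lt u z)"
    have H: "u \<in> H" "lt (c 0) u" "lt u (c 1)" using u MI by (auto simp: I_def)
    obtain z where z: "z \<in> H" "lt u z" "lt z (c 1)" using dense[OF H(1) _ H(3)] by auto
    have "z \<in> I" using H z lt_trans[of "c 0" u z] by (simp add: I_def)
    moreover have "comparable x z" if x: "x \<in> M" for x
    proof -
      have xH: "x \<in> H" using x MH by blast
      have "x = u \<or> lt x u" using no x Mc[OF x u] unfolding comparable_def by blast
      then show ?thesis using z H(1) xH lt_trans[of x u z] unfolding comparable_def by blast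
    qed
    ultimately show False using add no z by blast
  qed
  have bot: "\<exists>z\<in>M. lt z u" if u: "u \<in> M" for u
  proof (rule ccontr)
    assume no: "\<not> (\<exists>z\<in>M. lt z u)"
    have H: "u \<in> H" "lt (c 0) u" "lt u (c 1)" using u MI by (auto simp: I_def)
    obtain z where z: "z \<in> H" "lt (c 0) z" "lt z u" using dense[OF _ H(1,2)] by auto
    have "z \<in> I" using H z lt_trans[of z u "c 1"] by (simp add: I_def)
    moreover have "comparable x z" if x: "x \<in> M" for x
    proof -
      have xH: "x \<in> H" using x MH by blast
      have "x = u \<or> lt u x" using no x Mc[OF x u] unfolding comparable_def by blast
      then show ?thesis using z H(1) xH lt_trans[of z u x] unfolding comparable_def by blast
    qed
    ultimately show False using add no z by blast
  qed
  define X where "X = (\<Union>m. shift m ` M)"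
  have XE: "\<exists>m u. u \<in> M \<and> u \<in> H \<and> x = shift m u \<and> x \<in> H \<and> lt (c m) x \<and> lt x (c (m + 1))"
    if x: "x \<in> X" for x
  proof -
    obtain m u where u: "u \<in> M" "x = shift m u" using x by (auto simp: X_def)
    have H: "u \<in> H" "lt (c 0) u" "lt u (c 1)" using u(1) MI by (auto simp: I_def)
    have "lt (shift m (c 0)) (shift m u)" "lt (shift m u) (shift m (c 1))" using H by simp_all
    then have "lt (c m) x" "lt x (c (m + 1))" using u(2) by (simp_all add: shift_c add.commute)
    moreover have "x \<in> H" using u(2) H(1) by simp
    ultimately show ?thesis using u H(1) by blast
  qed
  have shiftX: "shift m u \<in> X" if "u \<in> M" for m u using that by (auto simp: X_def)
  have order: "lt x y" if xy: "x \<in> H" "y \<in> H" "lt x (c (m + 1))" "lt (c m') y" "m < m'" for x y m m'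
  proof -
    have "lt x (c m')"
      using xy(3,5) c_less[of "m + 1" m'] lt_trans[of x "c (m + 1)" "c m'"] xy(1)
      by (cases "m' = m + 1") auto
    then show ?thesis using xy lt_trans[of x "c m'" y] by simp
  qed
  show ?thesis
  proof (rule that[of X])
    show "X \<subseteq> H" using XE by blast
    show "X \<noteq> {}" using ne by (auto simp: X_def)
    show "comparable x y" if xy: "x \<in> X" "y \<in> X" for x y
    proof -
      obtain m u where u: "u \<in> M" "u \<in> H" "x = shift m u" "x \<in> H" "lt (c m) x" "lt x (c (m + 1))"
        using XE[OF xy(1)] by blast
      obtain m' v where v: "v \<in> M" "v \<in> H" "y = shift m' v" "y \<in> H" "lt (c m') y" "lt y (c (m' + 1))"
        using XE[OF xy(2)] by blast
      consider "m = m'" | "m < m'" | "m' < m" by linarith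
      then show ?thesis
      proof cases
        case 1
        then show ?thesis using u v Mc by simp
      next
        case 2
        then show ?thesis using order[of x y m m'] u v by (simp add: comparable_def)
      next
        case 3
        then show ?thesis using order[of y x m' m] u v by (simp add: comparable_def)
      qed
    qed
    show "\<exists>z\<in>X. lt x z \<and> lt z y" if xy: "x \<in> X" "y \<in> X" "lt x y" for x y
    proof -
      obtain m u where u: "u \<in> M" "u \<in> H" "x = shift m u" "x \<in> H" "lt (c m) x" "lt x (c (m + 1))"
        using XE[OF xy(1)] by blast
      obtain m' v where v: "v \<in> M" "v \<in> H" "y = shift m' v" "y \<in> H" "lt (c m') y" "lt y (c (m' + 1))"
        using XE[OF xy(2)] by blast
      consider "m = m'" | "m < m'" | "m' < m" by linarith
      then show ?thesis
      proof cases
        case 1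
        then have "lt u v" using xy(3) u v by simp
        then obtain z where z: "z \<in> M" "lt u z" "lt z v" using gap u v by blast
        then have "z \<in> H" using MH by blast
        then have "lt x (shift m z)" "lt (shift m z) y" using z u v 1 by simp_all
        then show ?thesis using shiftX[OF z(1)] by blast
      next
        case 2
        obtain z where z: "z \<in> M" "lt u z" using top u by blast
        have zH: "z \<in> H" "lt z (c 1)" using z MI by (auto simp: I_def)
        have "lt (shift m z) (shift m (c 1))" using zH by simp
        then have "lt (shift m z) (c (m + 1))" by (simp add: shift_c add.commute)
        then have "lt (shift m z) y" using order[of "shift m z" y m m'] zH v 2 by simp
        moreover have "lt x (shift m z)" using z zH u by simp
        ultimately show ?thesis using shiftX[OF z(1)] by blast
      next
        case 3
        then have "lt y x" using order[of y x m' m] u v by simp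
        then show ?thesis using xy(3) lt_asym u v by blast
      qed
    qed
    fix x assume x: "x \<in> X"
    then obtain m u where u: "u \<in> M" "u \<in> H" "x = shift m u" using XE by blast
    obtain z where z: "z \<in> M" "lt u z" using top u by blast
    then have "lt x (shift m z)" using u MH by (simp add: subset_iff)
    then show "\<exists>z\<in>X. lt x z" using shiftX[OF z(1)] by blast
    obtain z' where z': "z' \<in> M" "lt z' u" using bot u by blast
    then have "lt (shift m z') x" using u MH by (simp add: subset_iff)
    then show "\<exists>z\<in>X. lt z x" using shiftX[OF z'(1)] by blast
    fix k
    have "shift k x = shift (k + m) u" using u pow_add_apply[OF f u(2)] by simp
    then show "shift k x \<in> X" using shiftX[OF u(1)] by simp
  qed
qed

text \<open>
  The map that makes the word move a point is found inside the invariant chain, with no regard to \<open>h\<close>; its conjugate by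
  a high power of the shift is compatible with \<open>h\<close>.
\<close>

lemma free_directed:
  assumes n: "n = 1" and h: "h \<in> Auts" and C: "finite C" "C \<subseteq> H" and w: "irreducible_word w"
  shows "\<exists>h'\<in>Auts. (\<forall>u\<in>C. h' u = h u) \<and> (\<exists>x\<in>H. word_eval G f h' w x \<noteq> x)"
proof -
  obtain X where X: "X \<subseteq> H" "X \<noteq> {}" "\<And>x y. x \<in> X \<Longrightarrow> y \<in> X \<Longrightarrow> comparable x y"
    "\<And>x y. x \<in> X \<Longrightarrow> y \<in> X \<Longrightarrow> lt x y \<Longrightarrow> \<exists>z\<in>X. lt x z \<and> lt z y"
    "\<And>x. x \<in> X \<Longrightarrow> \<exists>z\<in>X. lt x z" "\<And>x. x \<in> X \<Longrightarrow> \<exists>z\<in>X. lt z x"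
    "\<And>x m. x \<in> X \<Longrightarrow> shift m x \<in> X"
    using interval_chain[OF n] by blast
  interpret W: walk_space X shift "finite_embeddings X"
  proof
    show "infinite X" using infinite_if_no_maximal[OF X(1,2,5)] .
    show "shift m x \<in> X" if "x \<in> X" for x m using X(7) that .
    show "shift 0 x = x" if "x \<in> X" for x using that X(1) by (intro pow_0_apply) blast
    show "shift m (shift k x) = shift (m + k) x" if "x \<in> X" for x m k
      using that X(1) by (intro pow_add_apply) auto
    show "shift m x \<noteq> x" if "x \<in> X" "m \<noteq> 0" for x m
      using that X(1) by (intro shift_no_fixpoint) auto
    show "finite p" if "p \<in> finite_embeddings X" for p
      using that by (simp add: finite_embeddings_def)
    show "infinite {y \<in> X. insert (x, y) p \<in> finite_embeddings X}"
      if "p \<in> finite_embeddings X" "x \<in> X" "x \<notin> Domain p" for p x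
      by (rule finite_embeddings_extend[OF X(1-6) that])
    show "p\<inverse> \<in> finite_embeddings X" if "p \<in> finite_embeddings X" for p
      using finite_embeddings_converse[OF that] .
  qed
  have "{} \<in> finite_embeddings X" by (simp add: finite_embeddings_def)
  then obtain q x y where q: "q \<in> finite_embeddings X" "x \<in> X" "walk shift q w x y" "x \<noteq> y"
    using W.irreducible_walk[OF w] by metis
  have qX: "finite q" "q \<subseteq> X \<times> X" using q(1) by (auto simp: finite_embeddings_def)
  obtain P where P: "P \<in> Auts" "\<And>u v. (u, v) \<in> q \<Longrightarrow> P u = v"
    using finite_embedding_extends[OF q(1) X(1)] by blast
  have D: "finite (Domain q)" "Domain q \<subseteq> H" using qX X(1) by (auto simp: finite_Domain)
  obtain rk where rk: "\<And>x. x \<in> H \<Longrightarrow> \<exists>lo hi. pos x (rk x) lo hi" using pos_ex by metis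
  obtain h' N where h': "h' \<in> Auts" "\<And>u. u \<in> C \<Longrightarrow> h' u = h u"
    "\<And>a. a \<in> Domain q \<Longrightarrow> h' (shift N a) = shift N (P a)"
    by (rule far_conjugate[OF h P(1) D C rk]) (use n in auto)
  define E where "E = shift (- N) \<otimes>\<^bsub>G\<^esub> h' \<otimes>\<^bsub>G\<^esub> shift N"
  have E: "E \<in> Auts" using h'(1) by (simp add: E_def)
  have xH: "x \<in> H" using q(2) X(1) by blast
  have "u \<in> H \<and> E u = v" if uv: "(u, v) \<in> q" for u v
  proof -
    have u: "u \<in> Domain q" "u \<in> H" using uv D by auto
    have "E u = shift (- N) (shift N (P u))" using h' u by (simp add: E_def)
    also have "\<dots> = P u" using pow_add_apply[OF f, of "P u" "- N" N] P(1) u(2) by simp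
    finally show ?thesis using P(2)[OF uv] u(2) by simp
  qed
  then have y: "word_eval G f E w x = y" using walk_eval[OF f E _ xH q(3)] by blast
  have "shift N \<otimes>\<^bsub>G\<^esub> E \<otimes>\<^bsub>G\<^esub> shift (- N) = h'"
  proof (rule aut_eqI)
    fix z assume z: "z \<in> H"
    then show "(shift N \<otimes>\<^bsub>G\<^esub> E \<otimes>\<^bsub>G\<^esub> shift (- N)) z = h' z"
      using E h'(1) pow_add_apply[OF f, of z N "- N"] pow_add_apply[OF f, of "h' z" N "- N"]
      by (simp add: E_def)
  qed (use E h'(1) in auto)
  then have "word_eval G f h' w (shift N x) = shift N y"
    using word_eval_shift_conjugate[OF E xH, of N w] y by simp
  moreover have "y \<in> H" using y E xH by (metis aut_closed f word_eval_closed)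
  then have "shift N y \<noteq> shift N x" using q(4) xH by simp
  ultimately show ?thesis using h'(1,2) xH by (intro bexI[of _ h'] conjI bexI[of _ "shift N x"]) auto
qed

end

context homogeneous_poset
begin

theorem directed_generated:
  assumes directed
  shows "freely_topologically_2_generated G (Aut_topology H lt)"
proof -
  have dir: "\<exists>z\<in>H. lt x z \<and> lt y z" "\<exists>z\<in>H. lt z x \<and> lt z y" if "x \<in> H" "y \<in> H" for x y
    using assms that unfolding directed_def by blast+
  obtain c :: "int \<Rightarrow> 'a" where c: "\<And>i. c i \<in> H" "\<And>i j. lt (c i) (c j) \<longleftrightarrow> i < j"
    "\<And>y. y \<in> H \<Longrightarrow> \<exists>i j. lt (c i) y \<and> lt y (c j)"
    using cofinal_coinitial_sequence[of H] dir infinite_H by (metis finite.emptyI order_refl)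
  interpret frame H lt c 1 "squeezed c 1"
    by (rule frame_of_cofinal_sequence) (use c in auto)
  obtain f where f: "f \<in> Auts" "\<And>i. f (c i) = c (i + 1)" using shift_exists by blast
  interpret shifted_frame H lt c 1 "squeezed c 1" f
    by unfold_locales (use f in auto)
  obtain rk where rk: "\<And>x. x \<in> H \<Longrightarrow> \<exists>lo hi. squeezed c 1 x (rk x) lo hi"
    using pos_ex by metis
  show ?thesis
  proof (rule generated_by_generic[OF f(1) aut_one, of "{}"])
    fix h C P A
    assume *: "h \<in> Auts" "finite C" "C \<subseteq> H" "P \<in> Auts" "finite A" "A \<subseteq> H"
    obtain h' N where h': "h' \<in> Auts" "\<And>u. u \<in> C \<Longrightarrow> h' u = h u"
      "\<And>a. a \<in> A \<Longrightarrow> h' (shift N a) = shift N (P a)"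
      by (rule far_conjugate[OF *(1,4,5,6,2,3) rk]) auto
    have "word_eval G f h' [(LetterA, - N), (LetterB, 1), (LetterA, N)] a = P a" if "a \<in> A" for a
      by (rule conjugate_word) (use h' * that in auto)
    then show "\<exists>h'\<in>Auts. (\<forall>u\<in>C. h' u = h u) \<and> (\<exists>w. \<forall>a\<in>A. word_eval G f h' w a = P a)"
      using h'(1,2) by blast
  next
    show "\<exists>h'\<in>Auts. (\<forall>u\<in>C. h' u = h u) \<and> (\<exists>x\<in>H. word_eval G f h' w x \<noteq> x)"
      if "h \<in> Auts" "finite C" "C \<subseteq> H" "irreducible_word w" for h C w
      by (rule free_directed[OF refl that])
  qed auto
qed

end

section \<open>Disjoint unions of chains\<close>

context homogeneous_poset
begin

lemma lower_bound_above:
  assumes chain_union "x \<in> H" "finite B" "B \<subseteq> H" "\<forall>b\<in>B. lt x b"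
    and up: "\<exists>y\<in>H. lt x y"
  shows "\<exists>y\<in>H. lt x y \<and> (\<forall>b\<in>B. lt y b)"
  using assms(3-5)
proof (induction B rule: finite_induct)
  case empty
  then show ?case using up by simp
next
  case (insert b B)
  then obtain y where y: "y \<in> H" "lt x y" "\<forall>b\<in>B. lt y b" by auto
  have b: "b \<in> H" "lt x b" using insert.prems by auto
  show ?case
  proof (cases "lt y b")
    case True
    then show ?thesis using y by blast
  next
    case False
    have "comparable y x" "comparable x b" using y b by (auto simp: comparable_def)
    then have "comparable y b" using assms(1,2) y(1) b(1) unfolding chain_union_def by blast
    then have b_le: "b = y \<or> lt b y" using False by (auto simp: comparable_def)
    obtain z where z: "z \<in> H" "lt x z" "lt z b" using dense[OF assms(2) b] by blast
    have zy: "lt z y" using b_le z y b lt_trans[of z b y] by auto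
    have "lt z d" if "d \<in> B" for d
      using lt_trans[OF zy, of d] y(1,3) z(1) that insert.prems by auto
    then show ?thesis using z by auto
  qed
qed

text \<open>
  If there are comparable elements at all, then \<open>x\<close> can be moved upwards, within its chain, by so little that no
  element of \<open>C\<close> is passed, and the orbit has no maximal element.  Otherwise the poset is an infinite antichain.
\<close>

lemma infinite_orbit:
  assumes cu: chain_union and C: "finite C" "C \<subseteq> H" and x: "x \<in> H" "x \<notin> C"
  shows "infinite {s x | s. s \<in> Auts \<and> (\<forall>u\<in>C. s u = u)}" (is "infinite ?S")
proof (cases "\<exists>u\<in>H. \<exists>v\<in>H. lt u v")
  case True
  then have up: "\<exists>y\<in>H. lt x y" using above_everywhere x(1) by metis
  have "\<exists>y\<in>H. lt x y \<and> (\<forall>b\<in>{u \<in> C. lt x u}. lt y b)"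
    by (rule lower_bound_above[OF cu x(1) _ _ _ up]) (use C in auto)
  then obtain y where y: "y \<in> H" "lt x y" "\<And>u. u \<in> C \<Longrightarrow> lt x u \<Longrightarrow> lt y u" by blast
  obtain t where t: "t \<in> Auts" "t x = y" using transitive[OF x(1) y(1)] by blast
  obtain e where e: "e \<in> Auts" "\<And>u. u \<in> C \<Longrightarrow> e u = \<one>\<^bsub>G\<^esub> u" "\<And>v. v \<in> {x} \<Longrightarrow> e v = t v"
  proof (rule glue[OF aut_one t(1) C, of "{x}"])
    fix u v assume uv: "u \<in> C" "v \<in> {x}"
    then have uH: "u \<in> H" using C by blast
    have ne: "u \<noteq> x" using uv x(2) by blast
    have yu: "\<not> comparable x u \<Longrightarrow> \<not> comparable y u"
      using cu x(1) y(1,2) uH unfolding chain_union_def comparable_def by blast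
    have 1: "lt u y \<longleftrightarrow> lt u x" "lt y u \<longleftrightarrow> lt x u" "u \<noteq> y"
      using yu ne y(2) y(3)[OF uv(1)] lt_trans[of u x y] lt_trans[of x y u] lt_asym[of u y]
        lt_irrefl uH x(1) y(1) unfolding comparable_def by blast+
    show "lt (\<one>\<^bsub>G\<^esub> u) (t v) \<longleftrightarrow> lt u v" "lt (t v) (\<one>\<^bsub>G\<^esub> u) \<longleftrightarrow> lt v u"
      "u \<noteq> v \<and> \<one>\<^bsub>G\<^esub> u \<noteq> t v"
      using 1 ne uv t(2) uH by auto
  qed (use x in auto)
  have e': "e x = y" "e u = u" if "u \<in> C" for u
    using e(2)[OF that] e(3)[of x] t(2) that C(2) by auto
  have ex: "e x = y" using e(3) t(2) by simp
  show ?thesis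
  proof (rule infinite_if_no_maximal)
    show "?S \<subseteq> H" using x(1) by auto
    have "\<one>\<^bsub>G\<^esub> \<in> Auts \<and> (\<forall>u\<in>C. \<one>\<^bsub>G\<^esub> u = u)" using C(2) by auto
    then show "?S \<noteq> {}" by blast
    fix v assume "v \<in> ?S"
    then obtain s where s: "v = s x" "s \<in> Auts" "\<forall>u\<in>C. s u = u" by blast
    have "s \<otimes>\<^bsub>G\<^esub> e \<in> Auts" "(s \<otimes>\<^bsub>G\<^esub> e) x = s y" "\<forall>u\<in>C. (s \<otimes>\<^bsub>G\<^esub> e) u = u"
      using s e(1) ex e'(2) x(1) C(2) by auto
    then have "s y \<in> ?S" by (intro CollectI exI[of _ "s \<otimes>\<^bsub>G\<^esub> e"]) simp
    moreover have "lt v (s y)" using s x(1) y by simp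
    ultimately show "\<exists>z\<in>?S. lt v z" by blast
  qed
next
  case False
  have "y \<in> ?S" if y: "y \<in> H - C" for y
  proof -
    obtain s where s: "s \<in> Auts" "\<And>u. u \<in> insert x C \<Longrightarrow> s u = (if u = x then y else u)"
      by (rule extend[of "insert x C" "\<lambda>u. if u = x then y else u"])
         (use False C x y in \<open>auto split: if_splits\<close>)
    have "s x = y" "\<forall>u\<in>C. s u = u" using s(2) x(2) by auto
    then show ?thesis using s(1) by blast
  qed
  then have "H - C \<subseteq> ?S" by blast
  moreover have "infinite (H - C)" using infinite_H C(1) by simp
  ultimately show ?thesis using infinite_super by blast
qed

definition finite_restrictions :: "('a \<times> 'a) set set" where
  "finite_restrictions = {p. finite p \<and> (\<exists>h\<in>Auts. \<forall>u v. (u, v) \<in> p \<longrightarrow> u \<in> H \<and> h u = v)}"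

lemma finite_restrictions_extend:
  assumes cu: chain_union and p: "p \<in> finite_restrictions" and x: "x \<in> H" "x \<notin> Domain p"
  shows "infinite {y \<in> H. insert (x, y) p \<in> finite_restrictions}"
proof -
  obtain h where h: "finite p" "h \<in> Auts" "\<And>u v. (u, v) \<in> p \<Longrightarrow> u \<in> H \<and> h u = v"
    using p unfolding finite_restrictions_def by blast
  have D: "finite (Domain p)" "Domain p \<subseteq> H" using h(1,3) by (auto simp: finite_Domain)
  let ?S = "{s x | s. s \<in> Auts \<and> (\<forall>u\<in>Domain p. s u = u)}"
  have SH: "?S \<subseteq> H" using x(1) by auto
  have "inj_on h ?S"
    using bij_betw_imp_inj_on[OF aut_bij[OF h(2)]] SH by (rule inj_on_subset)
  then have "infinite (h ` ?S)"
    using infinite_orbit[OF cu D x] finite_imageD by blast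
  moreover have "h ` ?S \<subseteq> {y \<in> H. insert (x, y) p \<in> finite_restrictions}"
  proof
    fix y assume "y \<in> h ` ?S"
    then obtain s where s: "y = h (s x)" "s \<in> Auts" "\<forall>u\<in>Domain p. s u = u" by blast
    have "u \<in> H \<and> (h \<otimes>\<^bsub>G\<^esub> s) u = v" if uv: "(u, v) \<in> insert (x, y) p" for u v
    proof (cases "(u, v) \<in> p")
      case True
      then have "s u = u" "u \<in> H" "h u = v" using s(3) h(3) by blast+
      then show ?thesis using h(2) s(2) by simp
    next
      case False
      then show ?thesis using uv x(1) s h(2) by simp
    qed
    moreover have "h \<otimes>\<^bsub>G\<^esub> s \<in> Auts" using h(2) s(2) by simp
    ultimately have "insert (x, y) p \<in> finite_restrictions"
      using h(1) unfolding finite_restrictions_def by blast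
    moreover have "y \<in> H" using s h(2) x(1) by simp
    ultimately show "y \<in> {y \<in> H. insert (x, y) p \<in> finite_restrictions}" by blast
  qed
  ultimately show ?thesis using infinite_super by blast
qed

lemma finite_restrictions_converse:
  assumes "p \<in> finite_restrictions"
  shows "p\<inverse> \<in> finite_restrictions"
proof -
  obtain h where h: "finite p" "h \<in> Auts" "\<And>u v. (u, v) \<in> p \<Longrightarrow> u \<in> H \<and> h u = v"
    using assms unfolding finite_restrictions_def by blast
  have "u \<in> H \<and> (inv\<^bsub>G\<^esub> h) u = v" if "(u, v) \<in> p\<inverse>" for u v
    using h(3)[of v u] h(2) that by auto
  then show ?thesis
    using h(1) aut_inv[OF h(2)] unfolding finite_restrictions_def by blast
qed

text \<open>The choice of \<open>rep x\<close> depends on the chain of \<open>x\<close> only.\<close>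

lemma chain_representatives:
  assumes chain_union
  obtains R where "R \<subseteq> H" "\<And>x. x \<in> H \<Longrightarrow> \<exists>r\<in>R. comparable x r"
    "\<And>r r'. r \<in> R \<Longrightarrow> r' \<in> R \<Longrightarrow> comparable r r' \<Longrightarrow> r = r'"
proof -
  define rep where "rep x = (SOME y. y \<in> H \<and> comparable x y)" for x
  have rep: "rep x \<in> H \<and> comparable x (rep x)" if "x \<in> H" for x
    unfolding rep_def by (rule someI[of _ x]) (use that in simp)
  have same: "rep x = rep y" if xy: "x \<in> H" "y \<in> H" "comparable x y" for x y
  proof -
    have "z \<in> H \<and> comparable x z \<longleftrightarrow> z \<in> H \<and> comparable y z" for z
      using xy assms comparable_sym unfolding chain_union_def by blast
    then show ?thesis by (simp add: rep_def)
  qed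
  show ?thesis
  proof (rule that[of "rep ` H"])
    show "rep ` H \<subseteq> H" using rep by blast
    show "\<exists>r\<in>rep ` H. comparable x r" if "x \<in> H" for x using rep[OF that] that by blast
    fix r r' assume "r \<in> rep ` H" "r' \<in> rep ` H" and rr: "comparable r r'"
    then obtain x y where x: "x \<in> H" "r = rep x" and y: "y \<in> H" "r' = rep y" by blast
    have "rep (rep x) = rep x" "rep (rep y) = rep y"
      using same[of x "rep x"] same[of y "rep y"] rep x(1) y(1) by auto
    then show "r = r'" using same[of r r'] rr x y rep by metis
  qed
qed

end

lemma (in shifted_frame) free_chain_union:
  assumes cu: chain_union and h: "h \<in> Auts" and C: "finite C" "C \<subseteq> H" and w: "irreducible_word w"
  shows "\<exists>h'\<in>Auts. (\<forall>u\<in>C. h' u = h u) \<and> (\<exists>x\<in>H. word_eval G f h' w x \<noteq> x)"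
proof -
  interpret W: walk_space H shift finite_restrictions
  proof
    show "infinite H" by (rule infinite_H)
    show "shift m x \<in> H" if "x \<in> H" for x m using that by simp
    show "shift 0 x = x" if "x \<in> H" for x using that by simp
    show "shift m (shift k x) = shift (m + k) x" if "x \<in> H" for x m k
      using that by (intro pow_add_apply) auto
    show "shift m x \<noteq> x" if "x \<in> H" "m \<noteq> 0" for x m
      using that by (rule shift_no_fixpoint)
    show "finite p" if "p \<in> finite_restrictions" for p
      using that by (simp add: finite_restrictions_def)
    show "infinite {y \<in> H. insert (x, y) p \<in> finite_restrictions}"
      if "p \<in> finite_restrictions" "x \<in> H" "x \<notin> Domain p" for p x
      by (rule finite_restrictions_extend[OF cu that])
    show "p\<inverse> \<in> finite_restrictions" if "p \<in> finite_restrictions" for p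
      using finite_restrictions_converse[OF that] .
  qed
  let ?p = "(\<lambda>u. (u, h u)) ` C"
  have "?p \<in> finite_restrictions"
    using h C unfolding finite_restrictions_def by auto
  then obtain q x y where q: "q \<in> finite_restrictions" "?p \<subseteq> q" "x \<in> H" "walk shift q w x y" "x \<noteq> y"
    using W.irreducible_walk[OF w] by metis
  obtain h' where h': "h' \<in> Auts" "\<And>u v. (u, v) \<in> q \<Longrightarrow> u \<in> H \<and> h' u = v"
    using q(1) unfolding finite_restrictions_def by blast
  have "word_eval G f h' w x = y" using walk_eval[OF f h' q(3,4)] by blast
  moreover have "\<forall>u\<in>C. h' u = h u" using h'(2) q(2) by blast
  ultimately show ?thesis
    using h'(1) q(3,5) by (intro bexI[of _ h'] conjI bexI[of _ x]) auto
qed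

context homogeneous_poset
begin

subsection \<open>Infinitely many chains\<close>

lemma frame_of_representatives:
  fixes c :: "int \<Rightarrow> 'a"
  assumes cu: chain_union and c: "\<And>i. c i \<in> H" "\<And>x. x \<in> H \<Longrightarrow> \<exists>i. comparable x (c i)"
    "\<And>i j. comparable (c i) (c j) \<Longrightarrow> i = j"
  shows "frame H lt c 0 (\<lambda>x r lo hi. lo \<le> r \<and> r \<le> hi \<and> comparable x (c r))"
proof
  show "\<exists>r lo hi. lo \<le> r \<and> r \<le> hi \<and> comparable x (c r)" if "x \<in> H" for x
    using c(2)[OF that] by blast
  show "lo + d \<le> r + d \<and> r + d \<le> hi + d \<and> comparable (F x) (c (r + d))"
    if "x \<in> H" "F \<in> Auts" "\<And>i. lo \<le> i \<Longrightarrow> i \<le> hi \<Longrightarrow> F (c i) = c (i + d)"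
      "lo \<le> r \<and> r \<le> hi \<and> comparable x (c r)" for x F lo hi d r
    using that aut_comparable[OF that(2,1) c(1)[of r]] that(3)[of r] by auto
  show "x \<noteq> y \<and> \<not> lt y x \<and> (lt x y \<longleftrightarrow> 0 dvd s - r)"
    if H: "x \<in> H" "y \<in> H" and x: "lo \<le> r \<and> r \<le> hi \<and> comparable x (c r)"
      and y: "lo' \<le> s \<and> s \<le> hi' \<and> comparable y (c s)" and less: "hi < lo'"
    for x y r lo hi s lo' hi'
  proof -
    have "\<not> comparable x y"
    proof
      assume "comparable x y"
      then have "comparable (c r) y"
        using cu H c(1) x comparable_sym unfolding chain_union_def by blast
      then have "comparable (c r) (c s)"
        using cu H c(1) y unfolding chain_union_def by blast
      then show False using c(3) x y less by fastforce
    qed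
    moreover have "s \<noteq> r" using x y less by linarith
    ultimately show ?thesis by (auto simp: comparable_def)
  qed
qed (use c(1) in auto)

theorem infinitely_many_chains_generated:
  assumes cu: chain_union and R: "R \<subseteq> H" "\<And>x. x \<in> H \<Longrightarrow> \<exists>r\<in>R. comparable x r"
    "\<And>r r'. r \<in> R \<Longrightarrow> r' \<in> R \<Longrightarrow> comparable r r' \<Longrightarrow> r = r'" and inf: "infinite R"
  shows "freely_topologically_2_generated G (Aut_topology H lt)"
proof -
  have "countable R" using R(1) countable_H countable_subset by blast
  then have "bij_betw (from_nat_into R) UNIV R" using inf by (rule bij_betw_from_nat_into)
  moreover have "bij_betw int_encode UNIV UNIV" by (rule bij_int_encode)
  ultimately have "bij_betw (from_nat_into R \<circ> int_encode) UNIV R" by (rule bij_betw_trans[rotated])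
  then obtain c :: "int \<Rightarrow> 'a" where cR: "bij_betw c UNIV R" by blast
  then have cinj: "inj c" and crange: "range c = R" by (auto simp: bij_betw_def)
  have cH: "c i \<in> H" for i using crange R(1) by blast
  have ccov: "\<exists>i. comparable x (c i)" if x: "x \<in> H" for x using R(2)[OF x] crange by blast
  have cc: "i = j" if "comparable (c i) (c j)" for i j
    using R(3)[of "c i" "c j"] that crange cinj by (auto simp: inj_def)
  interpret frame H lt c 0 "\<lambda>x r lo hi. lo \<le> r \<and> r \<le> hi \<and> comparable x (c r)"
    by (rule frame_of_representatives[OF cu cH ccov cc])
  obtain f where f: "f \<in> Auts" "\<And>i. f (c i) = c (i + 1)" using shift_exists by blast
  interpret shifted_frame H lt c 0 "\<lambda>x r lo hi. lo \<le> r \<and> r \<le> hi \<and> comparable x (c r)" f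
    by unfold_locales (use f in auto)
  obtain rk where rk: "\<And>x. x \<in> H \<Longrightarrow> \<exists>lo hi. lo \<le> rk x \<and> rk x \<le> hi \<and> comparable x (c (rk x))"
    using pos_ex by metis
  show ?thesis
  proof (rule generated_by_generic[OF f(1) aut_one, of "{}"])
    fix h C P A
    assume *: "h \<in> Auts" "finite C" "C \<subseteq> H" "P \<in> Auts" "finite A" "A \<subseteq> H"
    \<comment> \<open>Shifted by more than \<open>2 * K\<close>, no chain that meets \<open>A\<close> or \<open>P A\<close> can coincide with one that meets
      \<open>C\<close> or \<open>h C\<close>.\<close>
    define K where "K = Max (insert 0 ((\<lambda>x. \<bar>rk x\<bar>) ` (A \<union> P ` A \<union> C \<union> h ` C)))"
    have K: "\<bar>rk x\<bar> \<le> K" if "x \<in> A \<union> P ` A \<union> C \<union> h ` C" for x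
      unfolding K_def using that *(2,5) by (intro Max_ge) auto
    have far: "\<exists>N\<ge>B. \<forall>a\<in>A. \<forall>u\<in>C. 0 dvd rk a + N - rk u \<longleftrightarrow> 0 dvd rk (P a) + N - rk (h u)" for B
    proof (intro exI[of _ "max B (2 * K + 1)"] conjI ballI)
      fix a u assume au: "a \<in> A" "u \<in> C"
      have "\<bar>rk a\<bar> \<le> K" "\<bar>rk u\<bar> \<le> K" "\<bar>rk (P a)\<bar> \<le> K" "\<bar>rk (h u)\<bar> \<le> K"
        using K au by auto
      then show "0 dvd rk a + max B (2 * K + 1) - rk u \<longleftrightarrow>
          0 dvd rk (P a) + max B (2 * K + 1) - rk (h u)"
        by auto
    qed simp
    obtain h' N where h': "h' \<in> Auts" "\<And>u. u \<in> C \<Longrightarrow> h' u = h u"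
      "\<And>a. a \<in> A \<Longrightarrow> h' (shift N a) = shift N (P a)"
      by (rule far_conjugate[OF *(1,4,5,6,2,3) rk far]) auto
    have "word_eval G f h' [(LetterA, - N), (LetterB, 1), (LetterA, N)] a = P a" if "a \<in> A" for a
      by (rule conjugate_word) (use h' * that in auto)
    then show "\<exists>h'\<in>Auts. (\<forall>u\<in>C. h' u = h u) \<and> (\<exists>w. \<forall>a\<in>A. word_eval G f h' w a = P a)"
      using h'(1,2) by blast
  next
    show "\<exists>h'\<in>Auts. (\<forall>u\<in>C. h' u = h u) \<and> (\<exists>x\<in>H. word_eval G f h' w x \<noteq> x)"
      if "h \<in> Auts" "finite C" "C \<subseteq> H" "irreducible_word w" for h C w
      by (rule free_chain_union[OF cu that])
  qed auto
qed

end

subsection \<open>Finitely many chains\<close>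

text \<open>
  The shift permutes the chains cyclically, and \<open>h\<close> exchanges two neighbouring chains.  Conjugates of the transposition by
  powers of the cycle exchange any two neighbours, these generate the transpositions of \<open>0\<close> and \<open>k\<close>, and
  so all permutations of the chains are induced by words.
\<close>

lemma (in shifted_frame) chain_permutations_realized:
  assumes cu: chain_union and n: "n > 1"
    and pc: "\<And>x r lo hi. x \<in> H \<Longrightarrow> pos x r lo hi \<Longrightarrow> comparable x (c r)"
    and cc: "\<And>i j. comparable (c i) (c j) \<longleftrightarrow> n dvd j - i"
    and h: "h \<in> Auts" "comparable (h (c 0)) (c 1)" "comparable (h (c 1)) (c 0)"
      "\<And>i. 2 \<le> i \<Longrightarrow> i < n \<Longrightarrow> comparable (h (c i)) (c i)"
    and u: "u \<in> Auts"
  obtains w where "\<And>x. x \<in> H \<Longrightarrow> comparable (word_eval G f h w x) (u x)"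
proof -
  have tr: "comparable x z" if "comparable x y" "comparable y z" "x \<in> H" "y \<in> H" "z \<in> H" for x y z
    using cu that unfolding chain_union_def by blast
  define I where "I = {0..<n}"
  have W [simp]: "word_eval G f h w \<in> Auts" for w using f h(1) by simp
  define realized where "realized q \<longleftrightarrow> (\<exists>w. \<forall>i\<in>I. comparable (word_eval G f h w (c i)) (c (q i)))"
    for q
  have realized_comp: "realized (p \<circ> q)" if p: "realized p" and q: "realized q" "q permutes I" for p q
  proof -
    obtain v where v: "\<forall>i\<in>I. comparable (word_eval G f h v (c i)) (c (p i))"
      using p unfolding realized_def by blast
    obtain w where w: "\<forall>i\<in>I. comparable (word_eval G f h w (c i)) (c (q i))"
      using q(1) unfolding realized_def by blast
    have "comparable (word_eval G f h (v @ w) (c i)) (c ((p \<circ> q) i))" if i: "i \<in> I" for i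
    proof -
      have qi: "q i \<in> I" using i q(2) by (simp add: permutes_in_image)
      have "comparable (word_eval G f h v (word_eval G f h w (c i))) (word_eval G f h v (c (q i)))"
        using w i by simp
      then have "comparable (word_eval G f h v (word_eval G f h w (c i))) (c (p (q i)))"
        by (rule tr) (use v qi in auto)
      then show ?thesis using word_eval_append[OF f h(1)] by simp
    qed
    then show ?thesis unfolding realized_def by blast
  qed
  have realized_id: "realized id"
    unfolding realized_def by (intro exI[of _ "[]"]) simp
  have step: "realized (Transposition.transpose i (i + 1))" if i: "i \<in> I" "i + 1 \<in> I" for i
  proof -
    let ?w = "[(LetterA, i), (LetterB, 1), (LetterA, - i)]"
    have eval: "word_eval G f h ?w (c j) = shift i (h (c (j - i)))" for j
      using h(1) shift_c[of "- i" j] by simp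
    have "comparable (word_eval G f h ?w (c j)) (c (Transposition.transpose i (i + 1) j))"
      if j: "j \<in> I" for j
    proof -
      have push: "comparable (shift i (h (c (j - i)))) (c (k + i))"
        if "comparable (h (c (j - i))) (c k)" for k
        using that h(1) shift_c[of i k] aut_comparable[of "shift i" "h (c (j - i))" "c k"] by simp
      consider "j = i" | "j = i + 1" | "j \<noteq> i" "j \<noteq> i + 1" by blast
      then show ?thesis
      proof cases
        case 1
        then show ?thesis using push[of 1] h(2) eval by (simp add: add.commute)
      next
        case 2
        then show ?thesis using push[of 0] h(3) eval by simp
      next
        case 3
        define m where "m = (j - i) mod n"
        have m: "0 \<le> m" "m < n" using n by (auto simp: m_def)
        have dv: "n dvd m - (j - i)" by (simp add: m_def mod_eq_dvd_iff[symmetric])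
        have small: "\<bar>j - i\<bar> < n" "\<bar>j - i - 1\<bar> < n" using i j by (auto simp: I_def)
        have "m \<noteq> 0"
        proof
          assume "m = 0"
          then have "n dvd j - i" using dv by (simp add: dvd_diff_commute)
          then show False using small(1) 3(1) zdvd_not_zless[of "\<bar>j - i\<bar>" n] by auto
        qed
        moreover have "m \<noteq> 1"
        proof
          assume "m = 1"
          then have "n dvd j - i - 1" using dv by (simp add: dvd_diff_commute algebra_simps)
          then show False using small(2) 3(2) zdvd_not_zless[of "\<bar>j - i - 1\<bar>" n] by auto
        qed
        ultimately have hm: "comparable (h (c m)) (c m)" using h(4)[of m] m by linarith
        have cm: "comparable (c (j - i)) (c m)" using cc dv by simp
        have "comparable (h (c (j - i))) (h (c m))" using cm h(1) by simp
        then have "comparable (h (c (j - i))) (c m)" by (rule tr[OF _ hm]) (use h(1) in auto)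
        then have "comparable (h (c (j - i))) (c (j - i))"
          by (rule tr[OF _ comparable_sym[OF cm]]) (use h(1) in auto)
        then show ?thesis using push[of "j - i"] 3 eval by simp
      qed
    qed
    then show ?thesis unfolding realized_def by blast
  qed
  have from_0: "int k < n \<Longrightarrow> realized (Transposition.transpose 0 (int k))" for k
  proof (induction k)
    case 0
    then show ?case using realized_id by (simp add: id_def)
  next
    case (Suc k)
    show ?case
    proof (cases "k = 0")
      case True
      then show ?thesis using step[of 0] n by (simp add: I_def)
    next
      case False
      let ?t = "Transposition.transpose (int k) (int k + 1)"
      have kI: "int k \<in> I" "int k + 1 \<in> I" "0 \<in> I" using Suc.prems by (auto simp: I_def)
      have t: "realized ?t" "?t permutes I" using step[OF kI(1,2)] permutes_swap_id[OF kI(1,2)] by auto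
      have z: "realized (Transposition.transpose 0 (int k))" using Suc by simp
      have zp: "Transposition.transpose 0 (int k) permutes I" by (rule permutes_swap_id[OF kI(3,1)])
      have "?t \<circ> (Transposition.transpose 0 (int k) \<circ> ?t) = Transposition.transpose 0 (int (Suc k))"
        using False by (auto simp: fun_eq_iff Transposition.transpose_def)
      moreover have "realized (?t \<circ> (Transposition.transpose 0 (int k) \<circ> ?t))"
        by (intro realized_comp permutes_compose t z zp)
      ultimately show ?thesis by simp
    qed
  qed
  have transp: "realized (Transposition.transpose a b)" if ab: "a \<in> I" "b \<in> I" "a \<noteq> b" for a b
  proof -
    have z: "realized (Transposition.transpose 0 a)" "realized (Transposition.transpose 0 b)"
      using from_0[of "nat a"] from_0[of "nat b"] ab by (auto simp: I_def)
    have I0: "0 \<in> I" using n by (simp add: I_def)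
    show ?thesis
    proof (cases "a = 0 \<or> b = 0")
      case True
      then show ?thesis using z by (auto simp: transpose_commute)
    next
      case False
      have "Transposition.transpose 0 a \<circ> (Transposition.transpose 0 b \<circ> Transposition.transpose 0 a)
          = Transposition.transpose a b"
        using False ab(3) by (auto simp: fun_eq_iff Transposition.transpose_def)
      moreover have "realized (Transposition.transpose 0 a \<circ>
          (Transposition.transpose 0 b \<circ> Transposition.transpose 0 a))"
        by (intro realized_comp permutes_compose z permutes_swap_id I0 ab(1,2))
      ultimately show ?thesis by simp
    qed
  qed
  have fin_I: "finite I" by (simp add: I_def)
  have all: "realized q" if "q permutes I" for q
    using that fin_I
  proof (induction rule: permutes_induct)
    show "realized id" by (rule realized_id)
    show "realized (Transposition.transpose a b \<circ> p)"
      if "a \<in> I" "b \<in> I" "a \<noteq> b" "realized p" "p permutes I" for a b p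
      by (rule realized_comp[OF transp]) (use that in auto)
  qed
  have idx: "\<exists>i\<in>I. comparable x (c i)" if x: "x \<in> H" for x
  proof -
    obtain r where r: "comparable x (c r)" using pos_ex[OF x] pc[OF x] by blast
    have "comparable (c r) (c (r mod n))" using cc by (simp add: mod_eq_dvd_iff[symmetric])
    then have "comparable x (c (r mod n))" using tr[OF r] x by simp
    moreover have "r mod n \<in> I" using n by (simp add: I_def)
    ultimately show ?thesis by blast
  qed
  have uniq: "i = j" if "i \<in> I" "j \<in> I" "comparable (c i) (c j)" for i j
  proof -
    have "n dvd j - i" "\<bar>j - i\<bar> < n" using that cc by (auto simp: I_def)
    then show ?thesis using zdvd_not_zless[of "\<bar>j - i\<bar>" n] by auto
  qed
  define q where "q i = (if i \<in> I then SOME k. k \<in> I \<and> comparable (u (c i)) (c k) else i)" for i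
  have q: "q i \<in> I \<and> comparable (u (c i)) (c (q i))" if i: "i \<in> I" for i
  proof -
    have "\<exists>k. k \<in> I \<and> comparable (u (c i)) (c k)" using idx[of "u (c i)"] u by auto
    then have "(SOME k. k \<in> I \<and> comparable (u (c i)) (c k)) \<in> I \<and>
        comparable (u (c i)) (c (SOME k. k \<in> I \<and> comparable (u (c i)) (c k)))"
      by (rule someI_ex)
    then show ?thesis using i by (simp add: q_def)
  qed
  have "inj_on q I"
  proof (rule inj_onI)
    fix i j assume ij: "i \<in> I" "j \<in> I" "q i = q j"
    have "comparable (u (c i)) (u (c j))"
      by (rule tr[of _ "c (q i)"]) (use q[OF ij(1)] q[OF ij(2)] ij(3) u comparable_sym in auto)
    then show "i = j" using uniq[OF ij(1,2)] u by simp
  qed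
  moreover have "q ` I \<subseteq> I" using q by blast
  ultimately have "bij_betw q I I" unfolding bij_betw_def using endo_inj_surj[OF fin_I] by blast
  then have "q permutes I" by (rule bij_imp_permutes) (simp add: q_def)
  then obtain w where w: "\<forall>i\<in>I. comparable (word_eval G f h w (c i)) (c (q i))"
    using all unfolding realized_def by blast
  show ?thesis
  proof (rule that)
    fix x assume x: "x \<in> H"
    obtain i where i: "i \<in> I" "comparable x (c i)" using idx[OF x] by blast
    have 1: "comparable (word_eval G f h w x) (word_eval G f h w (c i))" using i x by simp
    have 2: "comparable (word_eval G f h w (c i)) (c (q i))" using w i(1) by blast
    have 3: "comparable (c (q i)) (u (c i))" using q[OF i(1)] comparable_sym by blast
    have 4: "comparable (u (c i)) (u x)" using i x u comparable_sym by simp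
    have H: "word_eval G f h w x \<in> H" "word_eval G f h w (c i) \<in> H" "u (c i) \<in> H" "u x \<in> H"
      using x u by auto
    show "comparable (word_eval G f h w x) (u x)"
      using tr[OF tr[OF tr[OF 1 2] 3] 4] H by simp
  qed
qed

context homogeneous_poset
begin

lemma below_everywhere:
  assumes "v \<in> H" "w \<in> H" "lt v w" "x \<in> H"
  obtains y where "y \<in> H" "lt y x"
proof -
  interpret D: homogeneous_poset H "\<lambda>x y. lt y x" by (rule dual)
  show ?thesis using D.above_everywhere[OF assms(2,1,3,4)] that by blast
qed

lemma chain_cofinal_sequence:
  assumes cu: chain_union and vw: "v \<in> H" "w \<in> H" "lt v w" and r: "r \<in> H"
  obtains c :: "int \<Rightarrow> 'a" where "\<And>i. c i \<in> H" "\<And>i. comparable r (c i)"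
    "\<And>i j. lt (c i) (c j) \<longleftrightarrow> i < j"
    "\<And>y. y \<in> H \<Longrightarrow> comparable r y \<Longrightarrow> \<exists>i j. lt (c i) y \<and> lt y (c j)"
proof -
  define Y where "Y = {y \<in> H. comparable r y}"
  have tr: "comparable x z" if "comparable x y" "comparable y z" "x \<in> H" "y \<in> H" "z \<in> H" for x y z
    using cu that unfolding chain_union_def by blast
  have dir: "(\<exists>z\<in>Y. lt x z \<and> lt y z) \<and> (\<exists>z\<in>Y. lt z x \<and> lt z y)" if xy: "x \<in> Y" "y \<in> Y" for x y
  proof -
    have H: "x \<in> H" "y \<in> H" "comparable r x" "comparable r y" using xy by (auto simp: Y_def)
    have cxy: "comparable x y" using tr[OF comparable_sym[OF H(3)] H(4)] H r by blast
    have inY: "z \<in> Y" if "z \<in> H" "lt x z \<or> lt z x" for z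
      using that tr[OF H(3), of z] H r by (auto simp: Y_def comparable_def)
    obtain a where a: "a \<in> H" "a = x \<or> a = y" "x = a \<or> lt x a" "y = a \<or> lt y a"
      using cxy H unfolding comparable_def by blast
    obtain z where z: "z \<in> H" "lt a z" using above_everywhere[OF vw a(1)] by blast
    have "lt x z" "lt y z" using a z H lt_trans[of x a z] lt_trans[of y a z] by auto
    moreover obtain b where b: "b \<in> H" "x = b \<or> lt b x" "y = b \<or> lt b y"
      using cxy H unfolding comparable_def by blast
    obtain z' where z': "z' \<in> H" "lt z' b" using below_everywhere[OF vw b(1)] by blast
    have "lt z' x" "lt z' y" using b z' H lt_trans[of z' b x] lt_trans[of z' b y] by auto
    ultimately show ?thesis using inY z(1) z'(1) by blast
  qed
  have YH: "Y \<subseteq> H" and Yne: "Y \<noteq> {}" using r by (auto simp: Y_def)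
  obtain c :: "int \<Rightarrow> 'a" where c: "\<And>i. c i \<in> Y" "\<And>i j. lt (c i) (c j) \<longleftrightarrow> i < j"
    "\<And>y. y \<in> Y \<Longrightarrow> \<exists>i j. lt (c i) y \<and> lt y (c j)"
    using cofinal_coinitial_sequence[OF YH Yne] dir by blast
  show ?thesis by (rule that[of c]) (use c in \<open>auto simp: Y_def\<close>)
qed

theorem finitely_many_chains_generated:
  assumes cu: chain_union and R: "R \<subseteq> H" "\<And>x. x \<in> H \<Longrightarrow> \<exists>r\<in>R. comparable x r"
    "\<And>r r'. r \<in> R \<Longrightarrow> r' \<in> R \<Longrightarrow> comparable r r' \<Longrightarrow> r = r'"
    and fin: "finite R" and ndir: "\<not> directed"
  shows "freely_topologically_2_generated G (Aut_topology H lt)"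
proof -
  have tr: "comparable x z" if "comparable x y" "comparable y z" "x \<in> H" "y \<in> H" "z \<in> H" for x y z
    using cu that unfolding chain_union_def by blast
  have "\<not> H \<subseteq> R" using infinite_H fin finite_subset by blast
  then obtain x where x: "x \<in> H" "x \<notin> R" by blast
  then obtain r where "r \<in> R" "comparable x r" using R(2) by blast
  then obtain v w where vw: "v \<in> H" "w \<in> H" "lt v w"
    using x R(1) unfolding comparable_def by blast
  define n where "n = int (card R)"
  obtain g where g: "bij_betw g {0..<card R} R" using ex_bij_betw_nat_finite[OF fin] by blast
  have gR: "g k \<in> R" if "k < card R" for k using g that by (auto simp: bij_betw_def)
  have "\<forall>k\<in>{0..<card R}. \<exists>d. (\<forall>i::int. d i \<in> H \<and> comparable (g k) (d i)) \<and>
      (\<forall>i j. lt (d i) (d j) \<longleftrightarrow> i < j) \<and>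
      (\<forall>y\<in>H. comparable (g k) y \<longrightarrow> (\<exists>i j. lt (d i) y \<and> lt y (d j)))"
  proof
    fix k assume "k \<in> {0..<card R}"
    then have "g k \<in> H" using gR R(1) by auto
    then obtain d :: "int \<Rightarrow> 'a" where "\<And>i. d i \<in> H" "\<And>i. comparable (g k) (d i)"
      "\<And>i j. lt (d i) (d j) \<longleftrightarrow> i < j"
      "\<And>y. y \<in> H \<Longrightarrow> comparable (g k) y \<Longrightarrow> \<exists>i j. lt (d i) y \<and> lt y (d j)"
      using chain_cofinal_sequence[OF cu vw] by blast
    then show "\<exists>d. (\<forall>i::int. d i \<in> H \<and> comparable (g k) (d i)) \<and>
      (\<forall>i j. lt (d i) (d j) \<longleftrightarrow> i < j) \<and>
      (\<forall>y\<in>H. comparable (g k) y \<longrightarrow> (\<exists>i j. lt (d i) y \<and> lt y (d j)))" by blast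
  qed
  from bchoice[OF this] obtain d :: "nat \<Rightarrow> int \<Rightarrow> 'a" where
    d_all: "\<forall>k\<in>{0..<card R}. (\<forall>i. d k i \<in> H \<and> comparable (g k) (d k i)) \<and>
      (\<forall>i j. lt (d k i) (d k j) \<longleftrightarrow> i < j) \<and>
      (\<forall>y\<in>H. comparable (g k) y \<longrightarrow> (\<exists>i j. lt (d k i) y \<and> lt y (d k j)))"
    by blast
  have d: "d k i \<in> H" "comparable (g k) (d k i)" "lt (d k i) (d k j) \<longleftrightarrow> i < j"
    "y \<in> H \<Longrightarrow> comparable (g k) y \<Longrightarrow> \<exists>i j. lt (d k i) y \<and> lt y (d k j)"
    if "k < card R" for k i j y
    using bspec[OF d_all, of k] that by simp_all
  have "R \<noteq> {}" using R(2)[OF x(1)] by blast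
  then have n0: "n > 0" using fin by (simp add: n_def card_gt_0_iff)
  define c where "c i = d (nat (i mod n)) (i div n)" for i
  have res: "nat (i mod n) < card R" for i
    using n0 pos_mod_bound[OF n0, of i] pos_mod_sign[OF n0, of i] by (simp add: n_def nat_less_iff)
  have cH: "c i \<in> H" for i using d(1)[OF res] by (simp add: c_def)
  have cg: "comparable (g (nat (i mod n))) (c i)" for i using d(2)[OF res] by (simp add: c_def)
  have gH: "g (nat (i mod n)) \<in> H" for i using gR[OF res] R(1) by blast
  have cc: "comparable (c i) (c j) \<longleftrightarrow> n dvd j - i" for i j
  proof
    assume "comparable (c i) (c j)"
    then have "comparable (g (nat (i mod n))) (c j)" using tr[OF cg[of i]] cH gH by blast
    then have "comparable (g (nat (i mod n))) (g (nat (j mod n)))"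
      using tr[OF _ comparable_sym[OF cg[of j]]] cH gH by blast
    then have "g (nat (i mod n)) = g (nat (j mod n))" using R(3) gR res by blast
    then have "nat (i mod n) = nat (j mod n)"
      using g res unfolding bij_betw_def by (auto dest: inj_onD)
    then have "i mod n = j mod n" using n0 by (simp add: eq_nat_nat_iff)
    then show "n dvd j - i" by (metis mod_eq_dvd_iff)
  next
    assume "n dvd j - i"
    then have "j mod n = i mod n" by (simp add: mod_eq_dvd_iff)
    then show "comparable (c i) (c j)"
      using tr[OF comparable_sym[OF cg[of i]], of "c j"] cg[of j] cH gH by metis
  qed
  have cl: "lt (c i) (c j) \<longleftrightarrow> i < j \<and> n dvd j - i" for i j
  proof (cases "n dvd j - i")
    case True
    then have eq: "j mod n = i mod n" by (simp add: mod_eq_dvd_iff)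
    have "lt (c i) (c j) \<longleftrightarrow> i div n < j div n" using d(3)[OF res] eq by (simp add: c_def)
    moreover have "i = n * (i div n) + i mod n" "j = n * (j div n) + i mod n"
      using eq by (metis mult_div_mod_eq)+
    then have "i < j \<longleftrightarrow> n * (i div n) < n * (j div n)" by linarith
    then have "i div n < j div n \<longleftrightarrow> i < j" using n0 by simp
    ultimately show ?thesis using True by simp
  next
    case False
    then show ?thesis using cc by (auto simp: comparable_def)
  qed
  have cof: "\<exists>i j. lt (c i) y \<and> lt y (c j)" if y: "y \<in> H" for y
  proof -
    obtain r where r: "r \<in> R" "comparable y r" using R(2)[OF y] by blast
    then have "r \<in> g ` {0..<card R}" using g by (simp add: bij_betw_def)
    then obtain k where k: "k < card R" "r = g k" by auto
    then obtain i j where ij: "lt (d k i) y" "lt y (d k j)"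
      using d(4)[OF k(1) y] comparable_sym[OF r(2)] k(2) by blast
    have "c (n * i + int k) = d k i" for i
    proof -
      have "int k < n" using k(1) by (simp add: n_def)
      then have "(n * i + int k) mod n = int k" "(n * i + int k) div n = i" using n0 by auto
      then show ?thesis by (simp add: c_def)
    qed
    then show ?thesis using ij by metis
  qed
  interpret frame H lt c n "squeezed c n"
    by (rule frame_of_cofinal_sequence[OF n0 cH cl cof disjI2[OF cu]])
  obtain f where f: "f \<in> Auts" "\<And>i. f (c i) = c (i + 1)" using shift_exists by blast
  interpret shifted_frame H lt c n "squeezed c n" f
    by unfold_locales (use f in auto)
  have pc: "comparable x (c r)" if x: "x \<in> H" and p: "squeezed c n x r lo hi" for x r lo hi
  proof -
    obtain i where i: "n dvd i - r" "c i = x \<or> lt (c i) x" using p unfolding squeezed_def by blast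
    have "comparable x (c i)" using i(2) by (auto simp: comparable_def)
    moreover have "comparable (c i) (c r)" using cc i(1) dvd_diff_commute by blast
    ultimately show ?thesis using tr x cH by blast
  qed
  obtain rk where rk: "\<And>x. x \<in> H \<Longrightarrow> \<exists>lo hi. squeezed c n x (rk x) lo hi" using pos_ex by metis
  have rkc: "comparable x (c (rk x))" if "x \<in> H" for x using rk[OF that] pc[OF that] by blast
  have rk_dvd: "n dvd rk x - rk y \<longleftrightarrow> comparable x y" if xy: "x \<in> H" "y \<in> H" for x y
  proof -
    have "n dvd rk x - rk y \<longleftrightarrow> comparable (c (rk y)) (c (rk x))" by (rule cc[symmetric])
    also have "\<dots> \<longleftrightarrow> comparable x y"
    proof
      assume "comparable (c (rk y)) (c (rk x))"
      then have "comparable y (c (rk x))" using tr[OF rkc[OF xy(2)]] xy cH by blast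
      then show "comparable x y"
        using tr[OF rkc[OF xy(1)] comparable_sym] xy cH by blast
    next
      assume "comparable x y"
      then have "comparable (c (rk y)) x"
        using tr[OF comparable_sym[OF rkc[OF xy(2)]] comparable_sym] xy cH by blast
      then show "comparable (c (rk y)) (c (rk x))" using tr[OF _ rkc[OF xy(1)]] xy cH by blast
    qed
    finally show ?thesis .
  qed
  have n1: "n > 1"
  proof (rule ccontr)
    assume "\<not> n > 1"
    then have n1: "n = 1" using n0 by linarith
    have "directed"
      unfolding directed_def
    proof (intro ballI)
      fix x y assume xy: "x \<in> H" "y \<in> H"
      obtain i i' where i: "lt (c i) x" "lt x (c i')" using cof[OF xy(1)] by blast
      obtain j j' where j: "lt (c j) y" "lt y (c j')" using cof[OF xy(2)] by blast
      have le: "lt z (c m)" if "z \<in> H" "lt z (c l)" "l \<le> m" for z l m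
        using that cl[of l m] lt_trans[of z "c l" "c m"] cH n1 by (cases "l = m") auto
      have ge: "lt (c m) z" if "z \<in> H" "lt (c l) z" "m \<le> l" for z l m
        using that cl[of m l] lt_trans[of "c m" "c l" z] cH n1 by (cases "l = m") auto
      have "lt x (c (max i' j'))" "lt y (c (max i' j'))" using le xy i j by auto
      moreover have "lt (c (min i j)) x" "lt (c (min i j)) y" using ge xy i j by auto
      ultimately show "(\<exists>z\<in>H. lt x z \<and> lt y z) \<and> (\<exists>z\<in>H. lt z x \<and> lt z y)" using cH by blast
    qed
    then show False using ndir by blast
  qed
  \<comment> \<open>The second generator is started as the transposition of the chains of \<open>c 0\<close> and \<open>c 1\<close>.\<close>
  define C0 where "C0 = c ` {0..<n}"
  have C0: "finite C0" "C0 \<subseteq> H" using cH by (auto simp: C0_def)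
  have C0_apart: "i = j" if "i \<in> {0..<n}" "j \<in> {0..<n}" "comparable (c i) (c j)" for i j
  proof -
    have "n dvd j - i" "\<bar>j - i\<bar> < n" using that cc by auto
    then show ?thesis using zdvd_not_zless[of "\<bar>j - i\<bar>" n] by auto
  qed
  define t where "t x = (if x = c 0 then c 1 else if x = c 1 then c 0 else x)" for x
  have c01: "c 0 \<noteq> c 1" using C0_apart[of 0 1] n1 by auto
  have tC0: "t x \<in> C0" if "x \<in> C0" for x using that n1 by (auto simp: t_def C0_def)
  have C0_anti: "\<not> lt x y" if xy: "x \<in> C0" "y \<in> C0" for x y
  proof
    assume "lt x y"
    moreover obtain i j where "x = c i" "y = c j" "i \<in> {0..<n}" "j \<in> {0..<n}"
      using xy by (auto simp: C0_def)
    ultimately show False using C0_apart[of i j] lt_irrefl[OF cH] by (auto simp: comparable_def)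
  qed
  obtain h0 where h0: "h0 \<in> Auts" "\<And>x. x \<in> C0 \<Longrightarrow> h0 x = t x"
  proof (rule extend[of C0 t])
    show "t x \<in> H" if "x \<in> C0" for x using tC0[OF that] C0(2) by blast
    show "lt (t x) (t y) \<longleftrightarrow> lt x y" if "x \<in> C0" "y \<in> C0" for x y
      using C0_anti tC0 that by blast
    show "x = y" if "x \<in> C0" "y \<in> C0" "t x = t y" for x y
      using that(3) c01 by (auto simp: t_def split: if_splits)
  qed (use C0 in blast)+
  show ?thesis
  proof (rule generated_by_generic[OF f(1) h0(1) C0])
    fix h C P A
    assume *: "h \<in> Auts" "finite C" "C \<subseteq> H" "\<And>x. x \<in> C0 \<Longrightarrow> h x = h0 x" "P \<in> Auts"
      "finite A" "A \<subseteq> H"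
    have hc: "h (c i) = t (c i)" if "0 \<le> i" "i < n" for i
      using *(4)[of "c i"] h0(2)[of "c i"] that by (simp add: C0_def)
    have h01: "comparable (h (c 0)) (c 1)" "comparable (h (c 1)) (c 0)"
      using hc[of 0] hc[of 1] n1 c01 by (auto simp: t_def)
    have h2: "comparable (h (c i)) (c i)" if i: "2 \<le> i" "i < n" for i
    proof -
      have "c i \<noteq> c 0" "c i \<noteq> c 1" using C0_apart[of i 0] C0_apart[of i 1] i by auto
      then show ?thesis using hc[of i] i by (simp add: t_def)
    qed
    have Ph: "P \<otimes>\<^bsub>G\<^esub> inv\<^bsub>G\<^esub> h \<in> Auts" using * by simp
    \<comment> \<open>The word \<open>v\<close> is chosen such that \<open>P' = v\<^sup>-\<^sup>1 P\<close> permutes the chains as \<open>h\<close> does.\<close>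
    obtain v where v: "\<And>x. x \<in> H \<Longrightarrow>
        comparable (word_eval G f h v x) ((P \<otimes>\<^bsub>G\<^esub> inv\<^bsub>G\<^esub> h) x)"
    proof (rule chain_permutations_realized[OF cu n1 _ cc *(1) h01 h2 Ph])
      show "comparable x (c r)" if "x \<in> H" "squeezed c n x r lo hi" for x r lo hi
        using pc that .
    qed (use that in blast)+
    define V where "V = word_eval G f h v"
    have V: "V \<in> Auts" using f(1) *(1) by (simp add: V_def)
    define P' where "P' = inv\<^bsub>G\<^esub> V \<otimes>\<^bsub>G\<^esub> P"
    have P': "P' \<in> Auts" using V *(5) by (simp add: P'_def)
    have VP: "V (P' x) = P x" if "x \<in> H" for x using that V *(5) by (simp add: P'_def)
    have like_h: "comparable (h x) (P' x)" if x: "x \<in> H" for x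
    proof -
      have "comparable (V (h x)) (V (P' x))"
        using v[of "h x"] VP[OF x] x *(1,5) by (simp add: V_def)
      then show ?thesis using V P' *(1) x by simp
    qed
    have P'A: "finite (P' ` A)" "P' ` A \<subseteq> H" using *(6,7) P' by auto
    obtain C1 where C1: "finite C1" "C1 \<subseteq> H"
      "\<And>g' x. g' \<in> Auts \<Longrightarrow> (\<And>u. u \<in> C1 \<Longrightarrow> g' u = h u) \<Longrightarrow> x \<in> P' ` A \<Longrightarrow>
        word_eval G f g' v x = word_eval G f h v x"
      using word_eval_continuous[OF f(1) *(1) P'A, of v] by blast
    have CC: "finite (C \<union> C1)" "C \<union> C1 \<subseteq> H" using *(2,3) C1(1,2) by auto
    \<comment> \<open>A shift by a multiple of \<open>n\<close> preserves each chain, so residues are compatible because \<open>P'\<close> and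
      \<open>h\<close> permute the chains in the same way.\<close>
    have far: "\<exists>N\<ge>B. \<forall>a\<in>A. \<forall>u\<in>C \<union> C1. n dvd rk a + N - rk u \<longleftrightarrow> n dvd rk (P' a) + N - rk (h u)"
      for B
    proof (intro exI[of _ "n * \<bar>B\<bar>"] conjI ballI)
      have "\<bar>B\<bar> \<le> n * \<bar>B\<bar>" using n1 by (simp add: mult_le_cancel_right1)
      then show "B \<le> n * \<bar>B\<bar>" by linarith
      fix a u assume "a \<in> A" "u \<in> C \<union> C1"
      then have H: "a \<in> H" "u \<in> H" "h u \<in> H" "h a \<in> H" "P' a \<in> H" using *(1,7) CC(2) P' by auto
      have drop: "n dvd i + n * \<bar>B\<bar> - j \<longleftrightarrow> n dvd i - j" for i j
      proof -
        have "i + n * \<bar>B\<bar> - j = (i - j) + n * \<bar>B\<bar>" by simp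
        then show ?thesis by (metis dvd_add_left_iff dvd_triv_left)
      qed
      have "comparable (P' a) (h u) \<longleftrightarrow> comparable (h a) (h u)"
        using tr[of "h a" "P' a" "h u"] tr[of "P' a" "h a" "h u"] like_h[OF H(1)] comparable_sym H
        by blast
      then have "comparable (P' a) (h u) \<longleftrightarrow> comparable a u" using H(1,2) *(1) by simp
      then show "n dvd rk a + n * \<bar>B\<bar> - rk u \<longleftrightarrow> n dvd rk (P' a) + n * \<bar>B\<bar> - rk (h u)"
        unfolding drop using rk_dvd H by blast
    qed
    obtain h' N where h': "h' \<in> Auts" "\<And>u. u \<in> C \<union> C1 \<Longrightarrow> h' u = h u"
      "\<And>a. a \<in> A \<Longrightarrow> h' (shift N a) = shift N (P' a)"
      by (rule far_conjugate[OF *(1) P' *(6,7) CC rk far]) auto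
    have "word_eval G f h' (v @ [(LetterA, - N), (LetterB, 1), (LetterA, N)]) a = P a"
      if a: "a \<in> A" for a
    proof -
      have aH: "a \<in> H" using a *(7) by blast
      have "word_eval G f h' (v @ [(LetterA, - N), (LetterB, 1), (LetterA, N)]) a =
          word_eval G f h' v (word_eval G f h' [(LetterA, - N), (LetterB, 1), (LetterA, N)] a)"
        unfolding word_eval_append[OF f(1) h'(1)]
        by (rule mult_apply) (use f(1) h'(1) aH word_eval_closed in blast)+
      also have "word_eval G f h' [(LetterA, - N), (LetterB, 1), (LetterA, N)] a = P' a"
        by (rule conjugate_word) (use h' P' a aH in auto)
      also have "word_eval G f h' v (P' a) = V (P' a)"
        unfolding V_def by (rule C1(3)[OF h'(1)]) (use h'(2) a in auto)
      finally show ?thesis using VP aH by simp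
    qed
    then show "\<exists>h'\<in>Auts. (\<forall>u\<in>C. h' u = h u) \<and> (\<exists>w. \<forall>a\<in>A. word_eval G f h' w a = P a)"
      using h'(1,2) by blast
  next
    show "\<exists>h'\<in>Auts. (\<forall>u\<in>C. h' u = h u) \<and> (\<exists>x\<in>H. word_eval G f h' w x \<noteq> x)"
      if "h \<in> Auts" "finite C" "C \<subseteq> H" "irreducible_word w" for h C w
      by (rule free_chain_union[OF cu that])
  qed
qed

theorem generated: "freely_topologically_2_generated G (Aut_topology H lt)"
proof (cases directed)
  case True
  then show ?thesis by (rule directed_generated)
next
  case False
  then have cu: chain_union using directed_or_chain_union by blast
  obtain R where R: "R \<subseteq> H" "\<And>x. x \<in> H \<Longrightarrow> \<exists>r\<in>R. comparable x r"
    "\<And>r r'. r \<in> R \<Longrightarrow> r' \<in> R \<Longrightarrow> comparable r r' \<Longrightarrow> r = r'"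
    using chain_representatives[OF cu] by blast
  show ?thesis
    using infinitely_many_chains_generated[OF cu R] finitely_many_chains_generated[OF cu R _ False]
    by blast
qed

end

section \<open>Free dense subgroups with two generators\<close>

theorem theorem1p2:
  fixes H :: "'a set" and lt :: "'a \<Rightarrow> 'a \<Rightarrow> bool"
  assumes "strict_poset H lt"
    and "countable H" and "infinite H"
    and "ultrahomogeneous H lt"
  shows "freely_topologically_2_generated (Aut_group H lt) (Aut_topology H lt)"
proof -
  interpret homogeneous_poset H lt
    using assms by (rule homogeneous_poset.intro)
  show ?thesis by (rule generated)
qed

end
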